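(* Assume that $B(t)A(t)\in\mathcal{MR}$ for every $t\in[0,T]$. Then the family $\{A(t)B(t),\ t\in[0,T]\}$ has $L^p$-maximal regularity on $(0,T)$ for every $p\in(1,\infty)$. In particular, for each $(f,x_0)\in L^p(0,T;X)\times Tr$ there exists a unique $u\in MR_B(p,X)$ satisfying $$\dot u(t)+A(t)B(t)u(t)=f(t)\ \text{ for a.e. } t\in[0,T],\qquad B(0)u(0)=x_0.$$ Moreover $t\mapsto B(t)u(t)$ belongs to $C([0,T];Tr)$.
   Context: $X$ and $D$ are Banach spaces, $D$ is continuously and densely embedded in $X$, and $X$ has the Radon–Nikodým property; $T>0$, $p\in(1,\infty)$. An operator $C\in\mathcal L(D,X)$ belongs to $\mathcal{MR}$ ($L^p$-maximal regularity) if for every $f\in L^p(0,T;X)$ there is a unique $u\in MR(p,X):=L^p(0,T;D)\cap W^{1,p}(0,T;X)$ with $\dot u+Cu=f$ a.e. and $u(0)=0$ (this property is independent of $p\in(1,\infty)$ and $T$). Trace space: $Tr:=\{u(0):u\in MR(p,X)\}$ with norm $\|x\|_{Tr}=\inf\{\|u\|_{L^p(0,T;D)}+\|u\|_{W^{1,p}(0,T;X)}:u(0)=x\}$. A function $A:[0,T]\to\mathcal L(D,X)$ is relatively continuous if for each $t$ and $\varepsilon>0$ there are $\delta>0,\eta\ge0$ with $\|A(t)x-A(s)x\|\le\varepsilon\|x\|_D+\eta\|x\|$ for all $x\in D$ whenever $|t-s|\le\delta$. Standing assumptions: $A:[0,T]\to\mathcal L(D,X)$ is strongly measurable and relatively continuous;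 $B:[0,T]\to\mathcal L(X)$ is such that $t\mapsto B(t)x\in C^1([0,T];X)$ for each $x$, each $B(t)$ is invertible and $\sup_t\|B(t)^{-1}\|<\infty$. The operator $A(t)B(t)$ has domain $\{x\in X:B(t)x\in D\}$. $MR_B(p,X)$ is the set of $u\in W^{1,p}(0,T;X)$ with $B(t)u(t)\in D$ for a.e. $t$ and $t\mapsto A(t)B(t)u(t)\in L^p(0,T;X)$. A family $\{C(t)\}$ of operators (possibly $t$-dependent domains) has $L^p$-maximal regularity on $(0,T)$ if for each $f\in L^p(0,T;X)$ there is a unique $u\in W^{1,p}(0,T;X)$ with $u(t)\in D(C(t))$ a.e., $C(\cdot)u(\cdot)\in L^p(0,T;X)$, $\dot u+C(t)u=f$ a.e., $u(0)=0$. *)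

theory Defs
  imports "HOL-Analysis.Analysis"
begin

(* Time interval is [0,T]; Lebesgue measure on the reals.  Functions are
   ordinary HOL functions; values outside [0,T] are irrelevant. *)

definition RNP :: "('x::banach) itself \<Rightarrow> bool" where
  "RNP _ \<equiv> \<forall>(f :: real \<Rightarrow> 'x) L. L-lipschitz_on {0..1} f \<longrightarrow>
      (AE t in lebesgue. t \<in> {0..1} \<longrightarrow> f differentiable (at t within {0..1}))"

definition smeas :: "real \<Rightarrow> (real \<Rightarrow> 'b::real_normed_vector) \<Rightarrow> bool" where
  "smeas T f \<equiv> \<exists>s :: nat \<Rightarrow> real \<Rightarrow> 'b.
      (\<forall>n. finite (s n ` {0..T}) \<and> (\<forall>y. {t \<in> {0..T}. s n t = y} \<in> sets lebesgue)) \<and>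
      (AE t in lebesgue. t \<in> {0..T} \<longrightarrow> (\<lambda>n. s n t) \<longlonglongrightarrow> f t)"

definition Lp :: "real \<Rightarrow> real \<Rightarrow> (real \<Rightarrow> 'b::real_normed_vector) \<Rightarrow> bool" where
  "Lp T p f \<equiv> smeas T f \<and>
      (\<integral>\<^sup>+ t. indicator {0..T} t * ennreal (norm (f t) powr p) \<partial>lebesgue) < \<infinity>"

definition lpnorm :: "real \<Rightarrow> real \<Rightarrow> (real \<Rightarrow> 'b::real_normed_vector) \<Rightarrow> real" where
  "lpnorm T p f = (enn2real (\<integral>\<^sup>+ t. indicator {0..T} t * ennreal (norm (f t) powr p) \<partial>lebesgue))
                   powr (1 / p)"

(* v \<in> L^p is the (weak) derivative of u on [0,T]; u is the continuous representative *)
definition wderiv :: "real \<Rightarrow> real \<Rightarrow> (real \<Rightarrow> 'b::real_normed_vector) \<Rightarrow> (real \<Rightarrow> 'b) \<Rightarrow> bool" where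
  "wderiv T p u v \<equiv> Lp T p v \<and> (\<forall>t\<in>{0..T}. (v has_integral (u t - u 0)) {0..t})"

definition W1p :: "real \<Rightarrow> real \<Rightarrow> (real \<Rightarrow> 'b::real_normed_vector) \<Rightarrow> bool" where
  "W1p T p u \<equiv> Lp T p u \<and> (\<exists>v. wderiv T p u v)"

(* D is embedded in X via the injective bounded operator J *)
definition Jinv :: "('d::banach \<Rightarrow>\<^sub>L 'x::banach) \<Rightarrow> 'x \<Rightarrow> 'd" where
  "Jinv J = inv (blinfun_apply J)"

definition inMR :: "real \<Rightarrow> real \<Rightarrow> ('d::banach \<Rightarrow>\<^sub>L 'x::banach) \<Rightarrow> (real \<Rightarrow> 'x) \<Rightarrow> bool" where
  "inMR T p J u \<equiv> W1p T p u \<and> (AE t in lebesgue. t \<in> {0..T} \<longrightarrow> u t \<in> range (blinfun_apply J))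
      \<and> Lp T p (\<lambda>t. Jinv J (u t))"

definition maxreg :: "real \<Rightarrow> real \<Rightarrow> ('d::banach \<Rightarrow>\<^sub>L 'x::banach) \<Rightarrow> ('d \<Rightarrow>\<^sub>L 'x) \<Rightarrow> bool" where
  "maxreg T p J C \<equiv> \<forall>f. Lp T p f \<longrightarrow>
     (let sol = (\<lambda>u. inMR T p J u \<and> u 0 = 0 \<and>
                 (\<exists>v. wderiv T p u v \<and>
                   (AE t in lebesgue. t \<in> {0..T} \<longrightarrow> v t + C (Jinv J (u t)) = f t)))
      in (\<exists>u. sol u) \<and> (\<forall>u1 u2. sol u1 \<and> sol u2 \<longrightarrow> (\<forall>t\<in>{0..T}. u1 t = u2 t)))"

definition trace_space :: "real \<Rightarrow> real \<Rightarrow> ('d::banach \<Rightarrow>\<^sub>L 'x::banach) \<Rightarrow> 'x set" where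
  "trace_space T p J = {u 0 | u. inMR T p J u}"

definition tr_norm :: "real \<Rightarrow> real \<Rightarrow> ('d::banach \<Rightarrow>\<^sub>L 'x::banach) \<Rightarrow> 'x \<Rightarrow> real" where
  "tr_norm T p J x = Inf {lpnorm T p (\<lambda>t. Jinv J (u t)) + (lpnorm T p u + lpnorm T p v) | u v.
                          inMR T p J u \<and> wderiv T p u v \<and> u 0 = x}"

definition cont_Tr :: "real \<Rightarrow> real \<Rightarrow> ('d::banach \<Rightarrow>\<^sub>L 'x::banach) \<Rightarrow> (real \<Rightarrow> 'x) \<Rightarrow> bool" where
  "cont_Tr T p J y \<equiv> (\<forall>t\<in>{0..T}. y t \<in> trace_space T p J) \<and>
     (\<forall>t\<in>{0..T}. \<forall>\<epsilon>>0. \<exists>\<delta>>0. \<forall>s\<in>{0..T}. \<bar>s - t\<bar> < \<delta> \<longrightarrow> tr_norm T p J (y s - y t) < \<epsilon>)"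

definition rel_cont :: "real \<Rightarrow> ('d::banach \<Rightarrow>\<^sub>L 'x::banach) \<Rightarrow> (real \<Rightarrow> ('d \<Rightarrow>\<^sub>L 'x)) \<Rightarrow> bool" where
  "rel_cont T J A \<equiv> \<forall>t\<in>{0..T}. \<forall>\<epsilon>>0. \<exists>\<delta>>0. \<exists>\<eta>\<ge>0. \<forall>s\<in>{0..T}. \<bar>t - s\<bar> \<le> \<delta> \<longrightarrow>
       (\<forall>x. norm (A t x - A s x) \<le> \<epsilon> * norm x + \<eta> * norm (J x))"

definition strongly_C1 :: "real \<Rightarrow> (real \<Rightarrow> ('x::banach \<Rightarrow>\<^sub>L 'x)) \<Rightarrow> bool" where
  "strongly_C1 T B \<equiv> \<forall>x. \<exists>b'. continuous_on {0..T} b' \<and>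
      (\<forall>t\<in>{0..T}. ((\<lambda>s. B s x) has_vector_derivative b' t) (at t within {0..T}))"

definition inMRB :: "real \<Rightarrow> real \<Rightarrow> ('d::banach \<Rightarrow>\<^sub>L 'x::banach) \<Rightarrow> (real \<Rightarrow> ('d \<Rightarrow>\<^sub>L 'x))
                       \<Rightarrow> (real \<Rightarrow> ('x \<Rightarrow>\<^sub>L 'x)) \<Rightarrow> (real \<Rightarrow> 'x) \<Rightarrow> bool" where
  "inMRB T p J A B u \<equiv> W1p T p u \<and>
      (AE t in lebesgue. t \<in> {0..T} \<longrightarrow> B t (u t) \<in> range (blinfun_apply J)) \<and>
      Lp T p (\<lambda>t. A t (Jinv J (B t (u t))))"

(* L^p-maximal regularity of the family {A(t)B(t)} on (0,T),
   D(A(t)B(t)) = {x. B(t)x \<in> D} *)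
definition fam_maxreg :: "real \<Rightarrow> real \<Rightarrow> ('d::banach \<Rightarrow>\<^sub>L 'x::banach) \<Rightarrow> (real \<Rightarrow> ('d \<Rightarrow>\<^sub>L 'x))
                       \<Rightarrow> (real \<Rightarrow> ('x \<Rightarrow>\<^sub>L 'x)) \<Rightarrow> bool" where
  "fam_maxreg T p J A B \<equiv> \<forall>f. Lp T p f \<longrightarrow>
     (let sol = (\<lambda>u. inMRB T p J A B u \<and> u 0 = 0 \<and>
                 (\<exists>v. wderiv T p u v \<and>
                   (AE t in lebesgue. t \<in> {0..T} \<longrightarrow> v t + A t (Jinv J (B t (u t))) = f t)))
      in (\<exists>u. sol u) \<and> (\<forall>u1 u2. sol u1 \<and> sol u2 \<longrightarrow> (\<forall>t\<in>{0..T}. u1 t = u2 t)))"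

end

theory Submission
  imports Defs
begin

text \<open>
  The function \<open>w = B u\<close> solves \<open>w' + B A w - B' B\<inverse> w = B f\<close>, so it suffices to treat a relatively
  continuous family \<open>C(t) = B(t) A(t)\<close> with the fixed domain \<open>D\<close>, perturbed by bounded operators.

  A solution operator of a single \<open>C(t\<^sub>0)\<close> is causal, because solutions can be shifted to the end of
  \<open>[0, T]\<close>, where uniqueness applies. Causality turns a gliding hump construction into an a priori
  estimate on short intervals. Near \<open>t\<^sub>0\<close> the family is therefore a small perturbation of \<open>C(t\<^sub>0)\<close>, the
  equation can be solved by a fixed point argument in \<open>L\<^sup>p\<close>, and the local solutions are continued
  along the compact interval \<open>[0, T]\<close>.

  Uniqueness is claimed in a class where \<open>B u\<close> is not assumed to be in \<open>L\<^sup>p(0, T; D)\<close>. This regularity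
  is recovered from the equivalence of the norm of \<open>D\<close> with the graph norms of the \<open>C(t)\<close>, and from
  operators \<open>X \<rightarrow> D\<close> which converge strongly to the identity on \<open>D\<close> and so transfer strong
  measurability from \<open>X\<close> to \<open>D\<close>.
\<close>

section \<open>Strongly measurable functions\<close>

text \<open>\<open>maxreg\<close> asserts unique solvability for each right-hand side on the single
  interval [0, T]. It contains no estimate and says nothing about shorter intervals, so both have to
  be extracted from existence and uniqueness alone; this is why shifting in time is the basic
  device. Sizes are measured by \<open>pmass\<close>, the integral of the p-th power of the norm,
  rather than by the norm. Its triangle inequality carries a factor \<open>2 powr p\<close>, and the
  constants \<open>4 powr p\<close> and \<open>8 powr p\<close> compensate for such factors. The
  local problem is not posed with an initial value in the trace space. A function that solves the
  equation up to time a is corrected by a solution of the equation frozen at t0 whose right-hand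
  side is supported in [a, b]; by causality the correction vanishes on [0, a]. The unknown of the
  fixed point argument is that right-hand side. Trace spaces enter only at time 0, where an
  extension of x0 is subtracted, and in the final continuity statement.\<close>

lemma AE_lebesgue_on_iff:
  "(AE t in lebesgue_on {a..b::real}. P t) \<longleftrightarrow> (AE t in lebesgue. t \<in> {a..b} \<longrightarrow> P t)"
  by (simp add: AE_restrict_space_iff)

text \<open>Null sets may be changed freely because \<open>lebesgue\<close> is complete. That fact
  concerns the whole line, hence the detour through extensions by zero.\<close>

lemma borel_measurable_AE_lebesgue_on:
  fixes f g :: "real \<Rightarrow> real"
  assumes "f \<in> borel_measurable (lebesgue_on {a..b})" "AE t in lebesgue_on {a..b}. f t = g t"
  shows "g \<in> borel_measurable (lebesgue_on {a..b})"
proof -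
  have "(\<lambda>t. if t \<in> {a..b} then f t else 0) \<in> borel_measurable lebesgue"
    using assms(1) by (intro borel_measurable_if_I) auto
  moreover have "AE t in lebesgue. (if t \<in> {a..b} then f t else 0) = (if t \<in> {a..b} then g t else 0)"
    using assms(2) unfolding AE_lebesgue_on_iff by eventually_elim auto
  ultimately have "(\<lambda>t. if t \<in> {a..b} then g t else 0) \<in> borel_measurable lebesgue"
    by (rule borel_measurable_AE)
  then show ?thesis
    by (rule borel_measurable_if_D)
qed

lemma borel_measurable_AE_limit:
  fixes f :: "nat \<Rightarrow> real \<Rightarrow> real"
  assumes "\<And>n. f n \<in> borel_measurable (lebesgue_on {a..b})"
    and "AE t in lebesgue_on {a..b}. (\<lambda>n. f n t) \<longlonglongrightarrow> g t"
  shows "g \<in> borel_measurable (lebesgue_on {a..b})"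
proof (rule borel_measurable_AE_lebesgue_on)
  show "(\<lambda>t. lim (\<lambda>n. f n t)) \<in> borel_measurable (lebesgue_on {a..b})"
    using assms(1) by (rule borel_measurable_lim_metric)
  show "AE t in lebesgue_on {a..b}. lim (\<lambda>n. f n t) = g t"
    using assms(2) by eventually_elim (rule limI)
qed

text \<open>\<open>simple_function\<close> asks for measurable level sets of attained values, the
  definition of \<open>smeas\<close> for those of all \<open>y\<close>; the additional ones are
  empty.\<close>

lemma smeas_iff_simple:
  "smeas T f \<longleftrightarrow> (\<exists>s. (\<forall>n. simple_function (lebesgue_on {0..T}) (s n)) \<and>
      (AE t in lebesgue_on {0..T}. (\<lambda>n. s n t) \<longlonglongrightarrow> f t))"
proof -
  have *: "(\<lambda>t. s t) -` {y} \<inter> {0..T} = {t \<in> {0..T}. s t = y}" for s :: "real \<Rightarrow> 'a" and y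
    by auto
  have "simple_function (lebesgue_on {0..T}) s \<longleftrightarrow>
      finite (s ` {0..T}) \<and> (\<forall>y. {t \<in> {0..T}. s t = y} \<in> sets lebesgue)" for s :: "real \<Rightarrow> 'a"
  proof -
    have "{t \<in> {0..T}. s t = y} = {}" if "y \<notin> s ` {0..T}" for y
      using that by auto
    then have "{t \<in> {0..T}. s t = y} \<in> sets lebesgue" if "y \<notin> s ` {0..T}" for y
      using that by (metis sets.empty_sets)
    then have "(\<forall>y\<in>s ` {0..T}. {t \<in> {0..T}. s t = y} \<in> sets lebesgue) \<longleftrightarrow>
        (\<forall>y. {t \<in> {0..T}. s t = y} \<in> sets lebesgue)"
      by metis
    moreover have "{t \<in> {0..T}. s t = y} \<in> sets (lebesgue_on {0..T}) \<longleftrightarrow>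
        {t \<in> {0..T}. s t = y} \<in> sets lebesgue" for y
      by (subst sets_restrict_space_iff) auto
    ultimately show ?thesis
      unfolding simple_function_def space_lebesgue_on * by presburger
  qed
  then show ?thesis
    unfolding smeas_def AE_lebesgue_on_iff by simp
qed

text \<open>On each of the finitely many level sets of \<open>s\<close> the function is some
  \<open>h y\<close>. It serves to measure distances to a reference point that is itself a simple
  function of \<open>t\<close>.\<close>

lemma measurable_simple_function_apply:
  assumes "simple_function M s" "\<And>y. h y \<in> measurable M N"
  shows "(\<lambda>t. h (s t) t) \<in> measurable M N"
proof (rule measurable_compose_countable'[where f = h and I = "s ` space M"])
  show "s \<in> measurable M (count_space (s ` space M))"
    using assms(1) by (subst measurable_count_space_eq2) (auto simp: simple_function_def)
  show "countable (s ` space M)"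
    using assms(1) by (simp add: simple_function_def countable_finite)
  show "h y \<in> measurable M N" for y
    by (rule assms(2))
qed

text \<open>A best approximation of \<open>y\<close> among \<open>q 0\<close>, ...,
  \<open>q n\<close>, ties going to the earlier index. The choice depends on \<open>y\<close> only
  through its distances to the \<open>q k\<close>, so measurability of these real functions makes
  \<open>nearest q (f t) n\<close> a simple function of \<open>t\<close>.\<close>

primrec nearest :: "(nat \<Rightarrow> 'a::metric_space) \<Rightarrow> 'a \<Rightarrow> nat \<Rightarrow> 'a" where
  "nearest q y 0 = q 0"
| "nearest q y (Suc n) = (if dist y (q (Suc n)) < dist y (nearest q y n) then q (Suc n) else nearest q y n)"

lemma nearest_le: "k \<le> n \<Longrightarrow> dist y (nearest q y n) \<le> dist y (q k)"
proof (induction n)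
  case (Suc n)
  then show ?case by (cases "k = Suc n") (auto simp: le_Suc_eq)
qed auto

lemma nearest_tendsto:
  assumes "y \<in> closure (range q)"
  shows "(\<lambda>n. nearest q y n) \<longlonglongrightarrow> y"
proof (rule metric_LIMSEQ_I)
  fix e :: real assume "e > 0"
  with assms obtain k where "dist (q k) y < e"
    by (auto simp: closure_approachable)
  then show "\<exists>n0. \<forall>n\<ge>n0. dist (nearest q y n) y < e"
    using nearest_le[of k _ y q] by (intro exI[of _ k]) (force simp: dist_commute)
qed

text \<open>A form of Pettis' measurability theorem.\<close>

lemma smeas_iff_separable:
  fixes f :: "real \<Rightarrow> 'a::real_normed_vector"
  shows "smeas T f \<longleftrightarrow> (\<forall>y. (\<lambda>t. norm (f t - y)) \<in> borel_measurable (lebesgue_on {0..T})) \<and>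
    (\<exists>Q. countable Q \<and> (AE t in lebesgue_on {0..T}. f t \<in> closure Q))"
    (is "_ \<longleftrightarrow> ?M \<and> ?S")
proof
  assume "smeas T f"
  then obtain s where s: "\<And>n. simple_function (lebesgue_on {0..T}) (s n)"
    and lim: "AE t in lebesgue_on {0..T}. (\<lambda>n. s n t) \<longlonglongrightarrow> f t"
    by (auto simp: smeas_iff_simple)
  have ?M
  proof
    fix y
    show "(\<lambda>t. norm (f t - y)) \<in> borel_measurable (lebesgue_on {0..T})"
    proof (rule borel_measurable_AE_limit)
      show "(\<lambda>t. norm (s n t - y)) \<in> borel_measurable (lebesgue_on {0..T})" for n
        using simple_function_compose1[OF s, of "\<lambda>x. norm (x - y)"] by (rule borel_measurable_simple_function)
      show "AE t in lebesgue_on {0..T}. (\<lambda>n. norm (s n t - y)) \<longlonglongrightarrow> norm (f t - y)"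
        using lim by eventually_elim (intro tendsto_intros)
    qed
  qed
  moreover have ?S
  proof (intro exI conjI)
    show "countable (\<Union>n. s n ` {0..T})"
      using s by (intro countable_UN) (auto simp: simple_function_def countable_finite)
    have "AE t in lebesgue_on {0..T}. t \<in> {0..T}"
      using AE_space[of "lebesgue_on {0..T}"] by simp
    then show "AE t in lebesgue_on {0..T}. f t \<in> closure (\<Union>n. s n ` {0..T})"
      using lim
    proof eventually_elim
      case (elim t)
      then show ?case unfolding closure_sequential
        by (intro exI[of _ "\<lambda>n. s n t"] conjI allI UN_I[OF UNIV_I] imageI) auto
    qed
  qed
  ultimately show "?M \<and> ?S" by blast
next
  assume "?M \<and> ?S"
  then obtain Q where M: ?M and Q: "countable Q" "AE t in lebesgue_on {0..T}. f t \<in> closure Q"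
    by blast
  \<comment> \<open>Inserting 0 makes the set nonempty, as \<open>from_nat_into\<close> requires in
    order to enumerate it.\<close>
  define q where "q = from_nat_into (insert 0 Q)"
  have q: "range q = insert 0 Q"
    unfolding q_def by (rule range_from_nat_into) (use Q in auto)
  have near: "simple_function (lebesgue_on {0..T}) (\<lambda>t. nearest q (f t) n)" for n
  proof (induction n)
    case (Suc n)
    \<comment> \<open>By induction the previous choice takes finitely many values, so its distance
      to \<open>f t\<close> is measurable although the reference point varies with
      \<open>t\<close>.\<close>
    have [measurable]: "(\<lambda>t. norm (f t - nearest q (f t) n)) \<in> borel_measurable (lebesgue_on {0..T})"
      using measurable_simple_function_apply[OF Suc, of "\<lambda>y t. norm (f t - y)"] M by blast
    have [measurable]: "(\<lambda>t. norm (f t - y)) \<in> borel_measurable (lebesgue_on {0..T})" for y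
      using M by blast
    show ?case
      unfolding nearest.simps dist_norm
      by (intro simple_function_If Suc simple_function_const) measurable
  qed simp
  have "AE t in lebesgue_on {0..T}. (\<lambda>n. nearest q (f t) n) \<longlonglongrightarrow> f t"
    using Q(2)
  proof eventually_elim
    case (elim t)
    then have "f t \<in> closure (range q)"
      unfolding q using closure_mono[of Q "insert 0 Q"] by auto
    then show ?case by (rule nearest_tendsto)
  qed
  with near show "smeas T f"
    unfolding smeas_iff_simple by (intro exI[of _ "\<lambda>n t. nearest q (f t) n"] conjI allI)
qed

text \<open>Both halves of the separability criterion survive a limit: distances converge, and the
  union of the countable sets stays countable. Working from the definition would call for a diagonal
  argument.\<close>

lemma smeas_AE_limit:
  fixes f :: "nat \<Rightarrow> real \<Rightarrow> 'a::real_normed_vector"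
  assumes f: "\<And>n. smeas T (f n)" and lim: "AE t in lebesgue_on {0..T}. (\<lambda>n. f n t) \<longlonglongrightarrow> g t"
  shows "smeas T g"
  unfolding smeas_iff_separable
proof
  show "\<forall>y. (\<lambda>t. norm (g t - y)) \<in> borel_measurable (lebesgue_on {0..T})"
  proof
    fix y
    show "(\<lambda>t. norm (g t - y)) \<in> borel_measurable (lebesgue_on {0..T})"
    proof (rule borel_measurable_AE_limit)
      show "(\<lambda>t. norm (f n t - y)) \<in> borel_measurable (lebesgue_on {0..T})" for n
        using f[of n] by (simp add: smeas_iff_separable)
      show "AE t in lebesgue_on {0..T}. (\<lambda>n. norm (f n t - y)) \<longlonglongrightarrow> norm (g t - y)"
        using lim by eventually_elim (intro tendsto_intros)
    qed
  qed
  have "\<exists>Q. countable Q \<and> (AE t in lebesgue_on {0..T}. f n t \<in> closure Q)" for n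
    using f[of n] by (simp add: smeas_iff_separable)
  then obtain Q where Q: "\<And>n. countable (Q n)" "\<And>n. AE t in lebesgue_on {0..T}. f n t \<in> closure (Q n)"
    by metis
  have "AE t in lebesgue_on {0..T}. \<forall>n. f n t \<in> closure (Q n)"
    using Q(2) by (simp add: AE_all_countable)
  then have "AE t in lebesgue_on {0..T}. g t \<in> closure (\<Union>n. Q n)"
    using lim
  proof eventually_elim
    case (elim t)
    have "f n t \<in> closure (\<Union>n. Q n)" for n
      using elim(1) closure_mono[of "Q n" "\<Union>n. Q n"] by auto
    then show ?case
      using elim(2) closed_sequentially[OF closed_closure, of "\<lambda>n. f n t"] by blast
  qed
  moreover have "countable (\<Union>n. Q n)"
    using Q(1) by (intro countable_UN) auto
  ultimately show "\<exists>Q. countable Q \<and> (AE t in lebesgue_on {0..T}. g t \<in> closure Q)"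
    by (intro exI[of _ "\<Union>n. Q n"] conjI)
qed

lemma smeas_simple: "simple_function (lebesgue_on {0..T}) f \<Longrightarrow> smeas T f"
  unfolding smeas_iff_simple by (intro exI[of _ "\<lambda>_. f"]) auto

lemma smeas_const [simp, intro]: "smeas T (\<lambda>_. c)"
  by (rule smeas_simple) simp

lemma smeas_cong_AE:
  assumes "smeas T f" "AE t in lebesgue_on {0..T}. f t = g t"
  shows "smeas T g"
  using assms(2) by (intro smeas_AE_limit[OF assms(1)]) (auto elim!: eventually_mono)

lemma smeas_norm_measurable:
  "smeas T f \<Longrightarrow> (\<lambda>t. norm (f t)) \<in> borel_measurable (lebesgue_on {0..T})"
  unfolding smeas_iff_separable by (auto dest: spec[of _ 0])

lemma smeas_compose2:
  assumes "smeas T f" "smeas T g" and h: "continuous_on UNIV (\<lambda>z. h (fst z) (snd z))"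
  shows "smeas T (\<lambda>t. h (f t) (g t))"
proof -
  obtain s r where s: "\<And>n. simple_function (lebesgue_on {0..T}) (s n)"
      "AE t in lebesgue_on {0..T}. (\<lambda>n. s n t) \<longlonglongrightarrow> f t"
    and r: "\<And>n. simple_function (lebesgue_on {0..T}) (r n)"
      "AE t in lebesgue_on {0..T}. (\<lambda>n. r n t) \<longlonglongrightarrow> g t"
    using assms(1,2) unfolding smeas_iff_simple by blast
  have "AE t in lebesgue_on {0..T}. (\<lambda>n. h (s n t) (r n t)) \<longlonglongrightarrow> h (f t) (g t)"
    using s(2) r(2)
  proof eventually_elim
    case (elim t)
    have "(\<lambda>n. (s n t, r n t)) \<longlonglongrightarrow> (f t, g t)"
      using elim by (rule tendsto_Pair)
    then show ?case
      using continuous_on_tendsto_compose[OF h, of "\<lambda>n. (s n t, r n t)" "(f t, g t)" sequentially] by simp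
  qed
  then show ?thesis
    unfolding smeas_iff_simple using simple_function_compose2[OF s(1) r(1)]
    by (intro exI[of _ "\<lambda>n t. h (s n t) (r n t)"]) auto
qed

lemma smeas_add: "smeas T f \<Longrightarrow> smeas T g \<Longrightarrow> smeas T (\<lambda>t. f t + g t)"
  by (rule smeas_compose2) (auto intro!: continuous_intros)

lemma smeas_diff: "smeas T f \<Longrightarrow> smeas T g \<Longrightarrow> smeas T (\<lambda>t. f t - g t)"
  by (rule smeas_compose2) (auto intro!: continuous_intros)

lemma smeas_scaleR: "smeas T f \<Longrightarrow> smeas T g \<Longrightarrow> smeas T (\<lambda>t. f t *\<^sub>R g t)"
  by (rule smeas_compose2) (auto intro!: continuous_intros)

lemma smeas_compose:
  assumes "smeas T f" "continuous_on UNIV h"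
  shows "smeas T (\<lambda>t. h (f t))"
  by (rule smeas_compose2[OF assms(1) assms(1), of "\<lambda>x y. h x"])
    (auto intro!: continuous_on_compose2[OF assms(2)] continuous_intros)

lemma smeas_restrict:
  assumes "smeas T f" "E \<in> sets lebesgue"
  shows "smeas T (\<lambda>t. if t \<in> E then f t else 0)"
proof -
  have "smeas T (indicator E :: real \<Rightarrow> real)"
    unfolding indicator_def of_bool_def using assms(2)
    by (intro smeas_simple simple_function_If simple_function_const)
      (auto simp: sets_restrict_space image_iff intro!: bexI[of _ E])
  then have "smeas T (\<lambda>t. indicator E t *\<^sub>R f t)"
    using assms(1) by (rule smeas_scaleR)
  moreover have "(\<lambda>t. indicator E t *\<^sub>R f t) = (\<lambda>t. if t \<in> E then f t else 0)"
    by (auto simp: indicator_def)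
  ultimately show ?thesis
    by simp
qed

lemma smeas_sum:
  "(\<And>i. i \<in> I \<Longrightarrow> smeas T (f i)) \<Longrightarrow> smeas T (\<lambda>t. \<Sum>i\<in>I. f i t)"
  by (induction I rule: infinite_finite_induct) (auto intro: smeas_add)

text \<open>Strong measurability of \<open>L\<close> is weaker than measurability in operator norm,
  so this is not a composition. For simple \<open>s\<close> the function is a finite sum of the
  \<open>L t y\<close> times indicators, and the continuity of each \<open>L t\<close> carries this
  over to \<open>f\<close>.\<close>

lemma smeas_blinfun_family:
  fixes L :: "real \<Rightarrow> ('a::real_normed_vector \<Rightarrow>\<^sub>L 'b::real_normed_vector)"
  assumes L: "\<And>x. smeas T (\<lambda>t. L t x)" and f: "smeas T f"
  shows "smeas T (\<lambda>t. L t (f t))"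
proof -
  obtain s where s: "\<And>n. simple_function (lebesgue_on {0..T}) (s n)"
      "AE t in lebesgue_on {0..T}. (\<lambda>n. s n t) \<longlonglongrightarrow> f t"
    using f unfolding smeas_iff_simple by blast
  show ?thesis
  proof (rule smeas_AE_limit)
    fix n
    have fin: "finite (s n ` {0..T})"
      using s(1)[of n] by (simp add: simple_function_def)
    have "smeas T (\<lambda>t. \<Sum>y\<in>s n ` {0..T}. (if s n t = y then 1 else 0::real) *\<^sub>R L t y)"
      using simple_function_compose1[OF s(1)]
      by (intro smeas_sum smeas_scaleR L smeas_simple)
    then show "smeas T (\<lambda>t. L t (s n t))"
    proof (rule smeas_cong_AE)
      have "(\<Sum>y\<in>s n ` {0..T}. (if s n t = y then 1 else 0::real) *\<^sub>R L t y) = L t (s n t)"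
        if "t \<in> {0..T}" for t
        using that fin by (subst sum.remove[of _ "s n t"]) (auto intro!: sum.neutral split: if_splits)
      then show "AE t in lebesgue_on {0..T}.
          (\<Sum>y\<in>s n ` {0..T}. (if s n t = y then 1 else 0::real) *\<^sub>R L t y) = L t (s n t)"
        by (intro AE_I2) auto
    qed
  next
    show "AE t in lebesgue_on {0..T}. (\<lambda>n. L t (s n t)) \<longlonglongrightarrow> L t (f t)"
      using s(2) by eventually_elim (intro tendsto_intros)
  qed
qed

lemma smeas_continuous_on:
  assumes "continuous_on {0..T} f"
  shows "smeas T f"
  unfolding smeas_iff_separable
proof
  show "\<forall>y. (\<lambda>t. norm (f t - y)) \<in> borel_measurable (lebesgue_on {0..T})"
    using assms by (intro allI continuous_imp_measurable_on_sets_lebesgue continuous_intros) auto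
  obtain S where S: "countable S" "S \<subseteq> {0..T}" "{0..T} \<subseteq> closure S"
    using separable by blast
  have "f t \<in> closure (f ` S)" if "t \<in> {0..T}" for t
  proof -
    have "t \<in> closure S"
      using that S(3) by blast
    then obtain x where "\<And>n. x n \<in> S" "x \<longlonglongrightarrow> t"
      unfolding closure_sequential by blast
    then show ?thesis
      unfolding closure_sequential using S(2) that
      by (intro exI[of _ "\<lambda>n. f (x n)"]) (auto intro!: continuous_on_tendsto_compose[OF assms] always_eventually)
  qed
  then show "\<exists>Q. countable Q \<and> (AE t in lebesgue_on {0..T}. f t \<in> closure Q)"
    using S(1) by (intro exI[of _ "f ` S"]) (auto intro!: AE_I2)
qed

section \<open>Integration of vector-valued functions\<close>

text \<open>Riemann sums of \<open>f\<close> and \<open>g n\<close> over the same tagged division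
  differ by at most the Riemann sum of \<open>norm (f t - g n t)\<close>, which on fine divisions is
  close to the small integral of the error. For a given tolerance one \<open>n\<close> and two
  gauges suffice.\<close>

lemma integrable_on_L1_limit:
  fixes f :: "real \<Rightarrow> 'a::banach"
  assumes g: "\<And>n. g n integrable_on {a..b}"
    and fg: "\<And>n. (\<lambda>t. norm (f t - g n t)) integrable_on {a..b}"
    and lim: "(\<lambda>n. integral {a..b} (\<lambda>t. norm (f t - g n t))) \<longlonglongrightarrow> 0"
  shows "f integrable_on {a..b}"
proof -
  define e where "e n = integral {a..b} (\<lambda>t. norm (f t - g n t))" for n
  define I where "I n = integral {a..b} (g n)" for n
  have e: "e \<longlonglongrightarrow> 0" "e n \<ge> 0" for n
    using lim by (auto simp: e_def[abs_def] intro!: integral_nonneg fg)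
  have I: "norm (I m - I n) \<le> e m + e n" for m n
  proof -
    have "norm (integral {a..b} (\<lambda>t. g m t - g n t))
        \<le> integral {a..b} (\<lambda>t. norm (f t - g m t) + norm (f t - g n t))"
    proof (rule integral_norm_bound_integral)
      show "norm (g m t - g n t) \<le> norm (f t - g m t) + norm (f t - g n t)" for t
        using norm_triangle_ineq4[of "f t - g n t" "f t - g m t"] by (simp add: algebra_simps)
    qed (auto intro!: integrable_diff integrable_add g fg)
    then show ?thesis
      using g fg by (simp add: I_def e_def integral_diff integral_add)
  qed
  have "Cauchy I"
  proof (rule metric_CauchyI)
    fix r :: real assume "r > 0"
    then obtain N where N: "\<And>n. n \<ge> N \<Longrightarrow> norm (e n - 0) < r / 2"
      using LIMSEQ_D[OF e(1), of "r/2"] by auto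
    have "dist (I m) (I n) < r" if "m \<ge> N" "n \<ge> N" for m n
      using I[of m n] N[OF that(1)] N[OF that(2)] by (auto simp: dist_norm)
    then show "\<exists>M. \<forall>m\<ge>M. \<forall>n\<ge>M. dist (I m) (I n) < r" by blast
  qed
  \<comment> \<open>The integrals of the approximants are Cauchy; this produces the value of the
    integral before integrability of \<open>f\<close> is known.\<close>
  then obtain L where L: "I \<longlonglongrightarrow> L"
    using Cauchy_convergent_iff convergent_def by blast
  have "(f has_integral L) {a..b}"
    unfolding has_integral_real
  proof (intro allI impI)
    fix r :: real assume r: "r > 0"
    have "\<forall>\<^sub>F n in sequentially. norm (I n - L) < r / 4 \<and> norm (e n - 0) < r / 4"
      using tendstoD[OF L, of "r / 4"] tendstoD[OF e(1), of "r / 4"] r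
      by (intro eventually_conj) (simp_all add: dist_norm)
    then obtain n where n: "norm (I n - L) < r / 4" "e n < r / 4"
      by (auto simp: eventually_sequentially)
    have gI: "(g n has_integral I n) {a..b}"
      using g by (auto simp: I_def)
    obtain \<gamma>1 where \<gamma>1: "gauge \<gamma>1" "\<And>\<D>. \<D> tagged_division_of {a..b} \<Longrightarrow> \<gamma>1 fine \<D> \<Longrightarrow>
        norm ((\<Sum>(x, k)\<in>\<D>. measure lborel k *\<^sub>R g n x) - I n) < r / 4"
      using gI[unfolded has_integral_real, rule_format, of "r / 4"] r by auto
    have eI: "((\<lambda>t. norm (f t - g n t)) has_integral e n) {a..b}"
      using fg by (auto simp: e_def)
    obtain \<gamma>2 where \<gamma>2: "gauge \<gamma>2" "\<And>\<D>. \<D> tagged_division_of {a..b} \<Longrightarrow> \<gamma>2 fine \<D> \<Longrightarrow>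
        norm ((\<Sum>(x, k)\<in>\<D>. measure lborel k *\<^sub>R norm (f x - g n x)) - e n) < r / 4"
      using eI[unfolded has_integral_real, rule_format, of "r / 4"] r by auto
    show "\<exists>\<gamma>. gauge \<gamma> \<and> (\<forall>\<D>. \<D> tagged_division_of {a..b} \<and> \<gamma> fine \<D> \<longrightarrow>
        norm ((\<Sum>(x, k)\<in>\<D>. measure lborel k *\<^sub>R f x) - L) < r)"
    proof (intro exI[of _ "\<lambda>x. \<gamma>1 x \<inter> \<gamma>2 x"] conjI allI impI)
      show "gauge (\<lambda>x. \<gamma>1 x \<inter> \<gamma>2 x)"
        using \<gamma>1(1) \<gamma>2(1) by (rule gauge_Int)
      fix \<D> assume \<D>: "\<D> tagged_division_of {a..b} \<and> (\<lambda>x. \<gamma>1 x \<inter> \<gamma>2 x) fine \<D>"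
      then have fine: "\<gamma>1 fine \<D>" "\<gamma>2 fine \<D>"
        by (auto simp: fine_Int)
      have "norm ((\<Sum>(x, k)\<in>\<D>. measure lborel k *\<^sub>R f x) - (\<Sum>(x, k)\<in>\<D>. measure lborel k *\<^sub>R g n x))
          = norm (\<Sum>(x, k)\<in>\<D>. measure lborel k *\<^sub>R (f x - g n x))"
        by (simp add: sum_subtractf[symmetric] scaleR_diff_right split_def)
      also have "\<dots> \<le> (\<Sum>(x, k)\<in>\<D>. measure lborel k *\<^sub>R norm (f x - g n x))"
        by (rule sum_norm_le) auto
      also have "\<dots> < e n + r / 4"
        using \<gamma>2(2)[OF _ fine(2)] \<D> unfolding real_norm_def by linarith
      finally have A: "norm ((\<Sum>(x, k)\<in>\<D>. measure lborel k *\<^sub>R f x) - (\<Sum>(x, k)\<in>\<D>. measure lborel k *\<^sub>R g n x)) < e n + r / 4" .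
      have B: "norm ((\<Sum>(x, k)\<in>\<D>. measure lborel k *\<^sub>R g n x) - I n) < r / 4"
        using \<gamma>1(2) fine(1) \<D> by blast
      have tri: "norm (x - w) \<le> norm (x - y) + norm (y - z) + norm (z - w)" for x y z w :: 'a
        using norm_triangle_ineq[of "x - y" "y - z"] norm_triangle_ineq[of "x - z" "z - w"] by simp
      show "norm ((\<Sum>(x, k)\<in>\<D>. measure lborel k *\<^sub>R f x) - L) < r"
        using tri[of "\<Sum>(x, k)\<in>\<D>. measure lborel k *\<^sub>R f x" L "\<Sum>(x, k)\<in>\<D>. measure lborel k *\<^sub>R g n x" "I n"] A B n
        by linarith
    qed
  qed
  then show ?thesis by blast
qed

lemma nn_integrable_imp_integrable:
  fixes f :: "real \<Rightarrow> real"
  assumes "f \<in> borel_measurable (lebesgue_on {a..b})" "\<And>t. f t \<ge> 0"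
    "(\<integral>\<^sup>+t. ennreal (f t) \<partial>lebesgue_on {a..b}) < \<infinity>"
  shows "integrable (lebesgue_on {a..b}) f" "f integrable_on {a..b}"
    "(\<integral>\<^sup>+t. ennreal (f t) \<partial>lebesgue_on {a..b}) = ennreal (integral {a..b} f)"
proof -
  show *: "integrable (lebesgue_on {a..b}) f"
    using assms by (intro integrableI_nonneg) auto
  from has_integral_integral_lebesgue_on[OF this]
  have **: "(f has_integral (integral\<^sup>L (lebesgue_on {a..b}) f)) {a..b}" by simp
  then show "f integrable_on {a..b}" by blast
  show "(\<integral>\<^sup>+t. ennreal (f t) \<partial>lebesgue_on {a..b}) = ennreal (integral {a..b} f)"
    using nn_integral_eq_integral[OF *] assms(2) integral_unique[OF **] by simp
qed

lemma simple_function_integrable_on: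
  fixes s :: "real \<Rightarrow> 'a::banach"
  assumes "simple_function (lebesgue_on {a..b}) s"
  shows "s integrable_on {a..b}"
proof -
  have fin: "finite (s ` {a..b})"
    using assms by (simp add: simple_function_def)
  have "(\<lambda>t. \<Sum>y\<in>s ` {a..b}. (if s t = y then 1 else 0::real) *\<^sub>R y) integrable_on {a..b}"
  proof (rule integrable_sum[OF fin])
    fix y
    have "integrable (lebesgue_on {a..b}) (\<lambda>t. if s t = y then 1 else 0::real)"
    proof (rule finite_measure.integrable_const_bound[where B = 1])
      show "finite_measure (lebesgue_on {a..b})"
        by (simp add: finite_measure_lebesgue_on)
      show "(\<lambda>t. if s t = y then 1 else 0::real) \<in> borel_measurable (lebesgue_on {a..b})"
        using simple_function_compose1[OF assms, of "\<lambda>z. if z = y then 1 else 0::real"]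
        by (rule borel_measurable_simple_function)
    qed auto
    then have "(\<lambda>t. if s t = y then 1 else 0::real) integrable_on {a..b}"
      by (rule has_integral_integrable[OF has_integral_integral_lebesgue_on]) auto
    then show "(\<lambda>t. (if s t = y then 1 else 0::real) *\<^sub>R y) integrable_on {a..b}"
      using integrable_linear[OF _ bounded_linear_scaleR_left, of _ "{a..b}" y] by (simp add: o_def)
  qed
  then show ?thesis
  proof (rule integrable_eq)
    show "(\<Sum>y\<in>s ` {a..b}. (if s t = y then 1 else 0::real) *\<^sub>R y) = s t" if "t \<in> {a..b}" for t
      using that fin by (subst sum.remove[of _ "s t"]) (auto intro!: sum.neutral split: if_splits)
  qed
qed

text \<open>Dominated convergence is applied to the real functions \<open>norm (f t - r n t)\<close>
  only; vector values enter through \<open>integrable_on_L1_limit\<close>, so they may lie in a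
  nonseparable space.\<close>

lemma smeas_integrable_on:
  fixes f :: "real \<Rightarrow> 'a::banach"
  assumes f: "smeas T f" and int: "integrable (lebesgue_on {0..T}) (\<lambda>t. norm (f t))"
  shows "f integrable_on {0..T}"
proof -
  let ?M = "lebesgue_on {0..T}"
  obtain s where s: "\<And>n. simple_function ?M (s n)" "AE t in ?M. (\<lambda>n. s n t) \<longlonglongrightarrow> f t"
    using f unfolding smeas_iff_simple by blast
  have [measurable]: "(\<lambda>t. norm (f t)) \<in> borel_measurable ?M" "(\<lambda>t. norm (s n t)) \<in> borel_measurable ?M" for n
    using smeas_norm_measurable[OF f] smeas_norm_measurable[OF smeas_simple[OF s(1)]] by auto
  \<comment> \<open>The cut-off forces \<open>norm (r n t) \<le> 2 * norm (f t)\<close>. It is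
    eventually inactive where \<open>f t \<noteq> 0\<close> and gives zero where
    \<open>f t = 0\<close>, so convergence is kept.\<close>
  define r where "r n t = (if norm (s n t) \<le> 2 * norm (f t) then s n t else 0)" for n t
  have r: "simple_function ?M (r n)" for n
    unfolding r_def by (intro simple_function_If s simple_function_const) measurable
  have lim: "AE t in ?M. (\<lambda>n. norm (f t - r n t)) \<longlonglongrightarrow> 0"
    using s(2)
  proof eventually_elim
    case (elim t)
    show ?case
    proof (cases "f t = 0")
      case True
      then have "r n t = 0" for n by (auto simp: r_def)
      then show ?thesis using True by simp
    next
      case False
      have "(\<lambda>n. norm (s n t)) \<longlonglongrightarrow> norm (f t)"
        using elim by (rule tendsto_norm)
      then have "\<forall>\<^sub>F n in sequentially. norm (s n t) < 2 * norm (f t)"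
        using False by (intro order_tendstoD) auto
      then have ev: "\<forall>\<^sub>F n in sequentially. norm (f t - s n t) = norm (f t - r n t)"
        by eventually_elim (auto simp: r_def)
      have "(\<lambda>n. norm (f t - s n t)) \<longlonglongrightarrow> norm (f t - f t)"
        using elim by (intro tendsto_intros)
      then show ?thesis
        using tendsto_cong[OF ev] by simp
    qed
  qed
  have bd: "norm (f t - r n t) \<le> 3 * norm (f t)" for n t
    using norm_triangle_ineq4[of "f t" "r n t"] by (auto simp: r_def)
  have [measurable]: "(\<lambda>t. norm (f t - r n t)) \<in> borel_measurable ?M" for n
    using smeas_norm_measurable[OF smeas_diff[OF f smeas_simple[OF r]]] by auto
  have dom: "integrable ?M (\<lambda>t. 3 * norm (f t))"
    using int by simp
  have int_n: "integrable ?M (\<lambda>t. norm (f t - r n t))" for n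
    using bd by (intro Bochner_Integration.integrable_bound[OF dom]) auto
  have hi: "((\<lambda>t. norm (f t - r n t)) has_integral (\<integral>t. norm (f t - r n t) \<partial>?M)) {0..T}" for n
    using has_integral_integral_lebesgue_on[OF int_n] by simp
  have "(\<lambda>n. (\<integral>t. norm (f t - r n t) \<partial>?M)) \<longlonglongrightarrow> (\<integral>t. 0 \<partial>?M)"
    by (rule integral_dominated_convergence[OF _ _ dom lim]) (simp_all add: bd)
  then have "(\<lambda>n. integral {0..T} (\<lambda>t. norm (f t - r n t))) \<longlonglongrightarrow> 0"
    unfolding integral_unique[OF hi] by simp
  then show ?thesis
    by (rule integrable_on_L1_limit[OF simple_function_integrable_on[OF r] has_integral_integrable[OF hi]])
qed

section \<open>The modular of the L^p norm on subintervals\<close>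

text \<open>Values in \<open>ennreal\<close> allow estimates before finiteness is known. The
  interval is separate from \<open>T\<close> because functions on [0, T] are measured on short
  windows [a, b].\<close>

definition pmass :: "real \<Rightarrow> real \<Rightarrow> real \<Rightarrow> (real \<Rightarrow> 'a::real_normed_vector) \<Rightarrow> ennreal" where
  "pmass p a b f = (\<integral>\<^sup>+t. ennreal (norm (f t) powr p) \<partial>lebesgue_on {a..b})"

lemma pmass_eq: "pmass p a b f = (\<integral>\<^sup>+ t. indicator {a..b} t * ennreal (norm (f t) powr p) \<partial>lebesgue)"
  unfolding pmass_def by (subst nn_integral_restrict_space) (auto simp: mult.commute)

lemma Lp_iff: "Lp T p f \<longleftrightarrow> smeas T f \<and> pmass p 0 T f < \<infinity>"
  unfolding Lp_def pmass_eq ..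

lemma lpnorm_eq: "lpnorm T p f = enn2real (pmass p 0 T f) powr (1 / p)"
  unfolding lpnorm_def pmass_eq ..

lemma Lp_smeas: "Lp T p f \<Longrightarrow> smeas T f"
  by (simp add: Lp_iff)

lemma smeas_norm_measurable':
  assumes "smeas T f" "0 \<le> a" "b \<le> T"
  shows "(\<lambda>t. norm (f t)) \<in> borel_measurable (lebesgue_on {a..b})"
  using smeas_norm_measurable[OF assms(1)] by (rule measurable_restrict_mono) (use assms in auto)

lemma pmass_cong_AE:
  assumes "AE t in lebesgue_on {a..b}. norm (f t) = norm (g t)"
  shows "pmass p a b f = pmass p a b g"
  unfolding pmass_def using assms by (intro nn_integral_cong_AE) (auto elim!: eventually_mono)

lemma pmass_cong:
  assumes "\<And>t. t \<in> {a..b} \<Longrightarrow> norm (f t) = norm (g t)"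
  shows "pmass p a b f = pmass p a b g"
  using assms by (intro pmass_cong_AE AE_I2) auto

lemma pmass_0 [simp]: "pmass p a b (\<lambda>_. 0) = 0"
  by (simp add: pmass_def)

lemma pmass_mono:
  assumes "AE t in lebesgue_on {a..b}. norm (f t) \<le> norm (g t)" "p \<ge> 0"
  shows "pmass p a b f \<le> pmass p a b g"
  unfolding pmass_def using assms(1)
  by (intro nn_integral_mono_AE, eventually_elim) (auto intro!: ennreal_leI powr_mono2 assms)

lemma pmass_mono_interval:
  assumes "{a..b} \<subseteq> {c..d}"
  shows "pmass p a b f \<le> pmass p c d f"
  unfolding pmass_eq using assms by (intro nn_integral_mono mult_right_mono) (auto simp: indicator_def)

lemma pmass_scale:
  assumes "smeas T f" "0 \<le> a" "b \<le> T"
  shows "pmass p a b (\<lambda>t. c *\<^sub>R f t) = ennreal (\<bar>c\<bar> powr p) * pmass p a b f"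
proof -
  have [measurable]: "(\<lambda>t. norm (f t)) \<in> borel_measurable (lebesgue_on {a..b})"
    using assms by (rule smeas_norm_measurable')
  have "pmass p a b (\<lambda>t. c *\<^sub>R f t) =
      (\<integral>\<^sup>+t. ennreal (\<bar>c\<bar> powr p) * ennreal (norm (f t) powr p) \<partial>lebesgue_on {a..b})"
    unfolding pmass_def by (simp add: powr_mult ennreal_mult)
  also have "\<dots> = ennreal (\<bar>c\<bar> powr p) * pmass p a b f"
    unfolding pmass_def by (rule nn_integral_cmult) measurable
  finally show ?thesis .
qed

text \<open>The sum is at most twice the maximum. This crude constant reappears in the triangle
  inequalities for \<open>pmass\<close>.\<close>

lemma powr_add_le:
  fixes x y p :: real
  assumes "x \<ge> 0" "y \<ge> 0" "p \<ge> 0"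
  shows "(x + y) powr p \<le> 2 powr p * (x powr p + y powr p)"
proof -
  have "(x + y) powr p \<le> (2 * max x y) powr p"
    using assms by (intro powr_mono2) auto
  also have "\<dots> = 2 powr p * max x y powr p"
    using assms by (simp add: powr_mult)
  also have "max x y powr p \<le> x powr p + y powr p"
    by (auto simp: max_def)
  finally show ?thesis by simp
qed

text \<open>Pointwise domination is the common form of the later uses: sums, differences, and the
  bound that relative continuity gives for a perturbation.\<close>

lemma pmass_bound_add:
  assumes f: "smeas T f" and g: "smeas T g" and ab: "0 \<le> a" "b \<le> T" and p: "p \<ge> 0"
    and h: "AE t in lebesgue_on {a..b}. norm (h t) \<le> norm (f t) + norm (g t)"
  shows "pmass p a b h \<le> ennreal (2 powr p) * (pmass p a b f + pmass p a b g)"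
proof -
  have [measurable]: "(\<lambda>t. norm (f t)) \<in> borel_measurable (lebesgue_on {a..b})"
    "(\<lambda>t. norm (g t)) \<in> borel_measurable (lebesgue_on {a..b})"
    using f g ab by (auto intro: smeas_norm_measurable')
  have "pmass p a b h \<le> (\<integral>\<^sup>+t. ennreal (2 powr p) * (ennreal (norm (f t) powr p) + ennreal (norm (g t) powr p))
      \<partial>lebesgue_on {a..b})"
    unfolding pmass_def
  proof (rule nn_integral_mono_AE)
    show "AE t in lebesgue_on {a..b}. ennreal (norm (h t) powr p)
        \<le> ennreal (2 powr p) * (ennreal (norm (f t) powr p) + ennreal (norm (g t) powr p))"
      using h
    proof eventually_elim
      case (elim t)
      have "norm (h t) powr p \<le> (norm (f t) + norm (g t)) powr p"
        using p elim by (intro powr_mono2) auto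
      also have "\<dots> \<le> 2 powr p * (norm (f t) powr p + norm (g t) powr p)"
        using p by (intro powr_add_le) auto
      finally have "ennreal (norm (h t) powr p) \<le> ennreal (2 powr p * (norm (f t) powr p + norm (g t) powr p))"
        by (rule ennreal_leI)
      also have "\<dots> = ennreal (2 powr p) * (ennreal (norm (f t) powr p) + ennreal (norm (g t) powr p))"
        by (simp add: ennreal_mult ennreal_plus)
      finally show ?case .
    qed
  qed
  also have "\<dots> = ennreal (2 powr p) * (pmass p a b f + pmass p a b g)"
    unfolding pmass_def by (simp add: nn_integral_cmult nn_integral_add)
  finally show ?thesis .
qed

lemma pmass_add:
  assumes "smeas T f" "smeas T g" "0 \<le> a" "b \<le> T" "p \<ge> 0"
  shows "pmass p a b (\<lambda>t. f t + g t) \<le> ennreal (2 powr p) * (pmass p a b f + pmass p a b g)"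
  by (rule pmass_bound_add[OF assms]) (simp add: norm_triangle_ineq)

lemma pmass_diff:
  assumes "smeas T f" "smeas T g" "0 \<le> a" "b \<le> T" "p \<ge> 0"
  shows "pmass p a b (\<lambda>t. f t - g t) \<le> ennreal (2 powr p) * (pmass p a b f + pmass p a b g)"
  by (rule pmass_bound_add[OF assms]) (simp add: norm_triangle_ineq4)

lemma pmass_eq_0_iff:
  assumes "smeas T f" "0 \<le> a" "b \<le> T"
  shows "pmass p a b f = 0 \<longleftrightarrow> (AE t in lebesgue_on {a..b}. f t = 0)"
proof -
  have [measurable]: "(\<lambda>t. norm (f t)) \<in> borel_measurable (lebesgue_on {a..b})"
    using assms by (rule smeas_norm_measurable')
  have "pmass p a b f = 0 \<longleftrightarrow> (AE t in lebesgue_on {a..b}. ennreal (norm (f t) powr p) = 0)"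
    unfolding pmass_def by (rule nn_integral_0_iff_AE) measurable
  also have "\<dots> \<longleftrightarrow> (AE t in lebesgue_on {a..b}. f t = 0)"
    by (intro AE_cong) auto
  finally show ?thesis .
qed

lemma pmass_restrict:
  assumes "{a..b} \<subseteq> {c..d}"
  shows "pmass p c d (\<lambda>t. if t \<in> {a..b} then f t else 0) = pmass p a b f"
  unfolding pmass_eq using assms by (intro nn_integral_cong) (auto simp: indicator_def)

lemma pmass_const_finite:
  "pmass p a b (\<lambda>_. c) < \<infinity>"
  unfolding pmass_def
  by (cases "a \<le> b") (auto simp: emeasure_restrict_space ennreal_mult_less_top)

lemma pmass_const:
  "a \<le> b \<Longrightarrow> pmass p a b (\<lambda>_. c) = ennreal (norm c powr p * (b - a))"
  unfolding pmass_def by (simp add: emeasure_restrict_space ennreal_mult)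

section \<open>Closure properties of \<open>Lp\<close>\<close>

lemma Lp_add:
  assumes "Lp T p f" "Lp T p g" "p \<ge> 0"
  shows "Lp T p (\<lambda>t. f t + g t)"
proof -
  have "pmass p 0 T (\<lambda>t. f t + g t) \<le> ennreal (2 powr p) * (pmass p 0 T f + pmass p 0 T g)"
    using assms by (intro pmass_add) (auto simp: Lp_iff)
  also have "\<dots> < \<infinity>"
    using assms by (auto simp: Lp_iff ennreal_mult_less_top)
  finally show ?thesis
    using assms by (auto simp: Lp_iff intro: smeas_add)
qed

lemma Lp_bound:
  assumes "smeas T f" "Lp T p g" "p \<ge> 0" "C \<ge> 0"
    "AE t in lebesgue_on {0..T}. norm (f t) \<le> C * norm (g t)"
  shows "Lp T p f" "pmass p 0 T f \<le> ennreal (C powr p) * pmass p 0 T g"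
proof -
  have "pmass p 0 T f \<le> pmass p 0 T (\<lambda>t. C *\<^sub>R g t)"
    using assms by (intro pmass_mono) auto
  also have "\<dots> = ennreal (C powr p) * pmass p 0 T g"
    using assms by (subst pmass_scale[of T]) (auto simp: Lp_iff)
  finally show le: "pmass p 0 T f \<le> ennreal (C powr p) * pmass p 0 T g" .
  also have "\<dots> < \<infinity>"
    using assms(2) by (auto simp: Lp_iff ennreal_mult_less_top)
  finally show "Lp T p f"
    using assms by (auto simp: Lp_iff)
qed

lemma Lp_scale: "Lp T p f \<Longrightarrow> p \<ge> 0 \<Longrightarrow> Lp T p (\<lambda>t. c *\<^sub>R f t)"
  by (rule Lp_bound(1)[of T _ p f "\<bar>c\<bar>"])
    (auto intro: smeas_scaleR smeas_const simp: Lp_iff)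

lemma Lp_diff:
  assumes "Lp T p f" "Lp T p g" "p \<ge> 0"
  shows "Lp T p (\<lambda>t. f t - g t)"
  using Lp_add[OF assms(1) Lp_scale[OF assms(2,3), of "-1"] assms(3)] by simp

lemma Lp_const [simp, intro]: "Lp T p (\<lambda>_. c)"
  by (simp add: Lp_iff pmass_const_finite del: infinity_ennreal_def)

lemma Lp_cong_AE:
  assumes "Lp T p f" "AE t in lebesgue_on {0..T}. f t = g t"
  shows "Lp T p g"
proof -
  have "pmass p 0 T f = pmass p 0 T g"
    using assms(2) by (intro pmass_cong_AE) (auto elim!: eventually_mono)
  then show ?thesis
    using assms smeas_cong_AE by (auto simp: Lp_iff)
qed

lemma Lp_restrict:
  assumes "Lp T p f" "E \<in> sets lebesgue" "p \<ge> 0"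
  shows "Lp T p (\<lambda>t. if t \<in> E then f t else 0)"
proof (rule Lp_bound(1)[OF smeas_restrict[OF Lp_smeas[OF assms(1)] assms(2)] assms(1,3)])
  show "AE t in lebesgue_on {0..T}. norm (if t \<in> E then f t else 0) \<le> 1 * norm (f t)"
    by (rule AE_I2) simp
qed simp

lemma Lp_blinfun_family:
  fixes L :: "real \<Rightarrow> ('a::real_normed_vector \<Rightarrow>\<^sub>L 'b::real_normed_vector)"
  assumes "\<And>x. smeas T (\<lambda>t. L t x)" "Lp T p f" "p \<ge> 0" "C \<ge> 0" "\<And>t. t \<in> {0..T} \<Longrightarrow> norm (L t) \<le> C"
  shows "Lp T p (\<lambda>t. L t (f t))" "pmass p 0 T (\<lambda>t. L t (f t)) \<le> ennreal (C powr p) * pmass p 0 T f"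
proof -
  have "AE t in lebesgue_on {0..T}. norm (L t (f t)) \<le> C * norm (f t)"
    by (intro AE_I2 order.trans[OF norm_blinfun] mult_right_mono assms(5)) auto
  moreover have "smeas T (\<lambda>t. L t (f t))"
    by (rule smeas_blinfun_family[OF assms(1) Lp_smeas[OF assms(2)]])
  ultimately show "Lp T p (\<lambda>t. L t (f t))" "pmass p 0 T (\<lambda>t. L t (f t)) \<le> ennreal (C powr p) * pmass p 0 T f"
    using Lp_bound[of T "\<lambda>t. L t (f t)" p f C] assms(2-4) by blast+
qed

lemma Lp_blinfun: "Lp T p f \<Longrightarrow> p \<ge> 0 \<Longrightarrow> Lp T p (\<lambda>t. blinfun_apply L (f t))"
  by (rule Lp_blinfun_family(1)[of T "\<lambda>_. L" p f "norm L"]) auto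

lemma Lp_continuous_on:
  assumes "continuous_on {0..T} f" "p \<ge> 0"
  shows "Lp T p f"
proof -
  have "compact (f ` {0..T})"
    using assms by (intro compact_continuous_image) auto
  then obtain C where "\<And>t. t \<in> {0..T} \<Longrightarrow> norm (f t) \<le> C"
    using compact_imp_bounded by (fastforce simp: bounded_iff)
  then have "AE t in lebesgue_on {0..T}. norm (f t) \<le> \<bar>C\<bar> * norm (1::real)"
    by (intro AE_I2) force
  then show ?thesis
    using Lp_bound(1)[of T f p "\<lambda>_. 1::real" "\<bar>C\<bar>"] assms smeas_continuous_on by auto
qed

text \<open>For \<open>x > l\<close> the factor \<open>(x / l) powr (p - 1)\<close> is at least 1.
  With \<open>l = 1\<close> this embeds L^p of a bounded interval into L^1; with a chosen
  \<open>l\<close> it replaces Hoelder's inequality.\<close>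

lemma le_one_plus_powr:
  fixes x p l :: real
  assumes "x \<ge> 0" "p \<ge> 1" "l > 0"
  shows "x \<le> l + l powr (1 - p) * x powr p"
proof (cases "x \<le> l")
  case False
  then have "x powr (p - 1) \<ge> l powr (p - 1)"
    using assms by (intro powr_mono2) auto
  then have "1 \<le> l powr (1 - p) * x powr (p - 1)"
    using assms False by (simp add: powr_diff field_simps)
  then have "x * 1 \<le> x * (l powr (1 - p) * x powr (p - 1))"
    using assms by (intro mult_left_mono) auto
  also have "\<dots> = l powr (1 - p) * x powr p"
    using assms False by (simp add: powr_diff)
  finally show ?thesis using assms by simp
qed (use assms in \<open>auto intro: add_increasing2\<close>)

lemma Lp_integrable:
  fixes f :: "real \<Rightarrow> 'a::banach"
  assumes f: "Lp T p f" and p: "p \<ge> 1" and ab: "0 \<le> a" "b \<le> T"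
  shows "(\<lambda>t. norm (f t)) integrable_on {a..b}" "(\<lambda>t. norm (f t) powr p) integrable_on {a..b}"
    "f integrable_on {a..b}" "pmass p a b f = ennreal (integral {a..b} (\<lambda>t. norm (f t) powr p))"
proof -
  let ?M = "lebesgue_on {0..T}"
  have sub: "{a..b} \<subseteq> {0..T}" using ab by auto
  have [measurable]: "(\<lambda>t. norm (f t)) \<in> borel_measurable ?M"
    using f smeas_norm_measurable by (auto simp: Lp_iff)
  have P: "(\<integral>\<^sup>+t. ennreal (norm (f t) powr p) \<partial>?M) < \<infinity>"
    using f by (simp add: Lp_iff pmass_def)
  note I = nn_integrable_imp_integrable[of "\<lambda>t. norm (f t) powr p" 0 T, OF _ _ P, simplified]
  have int: "integrable ?M (\<lambda>t. norm (f t))"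
  proof (rule Bochner_Integration.integrable_bound)
    show "integrable ?M (\<lambda>t. 1 + norm (f t) powr p)"
      using I(1) by (intro Bochner_Integration.integrable_add) auto
    show "AE t in ?M. norm (norm (f t)) \<le> norm (1 + norm (f t) powr p)"
      using le_one_plus_powr[of _ p 1] p by (intro AE_I2) auto
  qed auto
  show "(\<lambda>t. norm (f t)) integrable_on {a..b}"
    using has_integral_integral_lebesgue_on[OF int] sub integrable_on_subinterval[of _ "{0..T}" a b] by auto
  show "f integrable_on {a..b}"
    using smeas_integrable_on[OF _ int] f sub integrable_on_subinterval[of f "{0..T}" a b]
    by (auto simp: Lp_iff)
  have P': "(\<integral>\<^sup>+t. ennreal (norm (f t) powr p) \<partial>lebesgue_on {a..b}) < \<infinity>"
    using pmass_mono_interval[OF sub, of p f] f unfolding Lp_iff by (auto simp: pmass_def)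
  have m: "(\<lambda>t. norm (f t)) \<in> borel_measurable (lebesgue_on {a..b})"
    using f ab smeas_norm_measurable' by (auto simp: Lp_iff)
  note I' = nn_integrable_imp_integrable[of "\<lambda>t. norm (f t) powr p" a b, OF _ _ P']
  show "(\<lambda>t. norm (f t) powr p) integrable_on {a..b}"
    "pmass p a b f = ennreal (integral {a..b} (\<lambda>t. norm (f t) powr p))"
    using I'(2,3) m by (auto simp: pmass_def)
qed

text \<open>Hoelder's inequality up to a factor of two, obtained by integrating
  \<open>\<parallel>f\<parallel> \<le> l + l powr (1 - p) * \<parallel>f\<parallel> powr p\<close> with \<open>l\<close> half the mean of \<open>\<parallel>f\<parallel>\<close>.\<close>

lemma Lp_integral_bound:
  fixes f :: "real \<Rightarrow> 'a::banach"
  assumes f: "Lp T p f" and p: "p > 1" and ab: "0 \<le> a" "a \<le> b" "b \<le> T"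
  shows "ennreal (norm (integral {a..b} f) powr p) \<le> ennreal (2 powr p * (b - a) powr (p - 1)) * pmass p a b f"
proof -
  define m where "m = integral {a..b} (\<lambda>t. norm (f t))"
  define P where "P = integral {a..b} (\<lambda>t. norm (f t) powr p)"
  note I = Lp_integrable[OF f _ ab(1) ab(3)]
  have nm: "norm (integral {a..b} f) \<le> m"
    unfolding m_def using p I by (intro integral_norm_bound_integral) auto
  have "P \<ge> 0" unfolding P_def using p I by (intro integral_nonneg) auto
  have "m powr p \<le> 2 powr p * (b - a) powr (p - 1) * P"
  proof (cases "m > 0")
    case True
    have ab': "a < b"
    proof (rule ccontr)
      assume "\<not> a < b"
      then have "m = 0" using ab by (simp add: m_def)
      with True show False by simp
    qed
    \<comment> \<open>With this value the term \<open>l * (b - a)\<close> equals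
      \<open>m / 2\<close> and can be absorbed into the left-hand side.\<close>
    define l where "l = m / (2 * (b - a))"
    have l: "l > 0" using True ab' by (simp add: l_def)
    have "m \<le> integral {a..b} (\<lambda>t. l + l powr (1 - p) * norm (f t) powr p)"
      unfolding m_def using p I l le_one_plus_powr
      by (intro integral_le) (auto intro!: integrable_add integrable_on_mult_right)
    also have "\<dots> = l * (b - a) + l powr (1 - p) * P"
      using p I ab by (subst integral_add) (auto intro!: integrable_on_mult_right simp: P_def)
    finally have "m \<le> l * (b - a) + l powr (1 - p) * P" .
    moreover have "l * (b - a) = m / 2"
      using ab' by (simp add: l_def divide_simps)
    ultimately have "m / 2 \<le> l powr (1 - p) * P"
      by simp
    then have "l powr (p - 1) * (m / 2) \<le> l powr (p - 1) * (l powr (1 - p) * P)"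
      by (intro mult_left_mono) auto
    also have "\<dots> = P"
      using l by (simp add: mult.assoc[symmetric] powr_add[symmetric])
    finally have "l powr (p - 1) * (m / 2) \<le> P" .
    moreover have "m powr p = 2 powr p * (b - a) powr (p - 1) * (l powr (p - 1) * (m / 2))"
    proof -
      have "m powr p = 2 powr p * h powr (p - 1) * ((m / (2 * h)) powr (p - 1) * (m / 2))" if "h > 0" for h
        using True that by (simp add: powr_divide powr_mult powr_diff)
      from this[of "b - a"] show ?thesis
        using ab' by (simp only: l_def)
    qed
    ultimately show ?thesis
      by (metis mult_left_mono mult_nonneg_nonneg powr_ge_zero)
  next
    case False
    have "m \<ge> 0" unfolding m_def using p I by (intro integral_nonneg) auto
    with False have "m = 0" by simp
    then show ?thesis using \<open>P \<ge> 0\<close> by simp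
  qed
  moreover have "norm (integral {a..b} f) powr p \<le> m powr p"
    using nm p by (intro powr_mono2) auto
  ultimately have "ennreal (norm (integral {a..b} f) powr p) \<le> ennreal (2 powr p * (b - a) powr (p - 1) * P)"
    by (intro ennreal_leI) linarith
  also have "\<dots> = ennreal (2 powr p * (b - a) powr (p - 1)) * pmass p a b f"
    using I(4) p \<open>P \<ge> 0\<close> by (simp add: P_def ennreal_mult)
  finally show ?thesis .
qed


section \<open>Affine changes of variable\<close>

lemma measurable_lebesgue_real_affine:
  "c \<noteq> 0 \<Longrightarrow> (\<lambda>x::real. d + c * x) \<in> lebesgue \<rightarrow>\<^sub>M lebesgue"
  using lebesgue_affine_measurable[where c = "\<lambda>_::real. c" and t = d] by simp

text \<open>The substitution rule, applied to the indicator of a null set, shows that its preimage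
  is null.\<close>

lemma AE_lebesgue_real_affine:
  fixes c d :: real
  assumes P: "AE x in lebesgue. P x" and c: "c \<noteq> 0"
  shows "AE x in lebesgue. P (d + c * x)"
proof -
  obtain N where N: "N \<in> null_sets lebesgue" "{x. \<not> P x} \<subseteq> N"
    using P unfolding eventually_ae_filter by auto
  let ?N = "(\<lambda>x. d + c * x) -` N"
  have [measurable]: "N \<in> sets lebesgue" "?N \<in> sets lebesgue"
    using N measurable_sets[OF measurable_lebesgue_real_affine[OF c], of N d] by auto
  have "ennreal \<bar>c\<bar> * (\<integral>\<^sup>+x. indicator N (d + c * x) \<partial>lebesgue) = emeasure lebesgue N"
    using nn_integral_real_affine_lebesgue[of "indicator N" c d] c by simp
  also have "\<dots> = 0"
    using N by auto
  finally have "(\<integral>\<^sup>+x. indicator N (d + c * x) \<partial>lebesgue) = 0"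
    using c by auto
  also have "(\<lambda>x. indicator N (d + c * x)) = (indicator ?N :: real \<Rightarrow> ennreal)"
    by (auto simp: indicator_def)
  finally have "?N \<in> null_sets lebesgue"
    by (auto simp: null_sets_def)
  then show ?thesis
    by (rule AE_I') (use N in auto)
qed

text \<open>Extension by zero outside [0, T] makes the target interval [0, S] independent of
  \<open>T\<close>. Shifts and windows use \<open>c = 1\<close>, time reversal uses
  \<open>c = -1\<close>.\<close>

lemma smeas_affine:
  assumes f: "smeas T f" and c: "c \<noteq> 0"
  shows "smeas S (\<lambda>t. if d + c * t \<in> {0..T} then f (d + c * t) else 0)"
proof -
  obtain s where s: "\<And>n. simple_function (lebesgue_on {0..T}) (s n)"
      "AE t in lebesgue_on {0..T}. (\<lambda>n. s n t) \<longlonglongrightarrow> f t"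
    using f unfolding smeas_iff_simple by blast
  define r where "r n t = (if d + c * t \<in> {0..T} then s n (d + c * t) else 0)" for n t
  have "simple_function (lebesgue_on {0..S}) (r n)" for n
    unfolding simple_function_def space_lebesgue_on
  proof (intro conjI ballI)
    have "finite (s n ` {0..T})"
      using s(1)[of n] by (simp add: simple_function_def)
    then show "finite (r n ` {0..S})"
      by (rule finite_subset[rotated, OF finite_insert[THEN iffD2]]) (auto simp: r_def)
    fix y
    let ?L = "{x \<in> {0..T}. s n x = y}"
    have "s n -` {y} \<inter> space (lebesgue_on {0..T}) \<in> sets (lebesgue_on {0..T})"
      using s(1)[of n] by (rule simple_functionD)
    then have "?L \<in> sets (lebesgue_on {0..T})"
      by (rule back_subst[of "\<lambda>A. A \<in> sets (lebesgue_on {0..T})"]) auto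
    then have L: "?L \<in> sets lebesgue"
      by (subst (asm) sets_restrict_space_iff) auto
    \<comment> \<open>For \<open>y = 0\<close> the level set also contains the points whose image
      lies outside [0, T].\<close>
    then have "?L \<union> (if y = 0 then - {0..T} else {}) \<in> sets lebesgue"
      by auto
    then have "(\<lambda>x. d + c * x) -` (?L \<union> (if y = 0 then - {0..T} else {})) \<inter> space lebesgue \<in> sets lebesgue"
      by (rule measurable_sets[OF measurable_lebesgue_real_affine[OF c]])
    then have "(\<lambda>x. d + c * x) -` (?L \<union> (if y = 0 then - {0..T} else {})) \<in> sets lebesgue"
      by (simp del: vimage_Un)
    then have "((\<lambda>x. d + c * x) -` (?L \<union> (if y = 0 then - {0..T} else {}))) \<inter> {0..S} \<in> sets lebesgue"
      by (rule sets.Int) simp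
    moreover have "((\<lambda>x. d + c * x) -` (?L \<union> (if y = 0 then - {0..T} else {}))) \<inter> {0..S} = r n -` {y} \<inter> {0..S}"
    proof (rule set_eqI)
      fix x
      show "x \<in> ((\<lambda>x. d + c * x) -` (?L \<union> (if y = 0 then - {0..T} else {}))) \<inter> {0..S} \<longleftrightarrow> x \<in> r n -` {y} \<inter> {0..S}"
        by (cases "d + c * x \<in> {0..T}"; cases "y = 0") (simp_all add: r_def del: atLeastAtMost_iff)
    qed
    ultimately have "r n -` {y} \<inter> {0..S} \<in> sets lebesgue"
      by (simp only:)
    then show "r n -` {y} \<inter> {0..S} \<in> sets (lebesgue_on {0..S})"
      by (subst sets_restrict_space_iff) simp_all
  qed
  moreover have "AE t in lebesgue_on {0..S}. (\<lambda>n. r n t) \<longlonglongrightarrow> (if d + c * t \<in> {0..T} then f (d + c * t) else 0)"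
    using AE_lebesgue_real_affine[OF s(2)[unfolded AE_lebesgue_on_iff] c, of d]
    unfolding AE_lebesgue_on_iff 
  proof eventually_elim
    case (elim t)
    then show ?case
      by (cases "d + c * t \<in> {0..T}") (simp_all add: r_def del: atLeastAtMost_iff)
  qed
  ultimately show ?thesis
    unfolding smeas_iff_simple by (intro exI[of _ r] conjI allI)
qed

lemma pmass_affine:
  assumes f: "smeas T f" and ab: "0 \<le> a" "b \<le> T" and c: "\<bar>c\<bar> = 1"
    and E: "\<And>x. d + c * x \<in> {a..b} \<longleftrightarrow> x \<in> {a'..b'}"
  shows "pmass p a' b' (\<lambda>t. f (d + c * t)) = pmass p a b f"
proof -
  have "(\<lambda>t. norm (f t) powr p) \<in> borel_measurable (lebesgue_on {a..b})"
    using smeas_norm_measurable'[OF f ab] by measurable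
  then have "(\<lambda>t. if t \<in> {a..b} then norm (f t) powr p else 0) \<in> borel_measurable lebesgue"
    by (intro borel_measurable_if_I) auto
  then have "(\<lambda>t. ennreal (if t \<in> {a..b} then norm (f t) powr p else 0)) \<in> borel_measurable lebesgue"
    by measurable
  moreover have eq: "(\<lambda>t. ennreal (if t \<in> {a..b} then norm (f t) powr p else 0))
      = (\<lambda>t. indicator {a..b} t * ennreal (norm (f t) powr p))"
    by (auto simp: indicator_def)
  ultimately have m: "(\<lambda>t. indicator {a..b} t * ennreal (norm (f t) powr p)) \<in> borel_measurable lebesgue"
    by metis
  have "pmass p a b f = (\<integral>\<^sup>+t. indicator {a..b} (d + c * t) * ennreal (norm (f (d + c * t)) powr p) \<partial>lebesgue)"
    unfolding pmass_eq using nn_integral_real_affine_lebesgue[OF m, of c d] c by auto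
  also have "\<dots> = pmass p a' b' (\<lambda>t. f (d + c * t))"
    unfolding pmass_eq using E by (intro nn_integral_cong) (auto simp: indicator_def)
  finally show ?thesis by simp
qed

lemma pmass_shift:
  assumes "smeas T f" "0 \<le> a" "b \<le> T"
  shows "pmass p (a + d) (b + d) (\<lambda>t. f (t - d)) = pmass p a b f"
  using pmass_affine[OF assms, of 1 "-d" "a + d" "b + d"] by (simp add: field_simps)

lemma pmass_reverse:
  assumes "smeas T f" "0 \<le> a" "b \<le> T"
  shows "pmass p (d - b) (d - a) (\<lambda>t. f (d - t)) = pmass p a b f"
  using pmass_affine[OF assms, of "-1" "d" "d - b" "d - a"] by (simp add: field_simps conj_commute)

lemma has_integral_shift:
  fixes f :: "real \<Rightarrow> 'a::real_normed_vector"
  assumes "(f has_integral i) {a..b}"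
  shows "((\<lambda>t. f (t - d)) has_integral i) {a + d..b + d}"
  using has_integral_affinity'[of f i a b 1 "-d"] assms by simp

lemma has_integral_reverse:
  fixes f :: "real \<Rightarrow> 'a::real_normed_vector"
  assumes "(f has_integral i) {a..b}"
  shows "((\<lambda>t. f (d - t)) has_integral i) {d - b..d - a}"
proof -
  have "((\<lambda>t. f (- t)) has_integral i) {-b..-a}"
    using assms by simp
  from has_integral_shift[OF this, of d] show ?thesis
    by (simp add: algebra_simps)
qed

section \<open>The maximal regularity space and causality\<close>

lemma AE_lebesgue_on_mono:
  assumes "AE t in lebesgue_on {c..d::real}. P t" "{a..b} \<subseteq> {c..d}"
  shows "AE t in lebesgue_on {a..b}. P t"
  using assms(1) unfolding AE_lebesgue_on_iff by eventually_elim (use assms(2) in blast)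

lemma AE_lebesgue_on_space: "(\<And>t. t \<in> {a..b} \<Longrightarrow> P t) \<Longrightarrow> AE t in lebesgue_on {a..b::real}. P t"
  by (rule AE_I2) simp

text \<open>Filling with zero creates no jump when \<open>u 0 = 0\<close>, so this right shift maps
  solutions with zero initial value to such solutions. Mass moved beyond \<open>T\<close> is lost,
  whence the inequality in \<open>pmass_sh_le\<close>.\<close>

definition sh :: "real \<Rightarrow> (real \<Rightarrow> 'a::real_normed_vector) \<Rightarrow> real \<Rightarrow> 'a" where
  "sh d f t = (if t \<ge> d then f (t - d) else 0)"

lemma pmass_sh:
  assumes "smeas T f" "0 \<le> a" "b \<le> T"
  shows "pmass p (a + d) (b + d) (sh d f) = pmass p a b f"
proof -
  have "pmass p (a + d) (b + d) (sh d f) = pmass p (a + d) (b + d) (\<lambda>t. f (t - d))"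
    using assms by (intro pmass_cong) (auto simp: sh_def)
  then show ?thesis
    using pmass_shift[OF assms] by simp
qed

lemma smeas_sh:
  assumes "smeas T f" "d \<ge> 0"
  shows "smeas T (sh d f)"
  using smeas_affine[OF assms(1), of 1 T "-d"]
  by (rule smeas_cong_AE) (use assms(2) in \<open>auto simp: sh_def intro!: AE_lebesgue_on_space\<close>)

lemma pmass_sh_le:
  assumes "smeas T f" "0 \<le> d" "d \<le> T"
  shows "pmass p 0 T (sh d f) \<le> pmass p 0 T f"
proof -
  have "pmass p 0 T (sh d f) = pmass p 0 T (\<lambda>t. if t \<in> {0 + d..(T - d) + d} then sh d f t else 0)"
    using assms by (intro pmass_cong) (auto simp: sh_def)
  also have "\<dots> = pmass p (0 + d) ((T - d) + d) (sh d f)"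
    using assms by (intro pmass_restrict) auto
  also have "\<dots> = pmass p 0 (T - d) f"
    using assms by (intro pmass_sh[of T]) auto
  also have "\<dots> \<le> pmass p 0 T f"
    using assms by (intro pmass_mono_interval) auto
  finally show ?thesis .
qed

lemma Lp_sh: "Lp T p f \<Longrightarrow> 0 \<le> d \<Longrightarrow> d \<le> T \<Longrightarrow> Lp T p (sh d f)"
  using pmass_sh_le[of T f d p] smeas_sh[of T f d] by (auto simp: Lp_iff)

lemma AE_sh:
  fixes b d :: real
  assumes "AE t in lebesgue_on {0..b}. P t"
  shows "AE t in lebesgue_on {d..b + d}. P (t - d)"
  using AE_lebesgue_real_affine[OF assms[unfolded AE_lebesgue_on_iff], of 1 "-d"]
  unfolding AE_lebesgue_on_iff by (auto elim!: eventually_mono)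

lemma has_integral_sh:
  fixes v :: "real \<Rightarrow> 'a::banach"
  assumes v: "\<And>t. t \<in> {0..T} \<Longrightarrow> (v has_integral u t) {0..t}" and d: "0 \<le> d" and t: "t \<in> {0..T}" "u 0 = 0"
  shows "(sh d v has_integral sh d u t) {0..t}"
proof -
  have Z: "(sh d v has_integral 0) {0..r}" if "r \<le> d" for r
  \<comment> \<open>At the single point \<open>d\<close> the value is \<open>v 0\<close>, which may
    be nonzero.\<close>
  proof (rule has_integral_spike_finite[where S = "{d}" and f = "\<lambda>_. 0"])
    show "sh d v x = 0" if "x \<in> {0..r} - {d}" for x
      using that \<open>r \<le> d\<close> by (auto simp: sh_def)
  qed auto
  show ?thesis
  proof (cases "t \<le> d")
    case True
    then have "sh d u t = 0"
      using t by (auto simp: sh_def)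
    with Z[OF True] show ?thesis by simp
  next
    case False
    have "(v has_integral u (t - d)) {0..t - d}"
      using t d False by (intro v) auto
    from has_integral_shift[OF this, of d]
    have "((\<lambda>s. v (s - d)) has_integral u (t - d)) {d..t}"
      by simp
    then have "(sh d v has_integral u (t - d)) {d..t}"
      by (rule has_integral_eq[rotated]) (auto simp: sh_def)
    from has_integral_combine[OF d _ Z[of d] this] False show ?thesis
      by (auto simp: sh_def)
  qed
qed

locale evolution =
  fixes T p :: real and J :: "'d::banach \<Rightarrow>\<^sub>L 'x::banach"
  assumes T_pos: "T > 0" and p_gt1: "p > 1" and J_inj: "inj (blinfun_apply J)"
begin

text \<open>\<open>MR u v g\<close>: \<open>u\<close> lies in the maximal regularity space, with derivative \<open>v\<close> and
  \<open>D\<close>-valued representative \<open>g\<close>.\<close>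

definition MR :: "(real \<Rightarrow> 'x) \<Rightarrow> (real \<Rightarrow> 'x) \<Rightarrow> (real \<Rightarrow> 'd) \<Rightarrow> bool" where
  "MR u v g \<longleftrightarrow> Lp T p v \<and> Lp T p g \<and> (\<forall>t\<in>{0..T}. (v has_integral (u t - u 0)) {0..t}) \<and>
     (AE t in lebesgue_on {0..T}. u t = J (g t))"

lemma p_nonneg: "p \<ge> 0" "p \<ge> 1" "p > 0"
  using p_gt1 by auto

lemma MR_continuous:
  assumes "MR u v g"
  shows "continuous_on {0..T} u"
proof -
  have v: "v integrable_on {0..T}"
    using assms T_pos Lp_integrable(3)[of T p v 0 T] p_nonneg by (auto simp: MR_def)
  have "continuous_on {0..T} (\<lambda>t. u 0 + integral {0..t} v)"
    by (intro continuous_intros indefinite_integral_continuous_1[OF v])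
  then show ?thesis
  proof (rule continuous_on_eq)
    show "u 0 + integral {0..t} v = u t" if "t \<in> {0..T}" for t
      using assms that integral_unique[of v "u t - u 0" "{0..t}"] by (auto simp: MR_def)
  qed
qed

text \<open>\<open>Jinv J\<close> inverts \<open>J\<close> only on its range, so it recovers
  \<open>g\<close> almost everywhere and not at every point.\<close>

lemma MR_inMR:
  assumes "MR u v g"
  shows "inMR T p J u" "wderiv T p u v" "AE t in lebesgue_on {0..T}. Jinv J (u t) = g t"
proof -
  show eq: "AE t in lebesgue_on {0..T}. Jinv J (u t) = g t"
  proof -
    have "AE t in lebesgue_on {0..T}. u t = J (g t)"
      using assms by (simp add: MR_def)
    then show ?thesis
      by eventually_elim (simp add: Jinv_def J_inj)
  qed
  show wd: "wderiv T p u v"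
    using assms by (auto simp: MR_def wderiv_def)
  have "Lp T p u"
    using MR_continuous[OF assms] p_nonneg by (intro Lp_continuous_on)
  moreover have "AE t in lebesgue. t \<in> {0..T} \<longrightarrow> u t \<in> range (blinfun_apply J)"
  proof -
    have "AE t in lebesgue_on {0..T}. u t = J (g t)"
      using assms by (simp add: MR_def)
    then show ?thesis
      unfolding AE_lebesgue_on_iff by eventually_elim auto
  qed
  moreover have "Lp T p (\<lambda>t. Jinv J (u t))"
  proof (rule Lp_cong_AE)
    show "Lp T p g" using assms by (simp add: MR_def)
    show "AE t in lebesgue_on {0..T}. g t = Jinv J (u t)"
      using eq by eventually_elim simp
  qed
  ultimately show "inMR T p J u"
    using wd by (auto simp: inMR_def W1p_def)
qed

lemma inMR_MR:
  assumes "inMR T p J u" "wderiv T p u v"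
  shows "MR u v (\<lambda>t. Jinv J (u t))"
proof -
  have "AE t in lebesgue. t \<in> {0..T} \<longrightarrow> u t \<in> range (blinfun_apply J)"
    using assms by (simp add: inMR_def)
  then have "AE t in lebesgue_on {0..T}. u t = J (Jinv J (u t))"
    unfolding AE_lebesgue_on_iff by eventually_elim (simp add: Jinv_def f_inv_into_f)
  then show ?thesis
    using assms by (simp add: MR_def inMR_def wderiv_def)
qed

lemma MR_zero: "MR (\<lambda>_. 0) (\<lambda>_. 0) (\<lambda>_. 0)"
  by (simp add: MR_def)

lemma MR_add:
  assumes "MR u v g" "MR u' v' g'"
  shows "MR (\<lambda>t. u t + u' t) (\<lambda>t. v t + v' t) (\<lambda>t. g t + g' t)"
  unfolding MR_def
proof (intro conjI ballI)
  show "Lp T p (\<lambda>t. v t + v' t)" "Lp T p (\<lambda>t. g t + g' t)"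
    using assms p_nonneg by (auto simp: MR_def intro!: Lp_add)
  show "((\<lambda>t. v t + v' t) has_integral (u t + u' t - (u 0 + u' 0))) {0..t}" if "t \<in> {0..T}" for t
    using has_integral_add[of v "u t - u 0" "{0..t}" v' "u' t - u' 0"] that assms
    by (auto simp: MR_def algebra_simps)
  have "AE t in lebesgue_on {0..T}. u t = J (g t)" "AE t in lebesgue_on {0..T}. u' t = J (g' t)"
    using assms by (auto simp: MR_def)
  then show "AE t in lebesgue_on {0..T}. u t + u' t = J (g t + g' t)"
    by eventually_elim (simp add: blinfun.add_right)
qed

lemma MR_scale:
  assumes "MR u v g"
  shows "MR (\<lambda>t. c *\<^sub>R u t) (\<lambda>t. c *\<^sub>R v t) (\<lambda>t. c *\<^sub>R g t)"
  unfolding MR_def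
proof (intro conjI ballI)
  show "Lp T p (\<lambda>t. c *\<^sub>R v t)" "Lp T p (\<lambda>t. c *\<^sub>R g t)"
    using assms p_nonneg by (auto simp: MR_def intro!: Lp_scale)
  show "((\<lambda>t. c *\<^sub>R v t) has_integral (c *\<^sub>R u t - c *\<^sub>R u 0)) {0..t}" if "t \<in> {0..T}" for t
    using has_integral_cmul[of v "u t - u 0" "{0..t}" c] that assms
    by (auto simp: MR_def algebra_simps)
  have "AE t in lebesgue_on {0..T}. u t = J (g t)"
    using assms by (auto simp: MR_def)
  then show "AE t in lebesgue_on {0..T}. c *\<^sub>R u t = J (c *\<^sub>R g t)"
    by eventually_elim (simp add: blinfun.scaleR_right)
qed

lemma MR_diff:
  assumes "MR u v g" "MR u' v' g'"
  shows "MR (\<lambda>t. u t - u' t) (\<lambda>t. v t - v' t) (\<lambda>t. g t - g' t)"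
  using MR_add[OF assms(1) MR_scale[OF assms(2), of "-1"]] by simp

lemma MR_sh:
  assumes u: "MR u v g" "u 0 = 0" and d: "0 \<le> d" "d \<le> T"
  shows "MR (sh d u) (sh d v) (sh d g)"
  unfolding MR_def
proof (intro conjI ballI)
  show "Lp T p (sh d v)" "Lp T p (sh d g)"
    using u d by (auto simp: MR_def intro!: Lp_sh)
  have "sh d u 0 = 0"
    using u d by (auto simp: sh_def)
  then show "(sh d v has_integral (sh d u t - sh d u 0)) {0..t}" if "t \<in> {0..T}" for t
    using has_integral_sh[of T v u d t] that u d by (auto simp: MR_def)
  have "AE t in lebesgue_on {0..T}. u t = J (g t)"
    using u by (auto simp: MR_def)
  from AE_sh[OF this, of d] have "AE t in lebesgue_on {d..T + d}. u (t - d) = J (g (t - d))" .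
  then show "AE t in lebesgue_on {0..T}. sh d u t = J (sh d g t)"
    unfolding AE_lebesgue_on_iff by eventually_elim (use d in \<open>auto simp: sh_def\<close>)
qed

section \<open>The equation with a constant operator and zero initial value\<close>

definition Sol :: "('d \<Rightarrow>\<^sub>L 'x) \<Rightarrow> (real \<Rightarrow> 'x) \<Rightarrow> (real \<Rightarrow> 'x) \<Rightarrow> (real \<Rightarrow> 'x) \<Rightarrow> (real \<Rightarrow> 'd) \<Rightarrow> bool" where
  "Sol C f u v g \<longleftrightarrow> MR u v g \<and> u 0 = 0 \<and> (AE t in lebesgue_on {0..T}. v t + C (g t) = f t)"

lemma Sol_zero: "Sol C (\<lambda>_. 0) (\<lambda>_. 0) (\<lambda>_. 0) (\<lambda>_. 0)"
  by (simp add: Sol_def MR_zero)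

lemma Sol_add:
  assumes "Sol C f u v g" "Sol C f' u' v' g'"
  shows "Sol C (\<lambda>t. f t + f' t) (\<lambda>t. u t + u' t) (\<lambda>t. v t + v' t) (\<lambda>t. g t + g' t)"
proof -
  have "AE t in lebesgue_on {0..T}. v t + C (g t) = f t" "AE t in lebesgue_on {0..T}. v' t + C (g' t) = f' t"
    using assms by (auto simp: Sol_def)
  then have "AE t in lebesgue_on {0..T}. v t + v' t + C (g t + g' t) = f t + f' t"
  proof eventually_elim
    case (elim t)
    show ?case unfolding elim[symmetric] by (simp add: blinfun.add_right)
  qed
  then show ?thesis
    using assms MR_add by (auto simp: Sol_def)
qed

lemma Sol_scale:
  assumes "Sol C f u v g"
  shows "Sol C (\<lambda>t. c *\<^sub>R f t) (\<lambda>t. c *\<^sub>R u t) (\<lambda>t. c *\<^sub>R v t) (\<lambda>t. c *\<^sub>R g t)"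
proof -
  have "AE t in lebesgue_on {0..T}. v t + C (g t) = f t"
    using assms by (auto simp: Sol_def)
  then have "AE t in lebesgue_on {0..T}. c *\<^sub>R v t + C (c *\<^sub>R g t) = c *\<^sub>R f t"
    by eventually_elim (auto simp: blinfun.scaleR_right scaleR_add_right[symmetric])
  then show ?thesis
    using assms MR_scale by (auto simp: Sol_def)
qed

lemma Sol_diff:
  assumes "Sol C f u v g" "Sol C f' u' v' g'"
  shows "Sol C (\<lambda>t. f t - f' t) (\<lambda>t. u t - u' t) (\<lambda>t. v t - v' t) (\<lambda>t. g t - g' t)"
  using Sol_add[OF assms(1) Sol_scale[OF assms(2), of "-1"]] by simp

lemma Sol_cong:
  assumes "Sol C f u v g" "AE t in lebesgue_on {0..T}. f t = f' t"
  shows "Sol C f' u v g"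
proof -
  have "AE t in lebesgue_on {0..T}. v t + C (g t) = f t"
    using assms by (auto simp: Sol_def)
  then have "AE t in lebesgue_on {0..T}. v t + C (g t) = f' t"
    using assms(2) by eventually_elim auto
  then show ?thesis
    using assms by (auto simp: Sol_def)
qed

lemma Sol_sh:
  assumes "Sol C f u v g" and d: "0 \<le> d" "d \<le> T"
  shows "Sol C (sh d f) (sh d u) (sh d v) (sh d g)"
proof -
  have "AE t in lebesgue_on {0..T}. v t + C (g t) = f t"
    using assms by (auto simp: Sol_def)
  from AE_sh[OF this, of d]
  have "AE t in lebesgue_on {0..T}. sh d v t + C (sh d g t) = sh d f t"
    unfolding AE_lebesgue_on_iff by eventually_elim (use d in \<open>auto simp: sh_def\<close>)
  moreover have "sh d u 0 = 0"
    using assms by (auto simp: sh_def Sol_def)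
  ultimately show ?thesis
    using assms MR_sh by (auto simp: Sol_def)
qed

lemma Sol_smeas:
  assumes "Sol C f u v g"
  shows "smeas T v" "smeas T g" "Lp T p v" "Lp T p g"
  using assms by (auto simp: Sol_def MR_def Lp_iff)

lemma maxreg_exists:
  assumes "maxreg T p J C" "Lp T p f"
  shows "\<exists>u v g. Sol C f u v g"
proof -
  obtain u v where u: "inMR T p J u" "u 0 = 0" "wderiv T p u v"
    "AE t in lebesgue. t \<in> {0..T} \<longrightarrow> v t + C (Jinv J (u t)) = f t"
    using assms unfolding maxreg_def Let_def by blast
  then have "Sol C f u v (\<lambda>t. Jinv J (u t))"
    using inMR_MR[of u v] by (simp add: Sol_def AE_lebesgue_on_iff)
  then show ?thesis by blast
qed

lemma Sol_unique:
  assumes "maxreg T p J C" "Lp T p f" "Sol C f u v g" "Sol C f u' v' g'" "t \<in> {0..T}"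
  shows "u t = u' t"
proof -
  have sol: "inMR T p J u \<and> u 0 = 0 \<and> (\<exists>v. wderiv T p u v \<and>
      (AE t in lebesgue. t \<in> {0..T} \<longrightarrow> v t + C (Jinv J (u t)) = f t))"
    if "Sol C f u v g" for u v g
  proof -
    have MR: "MR u v g" and "u 0 = 0" and eq: "AE t in lebesgue_on {0..T}. v t + C (g t) = f t"
      using that by (auto simp: Sol_def)
    have "AE t in lebesgue_on {0..T}. v t + C (Jinv J (u t)) = f t"
      using eq MR_inMR(3)[OF MR] by eventually_elim auto
    then show ?thesis
      using MR_inMR(1,2)[OF MR] \<open>u 0 = 0\<close> unfolding AE_lebesgue_on_iff by blast
  qed
  show ?thesis
    using assms(1,2,5) sol[OF assms(3)] sol[OF assms(4)] unfolding maxreg_def Let_def by blast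
qed

text \<open>A solution of the homogeneous equation on \<open>[0, b]\<close> is pushed to the end of the interval
  \<open>[0, T]\<close>, where uniqueness applies.\<close>

lemma causality:
  assumes C: "maxreg T p J C" and S: "Sol C f u v g" and b: "0 \<le> b" "b \<le> T"
    and f: "AE t in lebesgue_on {0..b}. f t = 0"
  shows "t \<in> {0..b} \<Longrightarrow> u t = 0" "AE t in lebesgue_on {0..b}. v t = 0" "AE t in lebesgue_on {0..b}. g t = 0"
proof -
  show u: "u t = 0" if t: "t \<in> {0..b}" for t
  proof -
    \<comment> \<open>This shift moves [0, b] onto [T - b, T]. As \<open>f\<close> vanishes almost
      everywhere on [0, b], the shifted right-hand side does so on all of [0, T].\<close>
    define d where "d = T - b"
    have d: "0 \<le> d" "d \<le> T" using b by (auto simp: d_def)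
    have "AE t in lebesgue_on {0..T}. sh d f t = 0"
      using AE_sh[OF f, of d] unfolding AE_lebesgue_on_iff
      by eventually_elim (auto simp: sh_def d_def)
    with Sol_sh[OF S d] have "Sol C (\<lambda>_. 0) (sh d u) (sh d v) (sh d g)"
      by (rule Sol_cong)
    then have "sh d u (t + d) = 0"
      using t b by (intro Sol_unique[OF C Lp_const _ Sol_zero]) (auto simp: d_def)
    then show ?thesis
      using t by (auto simp: sh_def)
  qed
  have sub: "{0..b} \<subseteq> {0..T}" using b by auto
  have "AE t in lebesgue_on {0..b}. u t = J (g t)"
    using S AE_lebesgue_on_mono[OF _ sub] by (auto simp: Sol_def MR_def)
  moreover have "AE t in lebesgue_on {0..b}. u t = 0"
    using u by (rule AE_lebesgue_on_space)
  ultimately show g: "AE t in lebesgue_on {0..b}. g t = 0"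
  proof eventually_elim
    case (elim t)
    then have "J (g t) = J 0" by simp
    then show ?case using injD[OF J_inj] by blast
  qed
  have "AE t in lebesgue_on {0..b}. v t + C (g t) = f t"
    using S AE_lebesgue_on_mono[OF _ sub] by (auto simp: Sol_def)
  then show "AE t in lebesgue_on {0..b}. v t = 0"
    using g f by eventually_elim auto
qed

text \<open>The difference of the solutions has a right-hand side vanishing on [0, b]. The data
  after \<open>b\<close> may thus be altered at will while a solution is studied on [0, b].\<close>

lemma Sol_unique_window:
  assumes C: "maxreg T p J C" and S: "Sol C f u v g" "Sol C f' u' v' g'" and b: "0 \<le> b" "b \<le> T"
    and f: "AE t in lebesgue_on {0..b}. f t = f' t"
  shows "t \<in> {0..b} \<Longrightarrow> u t = u' t" "AE t in lebesgue_on {0..b}. v t = v' t" "AE t in lebesgue_on {0..b}. g t = g' t"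
proof -
  have "AE t in lebesgue_on {0..b}. f t - f' t = 0"
    using f by eventually_elim auto
  note * = causality[OF C Sol_diff[OF S] b this]
  show "u t = u' t" if "t \<in> {0..b}" for t
    using *(1)[OF that] by simp
  show "AE t in lebesgue_on {0..b}. v t = v' t" "AE t in lebesgue_on {0..b}. g t = g' t"
    using *(2,3) by simp_all
qed

end

section \<open>A priori estimates\<close>

text \<open>Serves to bound the mass of infinitely many humps by the masses of the finite partial
  sums.\<close>

lemma pmass_Fatou:
  assumes s: "\<And>n. smeas T (s n)" and lim: "AE t in lebesgue_on {0..T}. (\<lambda>n. s n t) \<longlonglongrightarrow> f t"
    and c: "\<And>n. pmass p 0 T (s n) \<le> c" and p: "p > 0"
  shows "pmass p 0 T f \<le> c"
proof -
  have [measurable]: "(\<lambda>t. norm (s n t)) \<in> borel_measurable (lebesgue_on {0..T})" for n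
    by (rule smeas_norm_measurable[OF s])
  have "pmass p 0 T f = (\<integral>\<^sup>+t. liminf (\<lambda>n. ennreal (norm (s n t) powr p)) \<partial>lebesgue_on {0..T})"
    unfolding pmass_def
  proof (rule nn_integral_cong_AE)
    show "AE t in lebesgue_on {0..T}. ennreal (norm (f t) powr p) = liminf (\<lambda>n. ennreal (norm (s n t) powr p))"
      using lim
    proof eventually_elim
      case (elim t)
      have "(\<lambda>n. norm (s n t) powr p) \<longlonglongrightarrow> norm (f t) powr p"
        using elim p by (intro tendsto_powr2 tendsto_intros) auto
      then have "(\<lambda>n. ennreal (norm (s n t) powr p)) \<longlonglongrightarrow> ennreal (norm (f t) powr p)"
        by (rule tendsto_ennrealI)
      then show ?case
        using lim_imp_Liminf[OF sequentially_bot] by metis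
    qed
  qed
  also have "\<dots> \<le> liminf (\<lambda>n. pmass p 0 T (s n))"
    unfolding pmass_def by (rule nn_integral_liminf) measurable
  also have "\<dots> \<le> limsup (\<lambda>n. pmass p 0 T (s n))"
    by (rule Liminf_le_Limsup) simp
  also have "\<dots> \<le> c"
    by (rule Limsup_bounded) (simp add: c)
  finally show ?thesis .
qed

text \<open>The factor \<open>2 powr p\<close> of \<open>pmass_add\<close> would accumulate with
  each added hump; equality keeps the masses of all partial sums bounded.\<close>

lemma pmass_disjoint_add:
  assumes "smeas T f" "smeas T g" "0 \<le> a" "b \<le> T" "\<And>t. f t = 0 \<or> g t = 0"
  shows "pmass p a b (\<lambda>t. f t + g t) = pmass p a b f + pmass p a b g"
proof -
  have [measurable]: "(\<lambda>t. norm (f t)) \<in> borel_measurable (lebesgue_on {a..b})"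
    "(\<lambda>t. norm (g t)) \<in> borel_measurable (lebesgue_on {a..b})"
    using assms by (auto intro: smeas_norm_measurable')
  have "pmass p a b (\<lambda>t. f t + g t) = (\<integral>\<^sup>+t. ennreal (norm (f t) powr p) + ennreal (norm (g t) powr p) \<partial>lebesgue_on {a..b})"
    unfolding pmass_def
  proof (rule nn_integral_cong)
    fix t show "ennreal (norm (f t + g t) powr p) = ennreal (norm (f t) powr p) + ennreal (norm (g t) powr p)"
      using assms(5)[of t] by auto
  qed
  then show ?thesis
    unfolding pmass_def by (simp add: nn_integral_add)
qed

lemma AE_lebesgue_on_neq: "AE t in lebesgue_on {a..b::real}. t \<noteq> c"
  unfolding AE_lebesgue_on_iff using AE_completion[OF AE_lborel_singleton, of c]
  by eventually_elim simp

context evolution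
begin

text \<open>Gliding humps: if the estimate failed on all intervals \<open>(0, T/2^(n+1)]\<close>, worse and worse
  counterexamples could be placed next to each other from left to right. By causality a later hump does
  not influence the solution on the interval of an earlier one, so the solution for the sum of all
  humps would not lie in the maximal regularity space. This replaces the closed graph theorem.\<close>

lemma hump_bound:
  assumes C: "maxreg T p J C"
  shows "\<exists>n::nat. \<exists>c::real. \<forall>f u v g. Lp T p f \<and> (\<forall>t. t \<notin> {0<..T / 2^Suc n} \<longrightarrow> f t = 0) \<and>
      pmass p 0 T f \<le> ennreal (1 / 2^n) \<and> Sol C f u v g \<longrightarrow>
      pmass p 0 (T / 2^Suc n) g + pmass p 0 (T / 2^Suc n) v \<le> ennreal c"
proof (rule ccontr)
  assume neg: "\<not> ?thesis"
  have hump0: "\<exists>f u v g. Lp T p f \<and> (\<forall>t. t \<notin> {0<..T / 2^Suc n} \<longrightarrow> f t = 0) \<and>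
      pmass p 0 T f \<le> ennreal (1 / 2^n) \<and> Sol C f u v g \<and>
      ennreal c < pmass p 0 (T / 2^Suc n) g + pmass p 0 (T / 2^Suc n) v" for n :: nat and c :: real
    using neg unfolding not_ex not_all not_imp not_le by (elim allE[of _ n] allE[of _ c]) blast
  \<comment> \<open>The points \<open>a n\<close> increase to \<open>T\<close>, and consecutive ones
    have exactly the distance \<open>T / 2^Suc n\<close> on which the n-th counterexample
    lives.\<close>
  define a where "a n = T * (1 - 1 / 2^n)" for n :: nat
  have a: "0 \<le> a n" "a n \<le> T" "a (Suc n) = T / 2^Suc n + a n" "a n < T" for n
    using T_pos by (auto simp: a_def field_simps)
  have a_mono: "a n \<le> a m" if "n \<le> m" for n m
    by (rule lift_Suc_mono_le[OF _ that]) (use a(3) T_pos in auto)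
  have a_lim: "\<exists>n. t \<le> a n" if "t < T" for t
  proof -
    have "\<forall>\<^sub>F n in sequentially. (1/2)^n < (T - t) / T"
      using that T_pos by (intro order_tendstoD(2)[OF LIMSEQ_power_zero]) auto
    then obtain n where "(1/2)^n < (T - t) / T"
      by (auto simp: eventually_sequentially)
    then have "t \<le> a n"
      using T_pos by (simp add: a_def field_simps power_divide)
    then show ?thesis ..
  qed
  \<comment> \<open>The counterexample sits at the beginning of [0, T]; shifting it by
    \<open>a n\<close> preserves the masses on its interval.\<close>
  have hump: "\<exists>f u v g. Lp T p f \<and> (\<forall>t. t \<notin> {a n<..a (Suc n)} \<longrightarrow> f t = 0) \<and>
      pmass p 0 T f \<le> ennreal (1 / 2^n) \<and> Sol C f u v g \<and>
      ennreal c < pmass p (a n) (a (Suc n)) g + pmass p (a n) (a (Suc n)) v" for n c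
  proof -
    obtain f u v g where f: "Lp T p f" "\<And>t. t \<notin> {0<..T / 2^Suc n} \<Longrightarrow> f t = 0"
      "pmass p 0 T f \<le> ennreal (1 / 2^n)" "Sol C f u v g"
      and big: "ennreal c < pmass p 0 (T / 2^Suc n) g + pmass p 0 (T / 2^Suc n) v"
      using hump0[of n c] by blast
    have le: "T / 2^Suc n \<le> T"
      using a(1)[of n] a(2)[of "Suc n"] a(3)[of n] by linarith
    have w: "pmass p (a n) (a (Suc n)) (sh (a n) v) = pmass p 0 (T / 2^Suc n) v"
      "pmass p (a n) (a (Suc n)) (sh (a n) g) = pmass p 0 (T / 2^Suc n) g"
      using pmass_sh[OF Sol_smeas(1)[OF f(4)], of 0 "T / 2^Suc n" p "a n"]
        pmass_sh[OF Sol_smeas(2)[OF f(4)], of 0 "T / 2^Suc n" p "a n"] le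
      by (simp_all only: a(3)) simp_all
    show ?thesis
    proof (intro exI conjI allI impI)
      show "Lp T p (sh (a n) f)" by (rule Lp_sh[OF f(1) a(1,2)])
      show "sh (a n) f t = 0" if "t \<notin> {a n<..a (Suc n)}" for t
        using that f(2)[of "t - a n"] a(3)[of n] by (auto simp: sh_def)
      show "pmass p 0 T (sh (a n) f) \<le> ennreal (1 / 2^n)"
        using pmass_sh_le[OF Lp_smeas[OF f(1)] a(1,2)] f(3) by (rule order.trans)
      show "Sol C (sh (a n) f) (sh (a n) u) (sh (a n) v) (sh (a n) g)"
        by (rule Sol_sh[OF f(4) a(1,2)])
      show "ennreal c < pmass p (a n) (a (Suc n)) (sh (a n) g) + pmass p (a n) (a (Suc n)) (sh (a n) v)"
        using big unfolding w .
    qed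
  qed
  define E :: "(real \<Rightarrow> 'd) \<Rightarrow> (real \<Rightarrow> 'x) \<Rightarrow> ennreal" where "E g v = pmass p 0 T g + pmass p 0 T v" for g v
  \<comment> \<open>A stage is a partial sum of humps together with a solution for it. The bound
    \<open>2 - 2 / 2^n\<close> is the sum of \<open>1 / 2^k\<close> over
    \<open>k < n\<close>.\<close>
  define P where "P n x = (case x of (s, u, v, g) \<Rightarrow> Lp T p s \<and> Sol C s u v g \<and>
      (\<forall>t. t \<notin> {0<..a n} \<longrightarrow> s t = 0) \<and> pmass p 0 T s \<le> ennreal (2 - 2 / 2^n))"
    for n :: nat and x :: "(real \<Rightarrow> 'x) \<times> (real \<Rightarrow> 'x) \<times> (real \<Rightarrow> 'x) \<times> (real \<Rightarrow> 'd)"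
  \<comment> \<open>The n-th hump must outweigh the solution built so far by \<open>n\<close>, and
    the factor \<open>2 powr p\<close> anticipates the triangle inequality. Since the threshold
    depends on earlier choices, the humps come from dependent choice.\<close>
  define Q where "Q n x y = (case x of (s, u, v, g) \<Rightarrow> case y of (s', u', v', g') \<Rightarrow>
      (\<forall>t. t \<notin> {a n<..a (Suc n)} \<longrightarrow> s' t = s t) \<and>
      ennreal (2 powr p * (real n + enn2real (E g v)))
        < pmass p (a n) (a (Suc n)) (\<lambda>t. g' t - g t) + pmass p (a n) (a (Suc n)) (\<lambda>t. v' t - v t))"
    for n :: nat and x y :: "(real \<Rightarrow> 'x) \<times> (real \<Rightarrow> 'x) \<times> (real \<Rightarrow> 'x) \<times> (real \<Rightarrow> 'd)"
  have "\<exists>x. \<forall>n. P n (x n) \<and> Q n (x n) (x (Suc n))"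
  proof (rule dependent_nat_choice)
    show "\<exists>x. P 0 x"
      by (rule exI[of _ "(\<lambda>_. 0, \<lambda>_. 0, \<lambda>_. 0, \<lambda>_. 0)"]) (simp add: P_def Sol_zero)
    fix x n assume "P n x"
    then obtain s u v g where x: "x = (s, u, v, g)" and s: "Lp T p s" "Sol C s u v g"
      "\<And>t. t \<notin> {0<..a n} \<Longrightarrow> s t = 0" "pmass p 0 T s \<le> ennreal (2 - 2 / 2^n)"
      by (cases x) (auto simp: P_def)
    obtain f u' v' g' where f: "Lp T p f" "\<And>t. t \<notin> {a n<..a (Suc n)} \<Longrightarrow> f t = 0"
      "pmass p 0 T f \<le> ennreal (1 / 2^n)" "Sol C f u' v' g'"
      and big: "ennreal (2 powr p * (real n + enn2real (E g v)))
        < pmass p (a n) (a (Suc n)) g' + pmass p (a n) (a (Suc n)) v'"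
      using hump[of n "2 powr p * (real n + enn2real (E g v))"] by blast
    have "s t = 0 \<or> f t = 0" for t
      using s(3)[of t] f(2)[of t] by (cases "t \<le> a n") auto
    then have "pmass p 0 T (\<lambda>t. s t + f t) = pmass p 0 T s + pmass p 0 T f"
      by (intro pmass_disjoint_add[OF Lp_smeas[OF s(1)] Lp_smeas[OF f(1)]]) auto
    also have "\<dots> \<le> ennreal (2 - 2 / 2^n) + ennreal (1 / 2^n)"
      using s(4) f(3) by (rule add_mono)
    also have "\<dots> = ennreal (2 - 2 / 2^n + 1 / 2^n)"
      by (rule ennreal_plus[symmetric]) (auto simp: field_simps)
    also have "2 - 2 / 2^n + 1 / 2^n = 2 - 2 / (2^Suc n :: real)"
      by (simp add: field_simps)
    finally have mass: "pmass p 0 T (\<lambda>t. s t + f t) \<le> ennreal (2 - 2 / 2^Suc n)" .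
    have "P (Suc n) (\<lambda>t. s t + f t, \<lambda>t. u t + u' t, \<lambda>t. v t + v' t, \<lambda>t. g t + g' t)"
      unfolding P_def prod.case
    proof (intro conjI allI impI)
      show "Lp T p (\<lambda>t. s t + f t)" using s f p_nonneg by (intro Lp_add) auto
      show "Sol C (\<lambda>t. s t + f t) (\<lambda>t. u t + u' t) (\<lambda>t. v t + v' t) (\<lambda>t. g t + g' t)"
        by (rule Sol_add[OF s(2) f(4)])
      show "s t + f t = 0" if "t \<notin> {0<..a (Suc n)}" for t
        using that s(3)[of t] f(2)[of t] a(1)[of n] a_mono[of n "Suc n"] by auto
    qed (rule mass)
    moreover have "Q n x (\<lambda>t. s t + f t, \<lambda>t. u t + u' t, \<lambda>t. v t + v' t, \<lambda>t. g t + g' t)"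
      using big f(2) by (simp add: Q_def x)
    ultimately show "\<exists>y. P (Suc n) y \<and> Q n x y" by blast
  qed
  then obtain x where x: "\<And>n. P n (x n)" "\<And>n. Q n (x n) (x (Suc n))" by blast
  define s where "s n = fst (x n)" for n
  define U where "U n = fst (snd (x n))" for n
  define V where "V n = fst (snd (snd (x n)))" for n
  define G where "G n = snd (snd (snd (x n)))" for n
  have x_eq: "x n = (s n, U n, V n, G n)" for n
    by (simp add: s_def U_def V_def G_def)
  have s: "Lp T p (s n)" "Sol C (s n) (U n) (V n) (G n)" "pmass p 0 T (s n) \<le> ennreal (2 - 2 / 2^n)" for n
    using x(1)[of n] by (simp_all add: P_def x_eq)
  have s_step: "s (Suc n) t = s n t" if "t \<notin> {a n<..a (Suc n)}" for n t
    using x(2)[of n] that unfolding Q_def x_eq prod.case by blast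
  have big: "ennreal (2 powr p * (real n + enn2real (E (G n) (V n)))) <
      pmass p (a n) (a (Suc n)) (\<lambda>t. G (Suc n) t - G n t) + pmass p (a n) (a (Suc n)) (\<lambda>t. V (Suc n) t - V n t)" for n
    using x(2)[of n] unfolding Q_def x_eq prod.case by blast
  have s_const: "s m t = s n t" if "n \<le> m" "t \<le> a n" for n m t
    using that(1)
  proof (induction m rule: dec_induct)
    case (step m)
    then show ?case
      using s_step[where n = m and t = t] that(2) a_mono[of n m] by auto
  qed simp
  \<comment> \<open>The values \<open>s n t\<close> do not change once \<open>t \<le> a n\<close>,
    so any such \<open>n\<close> may be used. No \<open>a n\<close> reaches \<open>T\<close>, where
    the value 0 is chosen.\<close>
  define F where "F t = (if t < T then s (LEAST n. t \<le> a n) t else 0)" for t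
  have F: "F t = s n t" if "t \<le> a n" for t n
  proof -
    have "(LEAST n. t \<le> a n) \<le> n" "t \<le> a (LEAST n. t \<le> a n)"
      using that by (auto intro: Least_le LeastI)
    then show ?thesis
      using s_const[of "LEAST n. t \<le> a n" n t] that a(4)[of n] by (auto simp: F_def)
  qed
  have lim: "AE t in lebesgue_on {0..T}. (\<lambda>n. s n t) \<longlonglongrightarrow> F t"
  proof -
    have "AE t in lebesgue_on {0..T}. t \<in> {0..T}"
      by (rule AE_lebesgue_on_space)
    then show ?thesis
      using AE_lebesgue_on_neq[where a = 0 and b = T and c = T]
    proof eventually_elim
      case (elim t)
      then obtain n where n: "t \<le> a n" using a_lim[of t] by auto
      show ?case
      proof (rule tendsto_eventually, rule eventually_sequentiallyI[of n])
        fix m assume "n \<le> m"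
        then show "s m t = F t"
          using F[of t m] n a_mono[of n m] by auto
      qed
    qed
  qed
  have "pmass p 0 T F \<le> 2"
  proof (rule pmass_Fatou[OF Lp_smeas[OF s(1)] lim])
    fix n
    have "ennreal (2 - 2 / 2^n) \<le> ennreal 2" by (rule ennreal_leI) simp
    with s(3)[of n] show "pmass p 0 T (s n) \<le> 2" by simp
  qed (use p_nonneg in auto)
  then have "pmass p 0 T F < \<infinity>"
    by (auto intro: order.strict_trans1)
  then have "Lp T p F"
    using smeas_AE_limit[OF Lp_smeas[OF s(1)] lim] by (simp add: Lp_iff)
  then obtain u v g where S: "Sol C F u v g"
    using maxreg_exists[OF C] by blast
  have fin: "E g v < \<infinity>" "E (G n) (V n) < \<infinity>" for n
    using Sol_smeas(3,4)[OF S] Sol_smeas(3,4)[OF s(2)[of n]] by (auto simp: E_def Lp_iff)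
  have "real n < enn2real (E g v)" for n
  proof -
    let ?w = "pmass p (a n) (a (Suc n))"
    have sub: "{a n..a (Suc n)} \<subseteq> {0..a (Suc n)}" "{a n..a (Suc n)} \<subseteq> {0..T}"
      using a[of n] a[of "Suc n"] by auto
    \<comment> \<open>Up to \<open>a (Suc n)\<close> the right-hand sides \<open>F\<close> and
      \<open>s (Suc n)\<close> agree, so causality turns the n-th increments into
      \<open>g - G n\<close> and \<open>v - V n\<close>. The contribution of the earlier solution
      then cancels against the threshold in \<open>Q\<close>, leaving \<open>n\<close>.\<close>
    have "AE t in lebesgue_on {0..a (Suc n)}. F t = s (Suc n) t"
      using F[of _ "Suc n"] by (intro AE_lebesgue_on_space) auto
    note eq = Sol_unique_window(2,3)[OF C S s(2) a(1,2) this, THEN AE_lebesgue_on_mono, OF sub(1)]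
    have "?w (\<lambda>t. G (Suc n) t - G n t) = ?w (\<lambda>t. g t - G n t)"
      using eq(2) by (intro pmass_cong_AE) (auto elim!: eventually_mono)
    also have "\<dots> \<le> ennreal (2 powr p) * (?w g + ?w (G n))"
      by (rule pmass_diff[OF Sol_smeas(2)[OF S] Sol_smeas(2)[OF s(2)] a(1,2) p_nonneg(1)])
    also have "\<dots> \<le> ennreal (2 powr p) * (pmass p 0 T g + pmass p 0 T (G n))"
      by (intro mult_left_mono add_mono pmass_mono_interval sub) auto
    finally have 1: "?w (\<lambda>t. G (Suc n) t - G n t) \<le> ennreal (2 powr p) * (pmass p 0 T g + pmass p 0 T (G n))" .
    have "?w (\<lambda>t. V (Suc n) t - V n t) = ?w (\<lambda>t. v t - V n t)"
      using eq(1) by (intro pmass_cong_AE) (auto elim!: eventually_mono)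
    also have "\<dots> \<le> ennreal (2 powr p) * (?w v + ?w (V n))"
      by (rule pmass_diff[OF Sol_smeas(1)[OF S] Sol_smeas(1)[OF s(2)] a(1,2) p_nonneg(1)])
    also have "\<dots> \<le> ennreal (2 powr p) * (pmass p 0 T v + pmass p 0 T (V n))"
      by (intro mult_left_mono add_mono pmass_mono_interval sub) auto
    finally have 2: "?w (\<lambda>t. V (Suc n) t - V n t) \<le> ennreal (2 powr p) * (pmass p 0 T v + pmass p 0 T (V n))" .
    have "ennreal (2 powr p * (real n + enn2real (E (G n) (V n)))) <
        ennreal (2 powr p) * (pmass p 0 T g + pmass p 0 T (G n)) + ennreal (2 powr p) * (pmass p 0 T v + pmass p 0 T (V n))"
      using big[of n] add_mono[OF 1 2] by (rule less_le_trans)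
    also have "\<dots> = ennreal (2 powr p) * (E g v + E (G n) (V n))"
      by (simp add: E_def algebra_simps)
    also have "\<dots> = ennreal (2 powr p) * (ennreal (enn2real (E g v)) + ennreal (enn2real (E (G n) (V n))))"
      using fin(1) fin(2)[of n] by simp
    also have "\<dots> = ennreal (2 powr p * (enn2real (E g v) + enn2real (E (G n) (V n))))"
      by (simp add: ennreal_mult ennreal_plus)
    finally have "2 powr p * (real n + enn2real (E (G n) (V n))) < 2 powr p * (enn2real (E g v) + enn2real (E (G n) (V n)))"
      by (simp add: ennreal_less_iff)
    then show ?thesis by simp
  qed
  then show False
    using reals_Archimedean2[of "enn2real (E g v)"] by (meson less_asym)
qed

text \<open>Homogeneity turns the bound on small data into a linear estimate, and translation moves
  it with the same constant to short windows anywhere in [0, T].\<close>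

lemma local_bound:
  assumes C: "maxreg T p J C"
  shows "\<exists>\<tau> K. 0 < \<tau> \<and> \<tau> \<le> T \<and> 0 \<le> K \<and> (\<forall>a b f u v g. 0 \<le> a \<and> a \<le> b \<and> b \<le> T \<and> b - a \<le> \<tau> \<and>
      Lp T p f \<and> (AE t in lebesgue_on {0..a}. f t = 0) \<and> Sol C f u v g \<longrightarrow>
      pmass p a b g + pmass p a b v \<le> ennreal K * pmass p a b f)"
proof -
  obtain n c where c: "\<And>f u v g. Lp T p f \<Longrightarrow> (\<And>t. t \<notin> {0<..T / 2^Suc n} \<Longrightarrow> f t = 0) \<Longrightarrow>
      pmass p 0 T f \<le> ennreal (1 / 2^n) \<Longrightarrow> Sol C f u v g \<Longrightarrow>
      pmass p 0 (T / 2^Suc n) g + pmass p 0 (T / 2^Suc n) v \<le> ennreal c"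
    using hump_bound[OF C] by metis
  define \<tau> where "\<tau> = T / 2^Suc n"
  have \<tau>: "0 < \<tau>" "\<tau> \<le> T"
    using T_pos mult_left_mono[OF one_le_power[of "2::real" "Suc n"], of T] by (auto simp: \<tau>_def field_simps)
  \<comment> \<open>The bound \<open>c\<close> belongs to mass \<open>1 / 2^n\<close>, hence the
    factor \<open>2^n\<close>; its sign is not known, hence the maximum.\<close>
  define K where "K = max c 0 * 2^n"
  have bound0: "pmass p 0 \<tau> g + pmass p 0 \<tau> v \<le> ennreal K * pmass p 0 T f"
    if f: "Lp T p f" "\<And>t. t \<notin> {0<..\<tau>} \<Longrightarrow> f t = 0" and S: "Sol C f u v g" for f u v g
  proof (cases "pmass p 0 T f = 0")
    \<comment> \<open>Data of mass zero cannot be normalised; here causality makes the solution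
      vanish.\<close>
    case True
    then have "AE t in lebesgue_on {0..T}. f t = 0"
      using pmass_eq_0_iff[of T f 0 T p] f by (simp add: Lp_iff)
    from causality(2,3)[OF C S _ _ this] T_pos
    have "AE t in lebesgue_on {0..T}. v t = 0" "AE t in lebesgue_on {0..T}. g t = 0"
      by auto
    then have "pmass p 0 T g = 0" "pmass p 0 T v = 0"
      using pmass_eq_0_iff[of T g 0 T p] pmass_eq_0_iff[of T v 0 T p] Sol_smeas[OF S] by auto
    moreover have "pmass p 0 \<tau> g \<le> pmass p 0 T g" "pmass p 0 \<tau> v \<le> pmass p 0 T v"
      using \<tau> by (auto intro!: pmass_mono_interval)
    ultimately show ?thesis by simp
  next
    case False
    define \<mu> where "\<mu> = enn2real (pmass p 0 T f)"
    have \<mu>: "pmass p 0 T f = ennreal \<mu>" "\<mu> > 0"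
      using f(1) False by (auto simp: \<mu>_def Lp_iff enn2real_positive_iff less_top zero_less_iff_neq_zero)
    \<comment> \<open>The scaling that gives \<open>l *\<^sub>R f\<close> the mass
      \<open>1 / 2^n\<close>.\<close>
    define l where "l = (1 / (2^n * \<mu>)) powr (1 / p)"
    have l: "l > 0" "l powr p = 1 / (2^n * \<mu>)" "\<bar>l\<bar> = l"
      using \<mu>(2) p_nonneg by (auto simp: l_def powr_powr)
    have "pmass p 0 \<tau> (\<lambda>t. l *\<^sub>R g t) + pmass p 0 \<tau> (\<lambda>t. l *\<^sub>R v t) \<le> ennreal c"
      unfolding \<tau>_def
    proof (rule c)
      show "Lp T p (\<lambda>t. l *\<^sub>R f t)" using f p_nonneg by (intro Lp_scale) auto
      show "l *\<^sub>R f t = 0" if "t \<notin> {0<..T / 2^Suc n}" for t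
        using f(2)[of t] that by (simp add: \<tau>_def)
      show "Sol C (\<lambda>t. l *\<^sub>R f t) (\<lambda>t. l *\<^sub>R u t) (\<lambda>t. l *\<^sub>R v t) (\<lambda>t. l *\<^sub>R g t)"
        by (rule Sol_scale[OF S])
      have "pmass p 0 T (\<lambda>t. l *\<^sub>R f t) = ennreal (1 / (2^n * \<mu>)) * ennreal \<mu>"
        using pmass_scale[OF Lp_smeas[OF f(1)], of 0 T p l] l \<mu> by simp
      also have "\<dots> = ennreal (1 / 2^n)"
        using \<mu> by (subst ennreal_mult[symmetric]) auto
      finally show "pmass p 0 T (\<lambda>t. l *\<^sub>R f t) \<le> ennreal (1 / 2^n)" by simp
    qed
    then have "ennreal (1 / (2^n * \<mu>)) * (pmass p 0 \<tau> g + pmass p 0 \<tau> v) \<le> ennreal c"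
      using pmass_scale[OF Sol_smeas(1)[OF S], of 0 \<tau> p l] pmass_scale[OF Sol_smeas(2)[OF S], of 0 \<tau> p l] \<tau> l
      by (simp add: distrib_left)
    then have "ennreal (2^n * \<mu>) * (ennreal (1 / (2^n * \<mu>)) * (pmass p 0 \<tau> g + pmass p 0 \<tau> v)) \<le> ennreal (2^n * \<mu>) * ennreal c"
      by (rule mult_left_mono) simp
    moreover have "ennreal (2^n * \<mu>) * (ennreal (1 / (2^n * \<mu>)) * X) = X" for X
      using \<mu> by (simp add: mult.assoc[symmetric] ennreal_mult[symmetric])
    moreover have "ennreal (2^n * \<mu>) * ennreal c \<le> ennreal K * ennreal \<mu>"
    proof -
      have "ennreal (2^n * \<mu>) * ennreal c \<le> ennreal (2^n * \<mu>) * ennreal (max c 0)"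
        by (intro mult_left_mono ennreal_leI) auto
      also have "\<dots> = ennreal K * ennreal \<mu>"
        using \<mu> by (simp add: K_def ennreal_mult[symmetric] mult_ac)
      finally show ?thesis .
    qed
    ultimately show ?thesis
      unfolding \<mu>(1) by (metis order.trans)
  qed
  have win: "pmass p a b g + pmass p a b v \<le> ennreal K * pmass p a b f"
    if ab: "0 \<le> a" "a \<le> b" "b \<le> T" "b - a \<le> \<tau>" and f: "Lp T p f" "AE t in lebesgue_on {0..a}. f t = 0"
      and S: "Sol C f u v g" for a b f u v g
  proof -
    \<comment> \<open>The part of \<open>f\<close> on the window, moved to the start of [0, T]. The
      left endpoint is left out because \<open>bound0\<close> wants the value 0 at time 0. The inner
      conditional matches \<open>smeas_affine\<close>.\<close>
    define h where "h t = (if t \<in> {0<..b - a} then (if a + 1 * t \<in> {0..T} then f (a + 1 * t) else 0) else 0)" for t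
    have sm: "smeas T h"
      unfolding h_def by (intro smeas_restrict smeas_affine Lp_smeas[OF f(1)]) auto
    have h: "h t = (if t \<in> {0<..b - a} then f (a + t) else 0)" for t
      using ab by (auto simp: h_def)
    have "pmass p 0 T h = pmass p 0 T (\<lambda>t. if t \<in> {0..b - a} then f (a + 1 * t) else 0)"
      using AE_lebesgue_on_neq[where a = 0 and b = T and c = 0] by (intro pmass_cong_AE) (auto simp: h elim!: eventually_mono)
    also have "\<dots> = pmass p 0 (b - a) (\<lambda>t. f (a + 1 * t))"
      using ab by (intro pmass_restrict) auto
    also have "\<dots> = pmass p a b f"
      by (rule pmass_affine[OF Lp_smeas[OF f(1)]]) (use ab in auto)
    finally have hm: "pmass p 0 T h = pmass p a b f" .
    also have "\<dots> \<le> pmass p 0 T f"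
      using ab by (intro pmass_mono_interval) auto
    finally have "Lp T p h"
      using sm f(1) by (auto simp: Lp_iff)
    then obtain u1 v1 g1 where S1: "Sol C h u1 v1 g1"
      using maxreg_exists[OF C] by blast
    have "pmass p 0 \<tau> g1 + pmass p 0 \<tau> v1 \<le> ennreal K * pmass p 0 T h"
      by (rule bound0[OF \<open>Lp T p h\<close> _ S1]) (use ab in \<open>auto simp: h\<close>)
    then have B1: "pmass p 0 \<tau> g1 + pmass p 0 \<tau> v1 \<le> ennreal K * pmass p a b f"
      by (simp add: hm)
    \<comment> \<open>Moved back to \<open>a\<close>, the piece agrees with \<open>f\<close> almost
      everywhere on [0, b]; by causality the values of \<open>f\<close> after \<open>b\<close> do
      not matter.\<close>
    have "AE t in lebesgue_on {0..b}. f t = sh a h t"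
      using f(2) AE_completion[OF AE_lborel_singleton, of a] unfolding AE_lebesgue_on_iff
      by eventually_elim (auto simp: sh_def h)
    note eq = Sol_unique_window(2,3)[OF C S Sol_sh[OF S1, of a] _ _ this]
    have sub: "{a..b} \<subseteq> {0..b}" using ab by auto
    have eqv: "AE t in lebesgue_on {a..b}. v t = sh a v1 t"
      by (rule AE_lebesgue_on_mono[OF eq(1) sub]) (use ab in auto)
    have eqg: "AE t in lebesgue_on {a..b}. g t = sh a g1 t"
      by (rule AE_lebesgue_on_mono[OF eq(2) sub]) (use ab in auto)
    have "pmass p a b g = pmass p a b (sh a g1)"
      using eqg by (intro pmass_cong_AE) (auto elim!: eventually_mono)
    also have "\<dots> = pmass p 0 (b - a) g1"
      using pmass_sh[OF Sol_smeas(2)[OF S1], of 0 "b - a" p a] ab by simp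
    also have "\<dots> \<le> pmass p 0 \<tau> g1"
      using ab by (intro pmass_mono_interval) auto
    finally have "pmass p a b g \<le> pmass p 0 \<tau> g1" .
    moreover have "pmass p a b v = pmass p a b (sh a v1)"
      using eqv by (intro pmass_cong_AE) (auto elim!: eventually_mono)
    moreover have "\<dots> = pmass p 0 (b - a) v1"
      using pmass_sh[OF Sol_smeas(1)[OF S1], of 0 "b - a" p a] ab by simp
    moreover have "pmass p 0 (b - a) v1 \<le> pmass p 0 \<tau> v1"
      using ab by (intro pmass_mono_interval) auto
    ultimately show ?thesis
      using order.trans[OF add_mono B1] by (simp only:)
  qed
  show ?thesis
  proof (rule exI[of _ \<tau>], rule exI[of _ K], intro conjI allI impI)
    show "0 \<le> K" by (simp add: K_def)
  qed (use \<tau> in simp, use \<tau> in simp, elim conjE, rule win)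
qed

end

lemma powr_le_cancel:
  fixes x y c p :: real
  assumes "x powr p \<le> c * y powr p" "x \<ge> 0" "y \<ge> 0" "c \<ge> 0" "p > 0"
  shows "x \<le> c powr (1 / p) * y"
proof -
  have "x = (x powr p) powr (1 / p)"
    using assms by (simp add: powr_powr)
  also have "\<dots> \<le> (c * y powr p) powr (1 / p)"
    using assms by (intro powr_mono2) auto
  also have "\<dots> = c powr (1 / p) * y"
    using assms by (simp add: powr_mult powr_powr)
  finally show ?thesis .
qed

text \<open>A one-point interval is null. This settles the condition on [0, a] of
  \<open>local_bound\<close> when \<open>a = 0\<close>, and it starts the continuation
  argument.\<close>

lemma AE_lebesgue_on_point: "AE t in lebesgue_on {a..a::real}. P t"
proof -
  have "AE t in lebesgue. t \<noteq> a"
    by (rule AE_completion[OF AE_lborel_singleton])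
  then have "AE t in lebesgue. t \<in> {a..a} \<longrightarrow> P t"
    by (rule eventually_mono) auto
  then show ?thesis
    unfolding AE_lebesgue_on_iff .
qed

context evolution
begin

text \<open>The Hoelder factor \<open>t powr (p - 1)\<close> and the factor \<open>t\<close> in the
  mass bound combine to \<open>t powr p\<close>, so the integral is of order
  \<open>t\<close>.\<close>

lemma pmass_integral_bound:
  fixes f :: "real \<Rightarrow> 'a::banach"
  assumes f: "Lp T p f" and t: "0 \<le> t" "t \<le> T" and K: "K \<ge> 0" "r \<ge> 0" "pmass p 0 t f \<le> ennreal (K * (r powr p * t))"
  shows "norm (integral {0..t} f) \<le> 2 * K powr (1 / p) * t * r"
proof -
  have "ennreal (norm (integral {0..t} f) powr p) \<le> ennreal (2 powr p * (t - 0) powr (p - 1)) * pmass p 0 t f"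
    by (rule Lp_integral_bound[OF f p_gt1]) (use t in auto)
  also have "\<dots> \<le> ennreal (2 powr p * t powr (p - 1)) * ennreal (K * (r powr p * t))"
    using K(3) by (simp add: mult_left_mono)
  also have "\<dots> = ennreal ((2 powr p * t powr (p - 1)) * (K * (r powr p * t)))"
    using K t by (subst ennreal_mult) auto
  finally have "norm (integral {0..t} f) powr p \<le> (2 powr p * t powr (p - 1)) * (K * (r powr p * t))"
    using K t by (simp add: ennreal_le_iff)
  also have "\<dots> = K * (2 * t * r) powr p"
    using K t by (cases "t = 0") (auto simp: powr_mult powr_diff)
  finally have "norm (integral {0..t} f) \<le> K powr (1 / p) * (2 * t * r)"
    by (rule powr_le_cancel) (use K t p_nonneg in auto)
  then show ?thesis by (simp add: mult_ac)
qed

text \<open>The function \<open>t *\<^sub>R J x\<close> is an explicit solution with right-hand side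
  \<open>J x + t *\<^sub>R C x\<close>, and the a priori estimate for it bounds \<open>x\<close> in
  D.\<close>

lemma graph_bound:
  assumes C: "maxreg T p J C"
  shows "\<exists>M\<ge>0. \<forall>x. norm x \<le> M * (norm (C x) + norm (J x))"
proof -
  obtain \<tau> K where \<tau>: "0 < \<tau>" "\<tau> \<le> T" "0 \<le> K"
    and win: "\<And>a b f u v g. 0 \<le> a \<Longrightarrow> a \<le> b \<Longrightarrow> b \<le> T \<Longrightarrow> b - a \<le> \<tau> \<Longrightarrow> Lp T p f \<Longrightarrow>
      (AE t in lebesgue_on {0..a}. f t = 0) \<Longrightarrow> Sol C f u v g \<Longrightarrow>
      pmass p a b g + pmass p a b v \<le> ennreal K * pmass p a b f"
    using local_bound[OF C] by metis
  \<comment> \<open>The 2 beside \<open>K\<close> comes from passing to the second half of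
    [0, \<tau>], \<open>2 / \<tau>\<close> from the weight \<open>t \<ge> \<tau> / 2\<close> there,
    and \<open>1 + T\<close> from the size of the right-hand side.\<close>
  define M where "M = (2 * K) powr (1 / p) * (2 / \<tau> * (1 + T))"
  have "norm x \<le> M * (norm (C x) + norm (J x))" for x
  proof -
    define f where "f t = J x + t *\<^sub>R C x" for t :: real
    have f: "Lp T p f"
      unfolding f_def using p_nonneg by (intro Lp_continuous_on continuous_intros) auto
    have "Sol C f (\<lambda>t. t *\<^sub>R J x) (\<lambda>_. J x) (\<lambda>t. t *\<^sub>R x)"
      unfolding Sol_def MR_def
    proof (intro conjI ballI)
      show "Lp T p (\<lambda>t. t *\<^sub>R x)"
        using p_nonneg by (intro Lp_continuous_on continuous_intros) auto
      show "((\<lambda>_. J x) has_integral t *\<^sub>R J x - 0 *\<^sub>R J x) {0..t}" if "t \<in> {0..T}" for t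
        using has_integral_const_real[of "J x" 0 t] that by simp
    qed (auto simp: f_def blinfun.scaleR_right)
    from win[OF _ _ _ _ f AE_lebesgue_on_point this, of \<tau>] \<tau>
    have "pmass p 0 \<tau> (\<lambda>t. t *\<^sub>R x) + pmass p 0 \<tau> (\<lambda>_. J x) \<le> ennreal K * pmass p 0 \<tau> f"
      by simp
    then have le: "pmass p 0 \<tau> (\<lambda>t. t *\<^sub>R x) \<le> ennreal K * pmass p 0 \<tau> f"
      by (meson add_increasing2 order.trans zero_le order_refl le_add_same_cancel1)
    have "ennreal (norm ((\<tau>/2) *\<^sub>R x) powr p * (\<tau> - \<tau>/2)) = pmass p (\<tau>/2) \<tau> (\<lambda>t. (\<tau>/2) *\<^sub>R x)"
      using \<tau> by (intro pmass_const[symmetric]) auto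
    also have "\<dots> \<le> pmass p (\<tau>/2) \<tau> (\<lambda>t. t *\<^sub>R x)"
    proof (rule pmass_mono[OF AE_lebesgue_on_space p_nonneg(1)])
      show "norm ((\<tau>/2) *\<^sub>R x) \<le> norm (t *\<^sub>R x)" if "t \<in> {\<tau>/2..\<tau>}" for t
        unfolding norm_scaleR using that \<tau> by (intro mult_right_mono) auto
    qed
    also have "\<dots> \<le> pmass p 0 \<tau> (\<lambda>t. t *\<^sub>R x)"
      using \<tau> by (intro pmass_mono_interval) auto
    also note le
    also have "ennreal K * pmass p 0 \<tau> f \<le> ennreal K * pmass p 0 \<tau> (\<lambda>_. (1 + T) * (norm (C x) + norm (J x)))"
    proof (intro mult_left_mono pmass_mono AE_lebesgue_on_space)
      fix t assume t: "t \<in> {0..\<tau>}"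
      have "norm (f t) \<le> norm (J x) + t * norm (C x)"
        unfolding f_def using t by (intro norm_triangle_le) auto
      also have "t * norm (C x) \<le> T * norm (C x)"
        using t \<tau> by (intro mult_right_mono) auto
      also have "norm (J x) + T * norm (C x) \<le> (1 + T) * (norm (C x) + norm (J x))"
        using T_pos by (simp add: algebra_simps)
      finally show "norm (f t) \<le> norm ((1 + T) * (norm (C x) + norm (J x)))"
        by simp
    qed (use p_nonneg in auto)
    also have "\<dots> = ennreal (K * (((1 + T) * (norm (C x) + norm (J x))) powr p * \<tau>))"
      using \<tau> T_pos by (subst pmass_const) (auto simp: ennreal_mult abs_mult)
    finally have "norm ((\<tau>/2) *\<^sub>R x) powr p * (\<tau> - \<tau>/2) \<le> K * (((1 + T) * (norm (C x) + norm (J x))) powr p * \<tau>)"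
      using \<tau> by (subst (asm) ennreal_le_iff) auto
    then have "norm ((\<tau>/2) *\<^sub>R x) powr p \<le> (2 * K) * ((1 + T) * (norm (C x) + norm (J x))) powr p"
      using \<tau> by (simp add: field_simps)
    then have "norm ((\<tau>/2) *\<^sub>R x) \<le> (2 * K) powr (1 / p) * ((1 + T) * (norm (C x) + norm (J x)))"
      by (rule powr_le_cancel) (use \<tau> T_pos p_nonneg in auto)
    then show ?thesis
      using \<tau> by (simp add: M_def field_simps)
  qed
  moreover have "M \<ge> 0"
    using \<tau> T_pos by (simp add: M_def)
  ultimately show ?thesis by blast
qed

text \<open>Averaging the solutions with constant right-hand sides over short time intervals yields
  operators in \<open>\<L>(X, D)\<close> that converge strongly to the identity of \<open>D\<close>.\<close>

lemma approximate_identity: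
  assumes C: "maxreg T p J C" and dense: "closure (range (blinfun_apply J)) = UNIV"
  shows "\<exists>R :: nat \<Rightarrow> 'x \<Rightarrow> 'd. (\<forall>n. bounded_linear (R n)) \<and> (\<forall>x. (\<lambda>n. R n (J x)) \<longlonglongrightarrow> x)"
proof -
  obtain \<tau> K where \<tau>: "0 < \<tau>" "\<tau> \<le> T" "0 \<le> K"
    and win: "\<And>a b f u v g. 0 \<le> a \<Longrightarrow> a \<le> b \<Longrightarrow> b \<le> T \<Longrightarrow> b - a \<le> \<tau> \<Longrightarrow> Lp T p f \<Longrightarrow>
      (AE t in lebesgue_on {0..a}. f t = 0) \<Longrightarrow> Sol C f u v g \<Longrightarrow>
      pmass p a b g + pmass p a b v \<le> ennreal K * pmass p a b f"
    using local_bound[OF C] by metis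
  obtain M where M: "M \<ge> 0" "\<And>x. norm x \<le> M * (norm (C x) + norm (J x))"
    using graph_bound[OF C] by blast
  have "\<forall>z. \<exists>u v g. Sol C (\<lambda>_. z) u v g"
    using maxreg_exists[OF C Lp_const] by blast
  then obtain U V G where S: "\<And>z. Sol C (\<lambda>_. z) (U z) (V z) (G z)"
    by metis
  have MR: "MR (U z) (V z) (G z)" and U0: "U z 0 = 0" for z
    using S[of z] by (auto simp: Sol_def)
  have JG: "AE t in lebesgue_on {0..T}. U z t = J (G z t)"
    and CG: "AE t in lebesgue_on {0..T}. V z t + C (G z t) = z" for z
    using S[of z] by (auto simp: Sol_def MR_def)
  have VI: "(V z has_integral U z t) {0..t}" if "t \<in> {0..T}" for z t
    using MR[of z] U0[of z] that by (auto simp: MR_def)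
  have G_int: "G z integrable_on {0..t}" "t \<le> T \<Longrightarrow> (G z has_integral integral {0..t} (G z)) {0..t}" if "t \<le> T" for z t
    using Lp_integrable(3)[OF Sol_smeas(4)[OF S[of z]] p_nonneg(2), of 0 t] that by auto
  have U_cont: "continuous_on {0..T} (U z)" for z
    by (rule MR_continuous[OF MR])
  have U_int: "U z integrable_on {0..t}" if "t \<le> T" for z t
    by (rule integrable_continuous_real, rule continuous_on_subset[OF U_cont]) (use that in auto)
  define k where "k = 2 * K powr (1 / p)"
  have k: "k \<ge> 0" by (simp add: k_def)
  have mass: "pmass p 0 t (G z) \<le> ennreal (K * (norm z powr p * t))"
    "pmass p 0 t (V z) \<le> ennreal (K * (norm z powr p * t))" if "0 \<le> t" "t \<le> \<tau>" for t z
  proof -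
    from win[OF _ _ _ _ Lp_const AE_lebesgue_on_point S, of t] that \<tau>
    have "pmass p 0 t (G z) + pmass p 0 t (V z) \<le> ennreal K * pmass p 0 t (\<lambda>_. z)"
      by auto
    also have "\<dots> = ennreal (K * (norm z powr p * t))"
      using that \<tau> by (subst pmass_const) (auto simp: ennreal_mult)
    finally have *: "pmass p 0 t (G z) + pmass p 0 t (V z) \<le> ennreal (K * (norm z powr p * t))" .
    have "pmass p 0 t (G z) \<le> pmass p 0 t (G z) + pmass p 0 t (V z)"
      "pmass p 0 t (V z) \<le> pmass p 0 t (G z) + pmass p 0 t (V z)"
      by auto
    with * show "pmass p 0 t (G z) \<le> ennreal (K * (norm z powr p * t))"
      "pmass p 0 t (V z) \<le> ennreal (K * (norm z powr p * t))"
      by (meson order.trans)+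
  qed
  have G_bd: "norm (integral {0..t} (G z)) \<le> k * t * norm z" if "0 \<le> t" "t \<le> \<tau>" for t z
    unfolding k_def
    by (rule pmass_integral_bound[OF Sol_smeas(4)[OF S]]) (use that \<tau> mass(1)[OF that, of z] in auto)
  have U_bd: "norm (U z t) \<le> k * t * norm z" if "0 \<le> t" "t \<le> \<tau>" for t z
  proof -
    have "norm (integral {0..t} (V z)) \<le> k * t * norm z"
      unfolding k_def
      by (rule pmass_integral_bound[OF Sol_smeas(3)[OF S]]) (use that \<tau> mass(2)[OF that, of z] in auto)
    then show ?thesis
      using integral_unique[OF VI[of t z]] that \<tau> by simp
  qed
  have neg: "negligible {t. t \<in> {0..T} \<and> \<not> P t}" if "AE t in lebesgue_on {0..T}. P t" for P
    using that unfolding AE_lebesgue_on_iff eventually_ae_filter_negligible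
    by (auto intro: negligible_subset)
  have U_eq: "integral {0..t} (U z) = J (integral {0..t} (G z))" if "t \<le> T" for t z
  proof -
    have "integral {0..t} (\<lambda>s. J (G z s)) = J (integral {0..t} (G z))"
      using integral_linear[OF G_int(1)[OF that] blinfun.bounded_linear_right[of J]] by (simp add: o_def)
    moreover have "integral {0..t} (U z) = integral {0..t} (\<lambda>s. J (G z s))"
      by (rule integral_spike[OF neg[OF JG[of z]]]) (use that in auto)
    ultimately show ?thesis by simp
  qed
  \<comment> \<open>Integrating the equation replaces \<open>G z\<close>, which is determined only
    almost everywhere, by its continuous primitive.\<close>
  have CG_eq: "C (integral {0..t} (G z)) = t *\<^sub>R z - U z t" if "t \<in> {0..T}" for t z
  proof -
    have "((\<lambda>s. z - V z s) has_integral (t *\<^sub>R z - U z t)) {0..t}"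
      using has_integral_diff[OF has_integral_const_real[of z 0 t] VI[of t z]] that by auto
    moreover have "((\<lambda>s. C (G z s)) has_integral C (integral {0..t} (G z))) {0..t}"
      using has_integral_linear[OF G_int(2) blinfun.bounded_linear_right[of C], of t z] that by (auto simp: o_def)
    then have "((\<lambda>s. z - V z s) has_integral C (integral {0..t} (G z))) {0..t}"
    proof (rule has_integral_spike[OF neg[OF CG[of z]], rotated])
      show "z - V z s = C (G z s)" if "s \<in> {0..t} - {t \<in> {0..T}. V z t + C (G z t) \<noteq> z}" for s
        using that \<open>t \<in> {0..T}\<close> by (auto simp: algebra_simps)
    qed
    ultimately show ?thesis
      by (metis has_integral_unique)
  qed
  have G_cont: "continuous_on {0..T} (\<lambda>t. integral {0..t} (G z))" for z
    by (rule indefinite_integral_continuous_1) (use G_int(1) in auto)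
  have UJ_cont: "continuous_on {0..T} (\<lambda>t. integral {0..t} (U z))" for z
    by (rule indefinite_integral_continuous_1) (use U_int in auto)
  \<comment> \<open>For data \<open>J x\<close> a solution arises by integrating the one for
    \<open>C x\<close> in time: \<open>CG_eq\<close> shows that \<open>C\<close> maps the last
    component to \<open>U (C x) t\<close>, which cancels the same term in the derivative. Hence
    \<open>U (J x) t\<close> differs from \<open>t *\<^sub>R J x\<close> only to second order in
    \<open>t\<close>.\<close>
  have SJ: "Sol C (\<lambda>_. J x) (\<lambda>t. t *\<^sub>R J x - integral {0..t} (U (C x))) (\<lambda>t. J x - U (C x) t)
      (\<lambda>t. t *\<^sub>R x - integral {0..t} (G (C x)))" for x
    unfolding Sol_def MR_def
  proof (intro conjI ballI AE_lebesgue_on_space)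
    show "Lp T p (\<lambda>t. J x - U (C x) t)" "Lp T p (\<lambda>t. t *\<^sub>R x - integral {0..t} (G (C x)))"
      using p_nonneg by (intro Lp_continuous_on continuous_intros U_cont G_cont; simp)+
    fix t assume t: "t \<in> {0..T}"
    have "(U (C x) has_integral integral {0..t} (U (C x))) {0..t}"
      using U_int[of t] t by auto
    from has_integral_diff[OF has_integral_const_real[of "J x" 0 t] this]
    show "((\<lambda>t. J x - U (C x) t) has_integral
        (t *\<^sub>R J x - integral {0..t} (U (C x))) - (0 *\<^sub>R J x - integral {0..0} (U (C x)))) {0..t}"
      using t by simp
    show "t *\<^sub>R J x - integral {0..t} (U (C x)) = J (t *\<^sub>R x - integral {0..t} (G (C x)))"
      using t U_eq[of t "C x"] by (simp add: blinfun.diff_right blinfun.scaleR_right)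
    show "J x - U (C x) t + C (t *\<^sub>R x - integral {0..t} (G (C x))) = J x"
      using CG_eq[OF t] by (simp add: blinfun.diff_right blinfun.scaleR_right)
  qed auto
  have UJ: "U (J x) t = t *\<^sub>R J x - integral {0..t} (U (C x))" if "t \<in> {0..T}" for x t
    by (rule Sol_unique[OF C Lp_const S SJ that])
  have GJ: "AE t in lebesgue_on {0..T}. G (J x) t = t *\<^sub>R x - integral {0..t} (G (C x))" for x
    by (rule Sol_unique_window(3)[OF C S SJ]) (use T_pos in auto)
  define h where "h n = \<tau> / Suc n" for n
  have h: "0 < h n" "h n \<le> \<tau>" "h n \<le> T" for n
    using \<tau> by (auto simp: h_def field_simps) (smt (verit) mult_nonneg_nonneg of_nat_0_le_iff)
  have h_lim: "h \<longlonglongrightarrow> 0"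
    unfolding h_def[abs_def] using tendsto_mult_right_zero[OF LIMSEQ_inverse_real_of_nat, of \<tau>] by (simp add: divide_inverse)
  \<comment> \<open>Since \<open>U (J x) t\<close> is close to \<open>t *\<^sub>R J x\<close>, whose
    integral over [0, h] is \<open>h^2 / 2\<close> times \<open>J x\<close>, the factor
    \<open>2 / h^2\<close> normalises the average.\<close>
  define R where "R n z = (2 / (h n)\<^sup>2) *\<^sub>R integral {0..h n} (G z)" for n z
  have R_lin: "bounded_linear (R n)" for n
  proof (rule bounded_linear_intro)
    fix z w
    have "AE t in lebesgue_on {0..T}. G (z + w) t = G z t + G w t"
      by (rule Sol_unique_window(3)[OF C S Sol_add[OF S S]]) (use T_pos in auto)
    from integral_spike[OF neg[OF this], of "{0..h n}" "\<lambda>t. G z t + G w t" "G (z + w)"]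
    have "integral {0..h n} (G (z + w)) = integral {0..h n} (\<lambda>t. G z t + G w t)"
      using h(3)[of n] by force
    then show "R n (z + w) = R n z + R n w"
      unfolding R_def using G_int(1)[OF h(3)] by (simp add: integral_add scaleR_add_right)
  next
    fix r z
    have "AE t in lebesgue_on {0..T}. G (r *\<^sub>R z) t = r *\<^sub>R G z t"
      by (rule Sol_unique_window(3)[OF C S Sol_scale[OF S]]) (use T_pos in auto)
    from integral_spike[OF neg[OF this], of "{0..h n}" "\<lambda>t. r *\<^sub>R G z t" "G (r *\<^sub>R z)"]
    have "integral {0..h n} (G (r *\<^sub>R z)) = integral {0..h n} (\<lambda>t. r *\<^sub>R G z t)"
      using h(3)[of n] by force
    then show "R n (r *\<^sub>R z) = r *\<^sub>R R n z"
      unfolding R_def by simp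
  next
    fix z
    have "norm (R n z) = (2 / (h n)\<^sup>2) * norm (integral {0..h n} (G z))"
      by (simp add: R_def)
    also have "\<dots> \<le> (2 / (h n)\<^sup>2) * (k * h n * norm z)"
      using h[of n] by (intro mult_left_mono G_bd) auto
    finally show "norm (R n z) \<le> norm z * ((2 / (h n)\<^sup>2) * (k * h n))"
      by (simp add: mult_ac)
  qed
  have JR: "J (R n z) = (2 / (h n)\<^sup>2) *\<^sub>R integral {0..h n} (U z)" for n z
    using U_eq[OF h(3)] by (simp add: R_def blinfun.scaleR_right)
  have avg: "norm ((2 / (h n)\<^sup>2) *\<^sub>R integral {0..h n} f) \<le> 2 / h n * B"
    if "continuous_on {0..h n} f" "\<And>t. t \<in> {0..h n} \<Longrightarrow> norm (f t) \<le> B" for f :: "real \<Rightarrow> 'x" and B n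
  proof -
    have "norm (integral {0..h n} f) \<le> B * (h n - 0)"
      by (rule integral_bound[OF _ that]) (use h(1)[of n] in simp_all)
    then have "2 / (h n)\<^sup>2 * norm (integral {0..h n} f) \<le> 2 / (h n)\<^sup>2 * (B * h n)"
      by (intro mult_left_mono) auto
    then show ?thesis
      using h[of n] by (simp add: power2_eq_square)
  qed
  have U_cont': "continuous_on {0..h n} (U z)" for n z
    by (rule continuous_on_subset[OF U_cont]) (use h(3)[of n] in auto)
  have U_bd': "norm (U z t) \<le> k * h n * norm z" if "t \<in> {0..h n}" for n z t
  proof -
    have "norm (U z t) \<le> k * t * norm z"
      using that h(2)[of n] by (intro U_bd) auto
    also have "\<dots> \<le> k * h n * norm z"
      using that k by (intro mult_right_mono mult_left_mono) auto
    finally show ?thesis .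
  qed
  \<comment> \<open>After composition with \<open>J\<close> the bound is uniform in
    \<open>n\<close>, whereas the bound found for \<open>R n\<close> as an operator into D grows
    like \<open>1 / h n\<close>.\<close>
  have JR_bd: "norm (J (R n z)) \<le> 2 * k * norm z" for n z
  proof -
    have "norm (J (R n z)) \<le> 2 / h n * (k * h n * norm z)"
      unfolding JR by (rule avg[OF U_cont' U_bd'])
    then show ?thesis
      using h(1)[of n] by simp
  qed
  have JR_D: "norm (J (R n (J x)) - J x) \<le> 2 * k * norm (C x) * h n" for n x
  proof -
    have "((\<lambda>t. t *\<^sub>R J x) has_integral ((h n)\<^sup>2 / 2) *\<^sub>R J x) {0..h n}"
    proof -
      have "((\<lambda>t. t) has_integral ((h n)\<^sup>2 / 2 - 0\<^sup>2 / 2)) {0..h n}"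
        using ident_has_integral[of 0 "h n"] h(1)[of n] by (simp add: power2_eq_square)
      from has_integral_linear[OF this bounded_linear_scaleR_left, of "J x"] show ?thesis
        by (simp add: o_def)
    qed
    then have I: "integral {0..h n} (\<lambda>t. t *\<^sub>R J x) = ((h n)\<^sup>2 / 2) *\<^sub>R J x" "(\<lambda>t. t *\<^sub>R J x) integrable_on {0..h n}"
      by (auto simp: integral_unique)
    have "J (R n (J x)) - J x = (2 / (h n)\<^sup>2) *\<^sub>R (integral {0..h n} (U (J x)) - ((h n)\<^sup>2 / 2) *\<^sub>R J x)"
      using h(1)[of n] by (simp add: JR scaleR_diff_right)
    also have "integral {0..h n} (U (J x)) - ((h n)\<^sup>2 / 2) *\<^sub>R J x = integral {0..h n} (\<lambda>t. U (J x) t - t *\<^sub>R J x)"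
      using I U_int[OF h(3)] by (simp add: integral_diff)
    finally have eq: "J (R n (J x)) - J x = (2 / (h n)\<^sup>2) *\<^sub>R integral {0..h n} (\<lambda>t. U (J x) t - t *\<^sub>R J x)" .
    have bd: "norm (U (J x) t - t *\<^sub>R J x) \<le> k * h n * norm (C x) * h n" if t: "t \<in> {0..h n}" for t
    proof -
      have bd: "norm (U (C x) s) \<le> k * h n * norm (C x)" if "s \<in> {0..t}" for s
        using that t by (intro U_bd') auto
      have "norm (integral {0..t} (U (C x))) \<le> k * h n * norm (C x) * (t - 0)"
        by (rule integral_bound[OF _ continuous_on_subset[OF U_cont] bd]) (use t h(3)[of n] in auto)
      also have "\<dots> \<le> k * h n * norm (C x) * h n"
        using t k h(1)[of n] by (intro mult_left_mono) auto
      finally show ?thesis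
        using UJ[of t x] t h(3)[of n] by simp
    qed
    have "norm (J (R n (J x)) - J x) \<le> 2 / h n * (k * h n * norm (C x) * h n)"
      unfolding eq by (rule avg[OF _ bd]) (intro continuous_intros U_cont')
    then show ?thesis
      using h(1)[of n] by simp
  qed
  \<comment> \<open>Uniform boundedness together with convergence on the dense range of
    \<open>J\<close>; \<open>e\<close> is chosen so that
    \<open>(2 * k + 1) * e = r / 2\<close>.\<close>
  have JR_lim: "(\<lambda>n. J (R n z)) \<longlonglongrightarrow> z" for z
  proof (rule LIMSEQ_I)
    fix r :: real assume r: "r > 0"
    define e where "e = r / (2 * (2 * k + 1))"
    have e: "e > 0" using r k by (simp add: e_def)
    obtain x where x: "norm (J x - z) < e"
      using dense e closure_approachable[of z "range (blinfun_apply J)"] by (auto simp: dist_norm)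
    have "(\<lambda>n. 2 * k * norm (C x) * h n) \<longlonglongrightarrow> 0"
      using tendsto_mult_right_zero[OF h_lim] by simp
    then have "\<forall>\<^sub>F n in sequentially. 2 * k * norm (C x) * h n < r / 2"
      by (rule order_tendstoD(2)) (use r in simp)
    then obtain N where N: "\<And>n. n \<ge> N \<Longrightarrow> 2 * k * norm (C x) * h n < r / 2"
      unfolding eventually_sequentially by blast
    have "norm (J (R n z) - z) < r" if "n \<ge> N" for n
    proof -
      have "J (R n z) - z = J (R n (z - J x)) + (J (R n (J x)) - J x) + (J x - z)"
        using linear_diff[OF bounded_linear.linear[OF R_lin], of n z "J x"] by (simp add: blinfun.diff_right)
      then have "norm (J (R n z) - z) \<le> norm (J (R n (z - J x))) + norm (J (R n (J x)) - J x) + norm (J x - z)"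
        by (metis norm_triangle_le norm_triangle_ineq add_mono order_refl)
      also have "norm (J (R n (z - J x))) \<le> 2 * k * e"
        using JR_bd[of n "z - J x"] x k by (smt (verit) mult_left_mono norm_minus_commute)
      also have "norm (J (R n (J x)) - J x) < r / 2"
        using JR_D[of n x] N[OF that] by linarith
      also have "2 * k * e + r / 2 + norm (J x - z) < 2 * k * e + r / 2 + e"
        using x by simp
      also have "\<dots> = r"
      proof -
        have "(2 * k + 1) * e = r / 2" 
        proof -
          have "4 * k + 2 > 0" using k by simp
          then show ?thesis by (simp add: e_def field_simps)
        qed
        then show ?thesis by (simp add: algebra_simps)
      qed
      finally show ?thesis by simp
    qed
    then show "\<exists>N. \<forall>n\<ge>N. norm (J (R n z) - z) < r" by blast
  qed
  \<comment> \<open>The averages commute with \<open>C\<close>, because \<open>U (C x)\<close>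
    equals \<open>C (G (J x))\<close> almost everywhere. Convergence in X therefore becomes
    convergence in the graph norm, which dominates the norm of D.\<close>
  have CR: "C (R n (J x)) = J (R n (C x))" for n x
  proof -
    have "AE t in lebesgue_on {0..T}. t \<in> {0..T}"
      by (rule AE_lebesgue_on_space)
    then have "AE t in lebesgue_on {0..T}. U (C x) t = C (G (J x) t)"
      using GJ[of x]
    proof eventually_elim
      case (elim t)
      then show ?case
        using CG_eq[of t "C x"] by (simp add: blinfun.diff_right blinfun.scaleR_right)
    qed
    from integral_spike[OF neg[OF this], of "{0..h n}" "\<lambda>t. C (G (J x) t)" "U (C x)"]
    have "integral {0..h n} (U (C x)) = integral {0..h n} (\<lambda>t. C (G (J x) t))"
      using h(3)[of n] by force
    also have "\<dots> = C (integral {0..h n} (G (J x)))"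
      using integral_linear[OF G_int(1)[OF h(3)] blinfun.bounded_linear_right[of C]] by (simp add: o_def)
    finally show ?thesis
      by (simp add: JR) (simp add: R_def blinfun.scaleR_right)
  qed
  have "(\<lambda>n. R n (J x)) \<longlonglongrightarrow> x" for x
  proof (rule LIM_zero_cancel, rule Lim_null_comparison)
    show "\<forall>\<^sub>F n in sequentially. norm (R n (J x) - x) \<le> M * (norm (J (R n (C x)) - C x) + norm (J (R n (J x)) - J x))"
      using M(2)[of "R _ (J x) - x"] by (simp add: blinfun.diff_right CR)
    have "(\<lambda>n. M * (norm (J (R n (C x)) - C x) + norm (J (R n (J x)) - J x))) \<longlonglongrightarrow> M * (norm (C x - C x) + norm (J x - J x))"
      by (intro tendsto_intros JR_lim)
    then show "(\<lambda>n. M * (norm (J (R n (C x)) - C x) + norm (J (R n (J x)) - J x))) \<longlonglongrightarrow> 0"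
      by simp
  qed
  with R_lin show ?thesis by blast
qed

text \<open>The inverse of \<open>J\<close> is in general discontinuous on its range, so
  \<open>g\<close> is not a continuous image of \<open>J (g t)\<close>; it is a pointwise limit of
  such images.\<close>

lemma smeas_domain:
  assumes "maxreg T p J C" "closure (range (blinfun_apply J)) = UNIV" and w: "smeas T (\<lambda>t. J (g t))"
  shows "smeas T g"
proof -
  obtain R :: "nat \<Rightarrow> 'x \<Rightarrow> 'd" where R: "\<And>n. bounded_linear (R n)" "\<And>x. (\<lambda>n. R n (J x)) \<longlonglongrightarrow> x"
    using approximate_identity[OF assms(1,2)] by blast
  show ?thesis
  proof (rule smeas_AE_limit)
    show "smeas T (\<lambda>t. R n (J (g t)))" for n
      by (rule smeas_compose[OF w linear_continuous_on[OF R(1)]])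
    show "AE t in lebesgue_on {0..T}. (\<lambda>n. R n (J (g t))) \<longlonglongrightarrow> g t"
      using R(2) by simp
  qed
qed

end

section \<open>Fixed points and uniform bounds\<close>

text \<open>Points at which the constant \<open>n\<close> fails accumulate at some \<open>t\<close>,
  in contradiction to the local bound near \<open>t\<close>.\<close>

lemma uniform_of_local:
  fixes Pr :: "real \<Rightarrow> real \<Rightarrow> bool"
  assumes loc: "\<And>t. t \<in> {0..T} \<Longrightarrow> \<exists>\<delta>>0. \<exists>M. \<forall>s\<in>{0..T}. \<bar>t - s\<bar> \<le> \<delta> \<longrightarrow> Pr s M"
    and mono: "\<And>s M M'. Pr s M \<Longrightarrow> M \<le> M' \<Longrightarrow> Pr s M'"
  shows "\<exists>M. \<forall>s\<in>{0..T}. Pr s M"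
proof (rule ccontr)
  assume "\<not> ?thesis"
  then have "\<forall>n::nat. \<exists>s\<in>{0..T}. \<not> Pr s (real n)" by blast
  then obtain s where s: "\<And>n. s n \<in> {0..T}" "\<And>n. \<not> Pr (s n) (real n)"
    by metis
  have "seq_compact {0..T}"
    by (simp add: compact_imp_seq_compact)
  then obtain t r where t: "t \<in> {0..T}" "strict_mono r" "(s \<circ> r) \<longlonglongrightarrow> t"
    using seq_compactE[of "{0..T}" s] s(1) by blast
  obtain \<delta> M where \<delta>: "\<delta> > 0" "\<And>s. s \<in> {0..T} \<Longrightarrow> \<bar>t - s\<bar> \<le> \<delta> \<Longrightarrow> Pr s M"
    using loc[OF t(1)] by blast
  obtain N where N: "\<And>n. n \<ge> N \<Longrightarrow> norm ((s \<circ> r) n - t) < \<delta>"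
    using LIMSEQ_D[OF t(3) \<delta>(1)] by blast
  obtain m where m: "M \<le> real m"
    using real_arch_simple by blast
  define n where "n = max N m"
  have "Pr (s (r n)) M"
    using N[of n] by (intro \<delta>(2) s) (auto simp: n_def)
  moreover have "M \<le> real (r n)"
    using m seq_suble[OF t(2), of n] by (auto simp: n_def)
  ultimately show False
    using s(2)[of "r n"] mono by blast
qed

text \<open>Near each \<open>t\<close> relative continuity with tolerance 1 suffices, its
  lower-order term being bounded through \<open>norm J\<close>.\<close>

lemma rel_cont_bounded:
  assumes "rel_cont T J C"
  shows "\<exists>M\<ge>0. \<forall>t\<in>{0..T}. norm (C t) \<le> M"
proof -
  have "\<exists>M. \<forall>s\<in>{0..T}. norm (C s) \<le> M"
  proof (rule uniform_of_local)
    fix t assume "t \<in> {0..T}"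
    then obtain \<delta> \<eta> where d: "\<delta> > 0" "\<eta> \<ge> 0"
      "\<And>s x. s \<in> {0..T} \<Longrightarrow> \<bar>t - s\<bar> \<le> \<delta> \<Longrightarrow> norm (C t x - C s x) \<le> 1 * norm x + \<eta> * norm (J x)"
      using assms unfolding rel_cont_def by (metis zero_less_one)
    show "\<exists>\<delta>>0. \<exists>M. \<forall>s\<in>{0..T}. \<bar>t - s\<bar> \<le> \<delta> \<longrightarrow> norm (C s) \<le> M"
    proof (rule exI[of _ \<delta>], rule conjI[OF d(1)], rule exI[of _ "norm (C t) + 1 + \<eta> * norm J"],
        intro ballI impI norm_blinfun_bound)
      fix s x assume s: "s \<in> {0..T}" "\<bar>t - s\<bar> \<le> \<delta>"
      have "norm (C s x) \<le> norm (C t x) + norm (C t x - C s x)"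
        by (metis add.commute norm_minus_commute norm_triangle_sub)
      also have "\<dots> \<le> norm (C t) * norm x + (1 * norm x + \<eta> * (norm J * norm x))"
        using d(2) by (intro add_mono norm_blinfun order.trans[OF d(3)[OF s]] mult_left_mono) auto
      finally show "norm (C s x) \<le> (norm (C t) + 1 + \<eta> * norm J) * norm x"
        by (simp add: algebra_simps)
    qed (use d in auto)
  qed auto
  then obtain M where "\<forall>t\<in>{0..T}. norm (C t) \<le> M" by blast
  then show ?thesis
    by (intro exI[of _ "max M 0"]) auto
qed

text \<open>The graph estimate at \<open>t\<close> persists for nearby operators: a tolerance
  \<open>e\<close> with \<open>M * e \<le> 1 / 2\<close> lets half of \<open>norm x\<close> be
  absorbed.\<close>

lemma (in evolution) uniform_graph_bound:
  assumes "rel_cont T J C" and MR: "\<And>t. t \<in> {0..T} \<Longrightarrow> maxreg T p J (C t)"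
  shows "\<exists>M\<ge>0. \<forall>t\<in>{0..T}. \<forall>x. norm x \<le> M * (norm (C t x) + norm (J x))"
proof -
  have "\<exists>M. \<forall>s\<in>{0..T}. \<forall>x. norm x \<le> M * (norm (C s x) + norm (J x))"
  proof (rule uniform_of_local)
    fix t assume t: "t \<in> {0..T}"
    obtain M where M: "M \<ge> 0" "\<And>x. norm x \<le> M * (norm (C t x) + norm (J x))"
      using graph_bound[OF MR[OF t]] by blast
    define e where "e = 1 / (2 * (M + 1))"
    have e: "e > 0" "M * e \<le> 1 / 2"
      using M(1) by (auto simp: e_def field_simps)
    obtain \<delta> \<eta> where d: "\<delta> > 0" "\<eta> \<ge> 0"
      "\<And>s x. s \<in> {0..T} \<Longrightarrow> \<bar>t - s\<bar> \<le> \<delta> \<Longrightarrow> norm (C t x - C s x) \<le> e * norm x + \<eta> * norm (J x)"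
      using assms(1) t e(1) unfolding rel_cont_def by metis
    show "\<exists>\<delta>>0. \<exists>M. \<forall>s\<in>{0..T}. \<bar>t - s\<bar> \<le> \<delta> \<longrightarrow> (\<forall>x. norm x \<le> M * (norm (C s x) + norm (J x)))"
    proof (rule exI[of _ \<delta>], rule conjI[OF d(1)], rule exI[of _ "2 * M * (1 + \<eta>)"], intro ballI impI allI)
      fix s x assume s: "s \<in> {0..T}" "\<bar>t - s\<bar> \<le> \<delta>"
      have "norm (C t x) \<le> norm (C s x) + norm (C t x - C s x)"
        by (metis add.commute norm_triangle_sub)
      also have "\<dots> \<le> norm (C s x) + (e * norm x + \<eta> * norm (J x))"
        using d(3)[OF s] by simp
      finally have "M * (norm (C t x) + norm (J x)) \<le> M * (norm (C s x) + (e * norm x + \<eta> * norm (J x)) + norm (J x))"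
        using M(1) by (intro mult_left_mono) auto
      also have "\<dots> = M * e * norm x + M * (norm (C s x) + (1 + \<eta>) * norm (J x))"
        by (simp add: algebra_simps)
      also have "\<dots> \<le> 1 / 2 * norm x + M * ((1 + \<eta>) * norm (C s x) + (1 + \<eta>) * norm (J x))"
        using M(1) d(2) e(2) by (intro add_mono mult_right_mono mult_left_mono order_refl) (auto simp: mult_le_cancel_right1)
      finally show "norm x \<le> 2 * M * (1 + \<eta>) * (norm (C s x) + norm (J x))"
        using M(2)[of x] by (simp add: algebra_simps)
    qed
  next
    fix s M M' assume "\<forall>x. norm x \<le> M * (norm (C s x) + norm (J x))" and "M \<le> (M'::real)"
    then show "\<forall>x. norm x \<le> M' * (norm (C s x) + norm (J x))"
      by (meson add_nonneg_nonneg mult_right_mono norm_ge_zero order.trans)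
  qed
  then obtain M where M: "\<And>t x. t \<in> {0..T} \<Longrightarrow> norm x \<le> M * (norm (C t x) + norm (J x))" by blast
  have "norm x \<le> max M 0 * (norm (C t x) + norm (J x))" if "t \<in> {0..T}" for t x
    using M[OF that, of x] by (meson add_nonneg_nonneg max.cobounded1 mult_right_mono norm_ge_zero order.trans)
  then show ?thesis
    by (intro exI[of _ "max M 0"]) auto
qed

section \<open>Fixed points in L^p\<close>

lemma geometric_Cauchy_limit:
  fixes y :: "nat \<Rightarrow> 'a::banach"
  assumes "\<And>n. norm (y (Suc n) - y n) \<le> B / 2^n"
  shows "\<exists>l. y \<longlonglongrightarrow> l \<and> (\<forall>n. norm (l - y n) \<le> 2 * B / 2^n)"
proof -
  have B: "B \<ge> 0" using order.trans[OF norm_ge_zero assms[of 0]] by simp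
  \<comment> \<open>Keeping the subtracted term lets the induction close; it is dropped in
    \<open>bd\<close>.\<close>
  have tele: "norm (y m - y n) \<le> 2 * B / 2^n - 2 * B / 2^m" if "n \<le> m" for n m
    using that
  proof (induction m rule: dec_induct)
    case (step m)
    have "norm (y (Suc m) - y n) \<le> norm (y (Suc m) - y m) + norm (y m - y n)"
      by (metis add.commute diff_add_cancel diff_diff_eq2 norm_triangle_ineq add_diff_eq)
    also have "\<dots> \<le> B / 2^m + (2 * B / 2^n - 2 * B / 2^m)"
      using step assms by (intro add_mono) auto
    also have "\<dots> = 2 * B / 2^n - 2 * B / 2^Suc m"
      by (simp add: field_simps)
    finally show ?case .
  qed simp
  have bd: "norm (y m - y n) \<le> 2 * B / 2^n" if "n \<le> m" for n m
    using tele[OF that] B by (smt (verit) divide_nonneg_nonneg mult_nonneg_nonneg zero_le_power)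
  have lim0: "(\<lambda>n. 2 * B / 2^n) \<longlonglongrightarrow> 0"
    using tendsto_mult_right_zero[OF LIMSEQ_power_zero[of "1/2::real"], of "2 * B"] by (simp add: power_divide)
  have "Cauchy y"
  proof (rule metric_CauchyI)
    fix e :: real assume "e > 0"
    then have "\<forall>\<^sub>F n in sequentially. 2 * B / 2^n < e / 2"
      by (intro order_tendstoD(2)[OF lim0]) auto
    then obtain N where "2 * B / 2^N < e / 2"
      unfolding eventually_sequentially by blast
    then have "dist (y m) (y n) < e" if "m \<ge> N" "n \<ge> N" for m n
      using bd[OF that(1)] bd[OF that(2)] dist_triangle2[of "y m" "y n" "y N"] by (simp add: dist_norm)
    then show "\<exists>M. \<forall>m\<ge>M. \<forall>n\<ge>M. dist (y m) (y n) < e" by blast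
  qed
  then obtain l where l: "y \<longlonglongrightarrow> l"
    using Cauchy_convergent_iff convergent_def by blast
  have "norm (l - y n) \<le> 2 * B / 2^n" for n
  proof (rule tendsto_upperbound)
    show "(\<lambda>m. norm (y m - y n)) \<longlonglongrightarrow> norm (l - y n)"
      by (intro tendsto_intros l)
    show "\<forall>\<^sub>F m in sequentially. norm (y m - y n) \<le> 2 * B / 2^n"
      using bd by (intro eventually_sequentiallyI[of n])
  qed simp
  with l show ?thesis by blast
qed

text \<open>Banach's fixed point theorem in \<open>L\<^sup>p\<close>, phrased with the modular \<open>\<integral>\<parallel>f\<parallel>\<^sup>p\<close> instead of the norm. The
  constant \<open>4\<^sup>p\<close> makes the weighted sum \<open>G\<close> below integrable, which yields pointwise geometric
  convergence of the Picard iterates almost everywhere.\<close>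

lemma Lp_fixed_point:
  fixes F :: "(real \<Rightarrow> 'a::banach) \<Rightarrow> real \<Rightarrow> 'a"
  assumes p: "p \<ge> 1" and \<theta>: "0 \<le> \<theta>" "\<theta> * 4 powr p \<le> 1"
    and F: "\<And>f. Lp T p f \<Longrightarrow> Lp T p (F f)"
    and contr: "\<And>f g. Lp T p f \<Longrightarrow> Lp T p g \<Longrightarrow>
      pmass p 0 T (\<lambda>t. F f t - F g t) \<le> ennreal \<theta> * pmass p 0 T (\<lambda>t. f t - g t)"
  shows "\<exists>f. Lp T p f \<and> (AE t in lebesgue_on {0..T}. F f t = f t)"
proof -
  let ?M = "lebesgue_on {0..T}"
  define f where "f n = (F ^^ n) (\<lambda>_. 0)" for n
  have fSuc: "f (Suc n) = F (f n)" for n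
    by (simp add: f_def)
  have fLp: "Lp T p (f n)" for n
  proof (induction n)
    case 0
    show ?case by (simp add: f_def)
  next
    case (Suc n)
    then show ?case unfolding fSuc by (rule F)
  qed
  define d where "d n = pmass p 0 T (\<lambda>t. f (Suc n) t - f n t)" for n
  have dd: "d n \<le> ennreal (\<theta>^n) * d 0" for n
  proof (induction n)
    case (Suc n)
    have "d (Suc n) \<le> ennreal \<theta> * d n"
      unfolding d_def fSuc[of "Suc n"] unfolding fSuc[of n]
      by (rule contr[OF fLp[of "Suc n", unfolded fSuc] fLp])
    also have "\<dots> \<le> ennreal \<theta> * (ennreal (\<theta>^n) * d 0)"
      by (intro mult_left_mono Suc) auto
    also have "\<dots> = ennreal (\<theta>^Suc n) * d 0"
      using \<theta> by (simp add: ennreal_mult mult.assoc)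
    finally show ?case .
  qed simp
  have d0: "d 0 < \<infinity>"
    using Lp_diff[OF fLp[of "Suc 0"] fLp[of 0]] p by (simp add: d_def Lp_iff)
  have m[measurable]: "(\<lambda>t. norm (f (Suc n) t - f n t)) \<in> borel_measurable ?M" for n
    by (intro smeas_norm_measurable smeas_diff Lp_smeas[OF fLp])
  \<comment> \<open>The weight is the p-th power of \<open>2^n\<close>, so finiteness of the sum at
    \<open>t\<close> bounds each step there by \<open>B t / 2^n\<close>.\<close>
  define G where "G t = (\<Sum>n. ennreal (2 powr (n * p) * norm (f (Suc n) t - f n t) powr p))" for t
  have [measurable]: "G \<in> borel_measurable ?M"
    unfolding G_def by measurable
  have two: "2 powr (real n * p) = (2 powr p)^n" for n
    by (simp add: powr_realpow[symmetric] powr_powr mult.commute)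
  \<comment> \<open>Of the two factors in \<open>4 powr p = 2 powr p * 2 powr p\<close>, one pays
    for the weights in \<open>G\<close>; the other is at least 2 and leaves the ratio 1/2.\<close>
  have \<theta>2: "2 powr p * \<theta> \<le> 1 / 2"
  proof -
    have "2 powr p * (2 powr p * \<theta>) \<le> 1"
      using \<theta>(2) powr_mult[of 2 2 p] by (simp add: mult_ac)
    moreover have "2 * (2 powr p * \<theta>) \<le> 2 powr p * (2 powr p * \<theta>)"
      using p \<theta> powr_mono[of 1 p "2::real"] by (intro mult_right_mono) auto
    ultimately show ?thesis by linarith
  qed
  have "(\<integral>\<^sup>+t. G t \<partial>?M) = (\<Sum>n. \<integral>\<^sup>+t. ennreal (2 powr (n * p) * norm (f (Suc n) t - f n t) powr p) \<partial>?M)"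
    unfolding G_def by (rule nn_integral_suminf) measurable
  also have "\<dots> = (\<Sum>n. ennreal (2 powr (n * p)) * d n)"
  proof (rule suminf_cong)
    fix n
    have "(\<integral>\<^sup>+t. ennreal (2 powr (n * p) * norm (f (Suc n) t - f n t) powr p) \<partial>?M)
        = (\<integral>\<^sup>+t. ennreal (2 powr (n * p)) * ennreal (norm (f (Suc n) t - f n t) powr p) \<partial>?M)"
      by (simp add: ennreal_mult)
    also have "\<dots> = ennreal (2 powr (n * p)) * d n"
      unfolding d_def pmass_def by (rule nn_integral_cmult) measurable
    finally show "(\<integral>\<^sup>+t. ennreal (2 powr (n * p) * norm (f (Suc n) t - f n t) powr p) \<partial>?M) = ennreal (2 powr (n * p)) * d n" .
  qed
  also have "\<dots> \<le> (\<Sum>n. ennreal ((1/2)^n) * d 0)"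
  proof (rule suminf_le)
    fix n
    have "ennreal (2 powr (n * p)) * d n \<le> ennreal (2 powr (n * p)) * (ennreal (\<theta>^n) * d 0)"
      by (intro mult_left_mono dd) auto
    also have "\<dots> = ennreal ((2 powr p * \<theta>)^n) * d 0"
      using \<theta> by (simp add: two ennreal_mult mult.assoc power_mult_distrib)
    also have "\<dots> \<le> ennreal ((1/2)^n) * d 0"
      using \<theta> \<theta>2 by (intro mult_right_mono ennreal_leI power_mono) auto
    finally show "ennreal (2 powr (n * p)) * d n \<le> ennreal ((1/2)^n) * d 0" .
  qed auto
  also have "\<dots> = (\<Sum>n. ennreal ((1/2)^n)) * d 0"
    by (rule ennreal_suminf_multc)
  also have "(\<Sum>n. ennreal ((1/2)^n)) = ennreal (\<Sum>n. (1/2)^n)"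
    by (rule suminf_ennreal2) (auto intro: summable_geometric)
  also have "\<dots> * d 0 < \<infinity>"
    using d0 by (auto simp: ennreal_mult_less_top)
  finally have Gint: "(\<integral>\<^sup>+t. G t \<partial>?M) < \<infinity>" .
  then have Gfin: "AE t in ?M. G t \<noteq> \<infinity>"
    by (intro nn_integral_PInf_AE) auto
  define B where "B t = enn2real (G t) powr (1 / p)" for t
  have step: "norm (f (Suc n) t - f n t) \<le> B t / 2^n" if "G t \<noteq> \<infinity>" for n t
  proof -
    let ?a = "\<lambda>n. ennreal (2 powr (n * p) * norm (f (Suc n) t - f n t) powr p)"
    have "?a n = sum ?a {n}" by simp
    also have "\<dots> \<le> G t"
      unfolding G_def by (rule sum_le_suminf) auto
    also have "\<dots> = ennreal (enn2real (G t))"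
      using that by (simp add: less_top)
    finally have "2 powr (n * p) * norm (f (Suc n) t - f n t) powr p \<le> enn2real (G t)"
      by (simp add: ennreal_le_iff)
    then have "(2^n * norm (f (Suc n) t - f n t)) powr p \<le> enn2real (G t) * 1 powr p"
      using p by (simp add: powr_mult two powr_realpow[symmetric] powr_powr mult.commute)
    then have "2^n * norm (f (Suc n) t - f n t) \<le> enn2real (G t) powr (1 / p) * 1"
      by (rule powr_le_cancel) (use p in auto)
    then show ?thesis
      by (simp add: B_def field_simps)
  qed
  define h where "h t = lim (\<lambda>n. f n t)" for t
  have lim: "AE t in ?M. (\<lambda>n. f n t) \<longlonglongrightarrow> h t" and bd: "AE t in ?M. \<forall>n. norm (h t - f n t) \<le> 2 * B t / 2^n"
  proof -
    have *: "(\<lambda>n. f n t) \<longlonglongrightarrow> h t \<and> (\<forall>n. norm (h t - f n t) \<le> 2 * B t / 2^n)" if "G t \<noteq> \<infinity>" for t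
      using geometric_Cauchy_limit[of "\<lambda>n. f n t" "B t", OF step[OF that]] limI unfolding h_def by metis
    show "AE t in ?M. (\<lambda>n. f n t) \<longlonglongrightarrow> h t" "AE t in ?M. \<forall>n. norm (h t - f n t) \<le> 2 * B t / 2^n"
      using Gfin by (eventually_elim, use * in blast)+
  qed
  have sh: "smeas T h"
    by (rule smeas_AE_limit[OF Lp_smeas[OF fLp] lim])
  define g where "g = enn2real (\<integral>\<^sup>+t. G t \<partial>?M)"
  \<comment> \<open>\<open>G\<close> dominates the p-th power of the whole remaining distance
    pointwise, which avoids triangle inequalities with a growing number of terms.\<close>
  have tail: "pmass p 0 T (\<lambda>t. h t - f n t) \<le> ennreal (2 powr p * g * (1/2)^n)" for n
  proof -
    have "pmass p 0 T (\<lambda>t. h t - f n t) \<le> (\<integral>\<^sup>+t. ennreal (2 powr p * (1/2)^n) * G t \<partial>?M)"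
      unfolding pmass_def
    proof (rule nn_integral_mono_AE)
      show "AE t in ?M. ennreal (norm (h t - f n t) powr p) \<le> ennreal (2 powr p * (1/2)^n) * G t"
        using bd Gfin
      proof eventually_elim
        case (elim t)
        have "norm (h t - f n t) powr p \<le> (2 * B t / 2^n) powr p"
          using elim(1) p by (intro powr_mono2) auto
        also have "\<dots> = 2 powr p * enn2real (G t) * ((1/2)^n) powr p"
          using p by (simp add: B_def powr_mult powr_divide powr_powr power_divide)
        also have "\<dots> \<le> 2 powr p * enn2real (G t) * ((1/2)^n) powr 1"
          using p by (intro mult_left_mono powr_mono') (auto simp: power_le_one)
        finally have "ennreal (norm (h t - f n t) powr p) \<le> ennreal ((2 powr p * (1/2)^n) * enn2real (G t))"
          by (intro ennreal_leI) (simp add: mult_ac)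
        also have "\<dots> = ennreal (2 powr p * (1/2)^n) * ennreal (enn2real (G t))"
          by (rule ennreal_mult) auto
        finally show ?case
          using elim(2) by (simp add: less_top)
      qed
    qed
    also have "\<dots> = ennreal (2 powr p * (1/2)^n) * (\<integral>\<^sup>+t. G t \<partial>?M)"
      by (rule nn_integral_cmult) measurable
    also have "(\<integral>\<^sup>+t. G t \<partial>?M) = ennreal g"
      using Gint by (simp add: g_def)
    also have "ennreal (2 powr p * (1/2)^n) * ennreal g = ennreal (2 powr p * g * (1/2)^n)"
      by (subst ennreal_mult[symmetric]) (auto simp: g_def mult_ac)
    finally show ?thesis .
  qed
  have hLp: "Lp T p h"
  proof -
    have "pmass p 0 T (\<lambda>t. h t - f 0 t) < \<infinity>"
      using tail[of 0] by (auto intro: order.strict_trans1)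
    then show ?thesis
      using sh by (simp add: Lp_iff f_def)
  qed
  \<comment> \<open>\<open>F (f n)\<close> is \<open>f (Suc n)\<close>, so both terms of the
    triangle inequality tend to zero, while the left-hand side does not depend on
    \<open>n\<close>.\<close>
  have small: "pmass p 0 T (\<lambda>t. F h t - h t) \<le> ennreal (2 powr p * (2 powr p * g * (\<theta> + 1)) * (1/2)^n)" for n
  proof -
    have "pmass p 0 T (\<lambda>t. F h t - h t) \<le> ennreal (2 powr p) *
        (pmass p 0 T (\<lambda>t. F h t - F (f n) t) + pmass p 0 T (\<lambda>t. h t - f (Suc n) t))"
    proof (rule pmass_bound_add)
      show "smeas T (\<lambda>t. F h t - F (f n) t)" "smeas T (\<lambda>t. h t - f (Suc n) t)"
        by (intro smeas_diff Lp_smeas[OF F[OF hLp]] Lp_smeas[OF F[OF fLp]] Lp_smeas[OF hLp] Lp_smeas[OF fLp])+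
      show "AE t in ?M. norm (F h t - h t) \<le> norm (F h t - F (f n) t) + norm (h t - f (Suc n) t)"
        unfolding fSuc by (rule AE_I2) (metis add.commute norm_minus_commute norm_triangle_ineq diff_add_cancel add_diff_eq)
    qed (use p in auto)
    also have "pmass p 0 T (\<lambda>t. F h t - F (f n) t) \<le> ennreal \<theta> * pmass p 0 T (\<lambda>t. h t - f n t)"
      by (rule contr[OF hLp fLp])
    also have "pmass p 0 T (\<lambda>t. h t - f n t) \<le> ennreal (2 powr p * g * (1/2)^n)"
      by (rule tail)
    also have "pmass p 0 T (\<lambda>t. h t - f (Suc n) t) \<le> ennreal (2 powr p * g * (1/2)^n)"
      by (rule order.trans[OF tail ennreal_leI]) (auto simp: g_def intro!: mult_left_mono)
    also have "ennreal (2 powr p) * (ennreal \<theta> * ennreal (2 powr p * g * (1/2)^n) + ennreal (2 powr p * g * (1/2)^n))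
        = ennreal (2 powr p * (2 powr p * g * (\<theta> + 1)) * (1/2)^n)"
    proof -
      have "ennreal \<theta> * ennreal (2 powr p * g * (1/2)^n) + ennreal (2 powr p * g * (1/2)^n)
          = ennreal (\<theta> * (2 powr p * g * (1/2)^n) + 2 powr p * g * (1/2)^n)"
        using \<theta> by (subst ennreal_mult[symmetric], simp, simp add: g_def, subst ennreal_plus[symmetric]) (auto simp: g_def)
      then show ?thesis
        using \<theta> by (simp, subst ennreal_mult[symmetric]) (auto simp: g_def algebra_simps)
    qed
    finally show ?thesis
      by (simp add: mult_left_mono add_mono)
  qed
  have "pmass p 0 T (\<lambda>t. F h t - h t) = 0"
  proof -
    let ?X = "pmass p 0 T (\<lambda>t. F h t - h t)"
    have lim0: "(\<lambda>n. 2 powr p * (2 powr p * g * (\<theta> + 1)) * (1/2)^n) \<longlonglongrightarrow> 0"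
      by (intro tendsto_mult_right_zero LIMSEQ_power_zero) simp
    have "?X \<le> ennreal 0"
      by (rule LIMSEQ_le_const[OF tendsto_ennrealI[OF lim0]]) (use small in auto)
    then show ?thesis by simp
  qed
  then have "AE t in ?M. F h t - h t = 0"
    using pmass_eq_0_iff[of T "\<lambda>t. F h t - h t" 0 T p] smeas_diff[OF Lp_smeas[OF F[OF hLp]] sh] by simp
  then have "AE t in ?M. F h t = h t"
    by simp
  with hLp show ?thesis by blast
qed

section \<open>Non-autonomous equations with a fixed domain\<close>

lemma AE_lebesgue_on_combine:
  assumes "AE t in lebesgue_on {a..b::real}. P t" "AE t in lebesgue_on {b..c}. P t"
  shows "AE t in lebesgue_on {a..c}. P t"
  using assms unfolding AE_lebesgue_on_iff
proof eventually_elim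
  case (elim t)
  then show ?case by (cases "t \<le> b") auto
qed

context evolution
begin

lemma MR_integral:
  assumes "MR z v g" "0 \<le> a" "a \<le> t" "t \<le> T"
  shows "integral {a..t} v = z t - z a"
proof -
  have "v integrable_on {0..t}"
    using assms Lp_integrable(3)[of T p v 0 t] p_nonneg by (auto simp: MR_def)
  then have "integral {0..a} v + integral {a..t} v = integral {0..t} v"
    using assms by (intro Henstock_Kurzweil_Integration.integral_combine) auto
  moreover have "integral {0..a} v = z a - z 0" "integral {0..t} v = z t - z 0"
    using assms by (auto simp: MR_def intro!: integral_unique)
  ultimately show ?thesis
    by (simp add: algebra_simps)
qed

text \<open>A Poincare inequality: \<open>z t\<close> is the integral of \<open>v\<close> from
  \<open>a\<close>. The factor \<open>(b - a)\<close> inside the power makes lower-order terms small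
  on short windows.\<close>

lemma pmass_primitive:
  assumes MR: "MR z v g" and ab: "0 \<le> a" "a \<le> b" "b \<le> T" and z: "z a = 0"
  shows "pmass p a b z \<le> ennreal ((2 * (b - a)) powr p) * pmass p a b v"
proof -
  have v: "Lp T p v" using MR by (simp add: MR_def)
  define c where "c = ennreal (2 powr p * (b - a) powr (p - 1)) * pmass p a b v"
  have "ennreal (norm (z t) powr p) \<le> c" if t: "t \<in> {a..b}" for t
  proof -
    have "ennreal (norm (z t) powr p) = ennreal (norm (integral {a..t} v) powr p)"
      using MR_integral[OF MR ab(1), of t] t ab z by simp
    also have "\<dots> \<le> ennreal (2 powr p * (t - a) powr (p - 1)) * pmass p a t v"
      using t ab by (intro Lp_integral_bound[OF v p_gt1]) auto
    also have "\<dots> \<le> c"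
      unfolding c_def using t p_gt1
      by (intro mult_mono ennreal_leI mult_left_mono powr_mono2 pmass_mono_interval) auto
    finally show ?thesis .
  qed
  then have "pmass p a b z \<le> (\<integral>\<^sup>+t. c \<partial>lebesgue_on {a..b})"
    unfolding pmass_def by (intro nn_integral_mono) auto
  also have "\<dots> = c * ennreal (b - a)"
    using ab by (simp add: emeasure_restrict_space)
  also have "\<dots> = ennreal (2 powr p * (b - a) powr (p - 1) * (b - a)) * pmass p a b v"
    using ab by (simp add: c_def ennreal_mult mult_ac)
  also have "2 powr p * (b - a) powr (p - 1) * (b - a) = (2 * (b - a)) powr p"
    using ab powr_mult[of 2 "b - a" p] by (cases "a = b") (auto simp: powr_diff)
  finally show ?thesis .
qed

end

text \<open>The lower-order term \<open>E\<close> is merely bounded; its smallness on short windows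
  comes from \<open>pmass_primitive\<close>.\<close>

locale nonautonomous = evolution T p J for T p :: real and J :: "'d::banach \<Rightarrow>\<^sub>L 'x::banach" +
  fixes C :: "real \<Rightarrow> ('d \<Rightarrow>\<^sub>L 'x)" and E :: "real \<Rightarrow> ('x \<Rightarrow>\<^sub>L 'x)" and e0 :: real
  assumes C_meas: "\<And>x. smeas T (\<lambda>t. C t x)" and C_rel: "rel_cont T J C"
    and C_MR: "\<And>t. t \<in> {0..T} \<Longrightarrow> maxreg T p J (C t)"
    and E_meas: "\<And>x. smeas T (\<lambda>t. E t x)" and E_bd: "\<And>t. t \<in> {0..T} \<Longrightarrow> norm (E t) \<le> e0"
begin

lemma e0_nonneg: "e0 \<ge> 0"
  using order.trans[OF norm_ge_zero E_bd[of 0]] T_pos by simp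

lemma Lp_C:
  assumes "Lp T p g"
  shows "Lp T p (\<lambda>t. C t (g t))"
proof -
  obtain M where "M \<ge> 0" "\<And>t. t \<in> {0..T} \<Longrightarrow> norm (C t) \<le> M"
    using rel_cont_bounded[OF C_rel] by blast
  then show ?thesis
    by (intro Lp_blinfun_family(1)[OF C_meas assms p_nonneg(1)])
qed

lemma Lp_E: "Lp T p u \<Longrightarrow> Lp T p (\<lambda>t. E t (u t))"
  by (rule Lp_blinfun_family(1)[OF E_meas _ p_nonneg(1) e0_nonneg E_bd])

lemma MR_Lp: "MR u v g \<Longrightarrow> Lp T p u"
  by (rule Lp_continuous_on[OF MR_continuous p_nonneg(1)])

definition contractive_near :: "real \<Rightarrow> real \<Rightarrow> bool" where
  "contractive_near t0 \<delta> \<longleftrightarrow> (\<forall>a b h z v g. 0 \<le> a \<and> a \<le> b \<and> b \<le> T \<and> \<bar>t0 - a\<bar> \<le> \<delta> \<and>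
    \<bar>t0 - b\<bar> \<le> \<delta> \<and> Lp T p h \<and> (AE t in lebesgue_on {0..a}. h t = 0) \<and> Sol (C t0) h z v g \<longrightarrow>
    pmass p a b (\<lambda>t. C t0 (g t) - C t (g t) - E t (z t)) \<le> ennreal (1 / 4 powr p) * pmass p a b h)"

lemma contractive_nearD:
  assumes "contractive_near t0 \<delta>" "0 \<le> a" "a \<le> b" "b \<le> T" "\<bar>t0 - a\<bar> \<le> \<delta>" "\<bar>t0 - b\<bar> \<le> \<delta>"
    "Lp T p h" "AE t in lebesgue_on {0..a}. h t = 0" "Sol (C t0) h z v g"
  shows "pmass p a b (\<lambda>t. C t0 (g t) - C t (g t) - E t (z t)) \<le> ennreal (1 / 4 powr p) * pmass p a b h"
  using assms(1)[unfolded contractive_near_def, rule_format, of a b h z v g] assms(2-) by simp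

text \<open>Relative continuity splits the freezing error into a small multiple of \<open>g\<close>,
  controlled by the a priori estimate, and a large multiple of \<open>z\<close>, controlled by
  \<open>v\<close> through \<open>pmass_primitive\<close>.\<close>

lemma perturbation_bound:
  assumes t0: "t0 \<in> {0..T}"
  shows "\<exists>\<delta>>0. contractive_near t0 \<delta>"
proof -
  obtain \<tau> K where \<tau>: "0 < \<tau>" "\<tau> \<le> T" "0 \<le> K"
    and win: "\<And>a b f u v g. 0 \<le> a \<Longrightarrow> a \<le> b \<Longrightarrow> b \<le> T \<Longrightarrow> b - a \<le> \<tau> \<Longrightarrow> Lp T p f \<Longrightarrow>
      (AE t in lebesgue_on {0..a}. f t = 0) \<Longrightarrow> Sol (C t0) f u v g \<Longrightarrow>
      pmass p a b g + pmass p a b v \<le> ennreal K * pmass p a b f"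
    using local_bound[OF C_MR[OF t0]] by metis
  \<comment> \<open>\<open>8 powr p\<close> is the loss \<open>2 powr p\<close> of the triangle
    inequality times the desired \<open>4 powr p\<close>; \<open>K + 1\<close> is positive even if
    \<open>K = 0\<close>.\<close>
  define \<kappa> where "\<kappa> = 1 / (8 powr p * (K + 1))"
  have \<kappa>: "\<kappa> > 0" "2 powr p * \<kappa> * K \<le> 1 / 4 powr p"
  proof -
    have "8 powr p = 2 powr p * 4 powr p"
      using powr_mult[of 2 4 p] by simp
    then have "2 powr p * \<kappa> * K = 1 / 4 powr p * (K / (K + 1))"
      by (simp add: \<kappa>_def)
    also have "\<dots> \<le> 1 / 4 powr p * 1"
      using \<tau>(3) by (intro mult_left_mono) auto
    finally show "2 powr p * \<kappa> * K \<le> 1 / 4 powr p" by simp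
    show "\<kappa> > 0" using \<tau>(3) by (simp add: \<kappa>_def)
  qed
  define \<epsilon> where "\<epsilon> = \<kappa> powr (1 / p)"
  have \<epsilon>: "\<epsilon> > 0" "\<epsilon> powr p = \<kappa>"
    using \<kappa>(1) p_nonneg by (auto simp: \<epsilon>_def powr_powr)
  obtain \<delta>0 \<eta> where d: "\<delta>0 > 0" "\<eta> \<ge> 0"
    "\<And>s x. s \<in> {0..T} \<Longrightarrow> \<bar>t0 - s\<bar> \<le> \<delta>0 \<Longrightarrow> norm (C t0 x - C s x) \<le> \<epsilon> * norm x + \<eta> * norm (J x)"
    using C_rel t0 \<epsilon>(1) unfolding rel_cont_def by metis
  \<comment> \<open>A window near \<open>t0\<close> has length at most \<open>2 * \<delta>\<close>.
    The bound \<open>\<tau> / 2\<close> keeps this below \<tau>, and the last bound keeps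
    \<open>(\<eta> + e0) * (2 * (b - a))\<close> below \<epsilon>.\<close>
  define \<delta> where "\<delta> = min \<delta>0 (min (\<tau> / 2) (\<epsilon> / (4 * (\<eta> + e0 + 1))))"
  have pos: "\<eta> + e0 + 1 > 0" using d(2) e0_nonneg by simp
  have \<delta>: "\<delta> > 0" "\<delta> \<le> \<delta>0" "2 * \<delta> \<le> \<tau>" "\<delta> \<le> \<epsilon> / (4 * (\<eta> + e0 + 1))"
    using d(1) \<tau>(1) \<epsilon>(1) pos by (auto simp: \<delta>_def)
  have main: "pmass p a b (\<lambda>t. C t0 (g t) - C t (g t) - E t (z t)) \<le> ennreal (1 / 4 powr p) * pmass p a b h"
    if ab: "0 \<le> a" "a \<le> b" "b \<le> T" "\<bar>t0 - a\<bar> \<le> \<delta>" "\<bar>t0 - b\<bar> \<le> \<delta>"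
      and h: "Lp T p h" "AE t in lebesgue_on {0..a}. h t = 0" and S: "Sol (C t0) h z v g" for a b h z v g
  proof -
    have MR: "MR z v g" using S by (simp add: Sol_def)
    \<comment> \<open>Causality provides the zero value at the left end that
      \<open>pmass_primitive\<close> starts from.\<close>
    have za: "z a = 0"
      using causality(1)[OF C_MR[OF t0] S ab(1) _ h(2), of a] ab by auto
    have zm: "smeas T z"
      by (rule Lp_smeas[OF MR_Lp[OF MR]])
    have ba: "b - a \<le> 2 * \<delta>" using ab by linarith
    have sub: "{a..b} \<subseteq> {0..T}" using ab by auto
    have "AE t in lebesgue_on {a..b}. z t = J (g t)"
      using MR AE_lebesgue_on_mono[OF _ sub] by (auto simp: MR_def)
    moreover have "AE t in lebesgue_on {a..b}. t \<in> {a..b}"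
      by (rule AE_lebesgue_on_space)
    ultimately have ae: "AE t in lebesgue_on {a..b}. norm (C t0 (g t) - C t (g t) - E t (z t))
        \<le> norm (\<epsilon> *\<^sub>R g t) + norm ((\<eta> + e0) *\<^sub>R z t)"
    proof eventually_elim
      case (elim t)
      have t: "t \<in> {0..T}" "\<bar>t0 - t\<bar> \<le> \<delta>0"
        using elim(2) ab \<delta>(2) by auto
      have "norm (C t0 (g t) - C t (g t) - E t (z t)) \<le> norm (C t0 (g t) - C t (g t)) + norm (E t (z t))"
        by (rule norm_triangle_ineq4)
      also have "\<dots> \<le> (\<epsilon> * norm (g t) + \<eta> * norm (J (g t))) + e0 * norm (z t)"
        by (intro add_mono d(3) t order.trans[OF norm_blinfun] mult_right_mono E_bd) auto
      also have "\<dots> = norm (\<epsilon> *\<^sub>R g t) + norm ((\<eta> + e0) *\<^sub>R z t)"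
        using elim(1) \<epsilon>(1) d(2) e0_nonneg by (simp add: distrib_right)
      finally show ?case .
    qed
    have "pmass p a b (\<lambda>t. C t0 (g t) - C t (g t) - E t (z t))
        \<le> ennreal (2 powr p) * (pmass p a b (\<lambda>t. \<epsilon> *\<^sub>R g t) + pmass p a b (\<lambda>t. (\<eta> + e0) *\<^sub>R z t))"
      by (rule pmass_bound_add[OF smeas_scaleR[OF smeas_const Sol_smeas(2)[OF S]] smeas_scaleR[OF smeas_const zm]
            ab(1,3) p_nonneg(1) ae])
    also have "pmass p a b (\<lambda>t. \<epsilon> *\<^sub>R g t) = ennreal \<kappa> * pmass p a b g"
      using pmass_scale[OF Sol_smeas(2)[OF S] ab(1,3), of p \<epsilon>] \<epsilon> by simp
    also have "pmass p a b (\<lambda>t. (\<eta> + e0) *\<^sub>R z t) \<le> ennreal \<kappa> * pmass p a b v"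
    proof -
      have "pmass p a b (\<lambda>t. (\<eta> + e0) *\<^sub>R z t) = ennreal ((\<eta> + e0) powr p) * pmass p a b z"
        using pmass_scale[OF zm ab(1,3), of p "\<eta> + e0"] d(2) e0_nonneg by simp
      also have "\<dots> \<le> ennreal ((\<eta> + e0) powr p) * (ennreal ((2 * (b - a)) powr p) * pmass p a b v)"
        by (intro mult_left_mono pmass_primitive[OF MR ab(1-3) za]) auto
      also have "\<dots> = ennreal (((\<eta> + e0) * (2 * (b - a))) powr p) * pmass p a b v"
        using ab d(2) e0_nonneg by (simp add: powr_mult ennreal_mult mult.assoc)
      also have "\<dots> \<le> ennreal (\<epsilon> powr p) * pmass p a b v"
      proof (intro mult_right_mono ennreal_leI powr_mono2)
        have "(\<eta> + e0) * (2 * (b - a)) \<le> (\<eta> + e0 + 1) * (4 * \<delta>)"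
        proof (rule mult_mono)
          show "2 * (b - a) \<le> 4 * \<delta>" using ba by simp
          show "0 \<le> \<eta> + e0 + 1" using d(2) e0_nonneg by simp
          show "0 \<le> 2 * (b - a)" using ab(2) by simp
        qed simp
        also have "\<dots> \<le> \<epsilon>"
          using \<delta>(4) pos by (simp add: field_simps)
        finally show "(\<eta> + e0) * (2 * (b - a)) \<le> \<epsilon>" .
      qed (use ab d(2) e0_nonneg p_nonneg in auto)
      finally show ?thesis unfolding \<epsilon>(2) .
    qed
    also have "ennreal (2 powr p) * (ennreal \<kappa> * pmass p a b g + ennreal \<kappa> * pmass p a b v)
        = ennreal (2 powr p * \<kappa>) * (pmass p a b g + pmass p a b v)"
      using \<kappa>(1) by (simp add: ennreal_mult distrib_left mult.assoc)
    also have "\<dots> \<le> ennreal (2 powr p * \<kappa>) * (ennreal K * pmass p a b h)"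
      by (intro mult_left_mono win[OF ab(1-3) _ h S]) (use ba \<delta>(3) in auto)
    also have "\<dots> = ennreal (2 powr p * \<kappa> * K) * pmass p a b h"
      using \<kappa>(1) \<tau>(3) by (simp add: ennreal_mult mult.assoc)
    also have "\<dots> \<le> ennreal (1 / 4 powr p) * pmass p a b h"
      by (intro mult_right_mono ennreal_leI \<kappa>(2)) auto
    finally show ?thesis
      by (simp add: mult_left_mono add_mono)
  qed
  have "contractive_near t0 \<delta>"
    unfolding contractive_near_def by (intro allI impI, elim conjE) (rule main)
  with \<delta>(1) show ?thesis by blast
qed

section \<open>Continuation of solutions and of their uniqueness\<close>

text \<open>Candidates live on all of [0, T] and only the equation is restricted to [0, b].
  Continuation then means adding a correction, with no gluing of functions at an intermediate
  time.\<close>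

definition NSol :: "real \<Rightarrow> (real \<Rightarrow> 'x) \<Rightarrow> (real \<Rightarrow> 'x) \<Rightarrow> (real \<Rightarrow> 'x) \<Rightarrow> (real \<Rightarrow> 'd) \<Rightarrow> bool" where
  "NSol b f u v g \<longleftrightarrow> MR u v g \<and> u 0 = 0 \<and> (AE t in lebesgue_on {0..b}. v t + C t (g t) + E t (u t) = f t)"

lemma NSol_extend:
  assumes t0: "t0 \<in> {0..T}" and f: "Lp T p f"
  shows "\<exists>\<delta>>0. \<forall>a b. 0 \<le> a \<and> a \<le> b \<and> b \<le> T \<and> \<bar>t0 - a\<bar> \<le> \<delta> \<and> \<bar>t0 - b\<bar> \<le> \<delta> \<longrightarrow>
    (\<exists>u v g. NSol a f u v g) \<longrightarrow> (\<exists>u v g. NSol b f u v g)"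
proof -
  obtain \<delta> where \<delta>: "\<delta> > 0" and near: "contractive_near t0 \<delta>"
    using perturbation_bound[OF t0] by blast
  note pert = contractive_nearD[OF near]
  have ext: "\<exists>u v g. NSol b f u v g"
    if ab: "0 \<le> a" "a \<le> b" "b \<le> T" "\<bar>t0 - a\<bar> \<le> \<delta>" "\<bar>t0 - b\<bar> \<le> \<delta>" and "NSol a f u v g" for a b u v g
  proof -
    have MR: "MR u v g" "u 0 = 0" and eq: "AE t in lebesgue_on {0..a}. v t + C t (g t) + E t (u t) = f t"
      using \<open>NSol a f u v g\<close> by (auto simp: NSol_def)
    \<comment> \<open>The defect of \<open>u\<close> in the equation, which the correction has to
      remove on [a, b].\<close>
    define r where "r t = f t - (v t + C t (g t) + E t (u t))" for t
    have r: "Lp T p r"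
      unfolding r_def using MR(1)
      by (intro Lp_diff Lp_add f Lp_C Lp_E MR_Lp[OF MR(1)] p_nonneg(1)) (auto simp: MR_def)
    define cut where "cut h t = (if t \<in> {a..b} then h t else 0)" for h :: "real \<Rightarrow> 'x" and t
    have cut: "Lp T p (cut h)" if "Lp T p h" for h
      unfolding cut_def using that by (intro Lp_restrict p_nonneg) auto
    have cut0: "AE t in lebesgue_on {0..a}. cut h t = 0" for h
      using AE_lebesgue_on_neq[where a = 0 and b = a and c = a] unfolding AE_lebesgue_on_iff
      by eventually_elim (auto simp: cut_def)
    have "\<forall>h. \<exists>z w k. Lp T p h \<longrightarrow> Sol (C t0) (cut h) z w k"
      using maxreg_exists[OF C_MR[OF t0] cut] by blast
    then obtain Z W K where S: "\<And>h. Lp T p h \<Longrightarrow> Sol (C t0) (cut h) (Z h) (W h) (K h)"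
      by metis
    \<comment> \<open>Substituting \<open>W h = h - C t0 (K h)\<close> into the equation for
      \<open>u + Z h\<close> on [a, b] turns it into \<open>h = F h\<close>.\<close>
    define F where "F h = cut (\<lambda>t. r t + (C t0 (K h t) - C t (K h t) - E t (Z h t)))" for h
    have "\<exists>h. Lp T p h \<and> (AE t in lebesgue_on {0..T}. F h t = h t)"
    proof (rule Lp_fixed_point)
      show "1 / 4 powr p * 4 powr p \<le> 1" by simp
      fix h :: "real \<Rightarrow> 'x" assume h: "Lp T p h"
      note S = S[OF h]
      have "MR (Z h) (W h) (K h)" using S by (simp add: Sol_def)
      then show "Lp T p (F h)"
        unfolding F_def
        by (intro cut Lp_add r Lp_diff Lp_C Lp_E Lp_blinfun p_nonneg(1) Sol_smeas(4)[OF S] MR_Lp)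
    next
      fix h h' :: "real \<Rightarrow> 'x" assume h: "Lp T p h" and h': "Lp T p h'"
      \<comment> \<open>\<open>Z\<close>, \<open>W\<close> and \<open>K\<close> are chosen
        separately for each \<open>h\<close> and need not be linear, but the difference of two
        chosen solutions solves the equation for the difference of the data.\<close>
      have "Sol (C t0) (\<lambda>t. cut h t - cut h' t) (\<lambda>t. Z h t - Z h' t) (\<lambda>t. W h t - W h' t) (\<lambda>t. K h t - K h' t)"
        by (rule Sol_diff[OF S[OF h] S[OF h']])
      moreover have "AE t in lebesgue_on {0..a}. cut h t - cut h' t = 0"
        using cut0[of h] cut0[of h'] by eventually_elim simp
      moreover have "Lp T p (\<lambda>t. cut h t - cut h' t)"
        by (intro Lp_diff cut h h' p_nonneg)
      ultimately have le: "pmass p a b (\<lambda>t. C t0 (K h t - K h' t) - C t (K h t - K h' t) - E t (Z h t - Z h' t))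
          \<le> ennreal (1 / 4 powr p) * pmass p a b (\<lambda>t. cut h t - cut h' t)"
        by (intro pert ab)
      have "pmass p 0 T (\<lambda>t. F h t - F h' t) = pmass p 0 T
          (\<lambda>t. if t \<in> {a..b} then C t0 (K h t - K h' t) - C t (K h t - K h' t) - E t (Z h t - Z h' t) else 0)"
        by (intro pmass_cong) (auto simp: F_def cut_def blinfun.diff_right algebra_simps)
      also have "\<dots> = pmass p a b (\<lambda>t. C t0 (K h t - K h' t) - C t (K h t - K h' t) - E t (Z h t - Z h' t))"
        using ab by (intro pmass_restrict) auto
      also note le
      also have "pmass p a b (\<lambda>t. cut h t - cut h' t) = pmass p a b (\<lambda>t. h t - h' t)"
        by (intro pmass_cong) (auto simp: cut_def)
      also have "\<dots> \<le> pmass p 0 T (\<lambda>t. h t - h' t)"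
        using ab by (intro pmass_mono_interval) auto
      finally show "pmass p 0 T (\<lambda>t. F h t - F h' t) \<le> ennreal (1 / 4 powr p) * pmass p 0 T (\<lambda>t. h t - h' t)"
        by (simp add: mult_left_mono)
    qed (use p_nonneg in auto)
    then obtain h where h: "Lp T p h" "AE t in lebesgue_on {0..T}. F h t = h t" by blast
    note Sh = S[OF h(1)]
    have zero: "AE t in lebesgue_on {0..a}. W h t = 0" "AE t in lebesgue_on {0..a}. K h t = 0"
      "\<And>t. t \<in> {0..a} \<Longrightarrow> Z h t = 0"
      using causality[OF C_MR[OF t0] Sh _ _ cut0] ab by auto
    have MRz: "MR (Z h) (W h) (K h)" "Z h 0 = 0"
      using Sh by (auto simp: Sol_def)
    let ?u = "\<lambda>t. u t + Z h t" and ?v = "\<lambda>t. v t + W h t" and ?g = "\<lambda>t. g t + K h t"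
    have "AE t in lebesgue_on {0..a}. Z h t = 0"
      by (rule AE_lebesgue_on_space[OF zero(3)])
    with eq zero(1,2) have "AE t in lebesgue_on {0..a}. ?v t + C t (?g t) + E t (?u t) = f t"
      by eventually_elim simp
    moreover have "AE t in lebesgue_on {a..b}. ?v t + C t (?g t) + E t (?u t) = f t"
    proof -
      have sub: "{a..b} \<subseteq> {0..T}" using ab by auto
      have "AE t in lebesgue_on {0..T}. W h t + C t0 (K h t) = cut h t"
        using Sh by (simp add: Sol_def)
      then have "AE t in lebesgue_on {a..b}. W h t + C t0 (K h t) = cut h t"
        by (rule AE_lebesgue_on_mono[OF _ sub])
      moreover have "AE t in lebesgue_on {a..b}. F h t = h t"
        by (rule AE_lebesgue_on_mono[OF h(2) sub])
      moreover have "AE t in lebesgue_on {a..b}. t \<in> {a..b}"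
        by (rule AE_lebesgue_on_space)
      ultimately show ?thesis
      proof eventually_elim
        case (elim t)
        have "h t = f t - (v t + C t (g t) + E t (u t)) + (C t0 (K h t) - C t (K h t) - E t (Z h t))"
          using elim(2,3) by (simp add: F_def cut_def r_def)
        moreover have "W h t = h t - C t0 (K h t)"
          using elim(1,3) by (simp add: cut_def eq_diff_eq)
        ultimately have "W h t = f t - (v t + C t (g t) + E t (u t)) - C t (K h t) - E t (Z h t)"
          by simp
        then show ?case
          by (simp add: blinfun.add_right)
      qed
    qed
    ultimately have "AE t in lebesgue_on {0..b}. ?v t + C t (?g t) + E t (?u t) = f t"
      by (rule AE_lebesgue_on_combine)
    then have "NSol b f ?u ?v ?g"
      unfolding NSol_def using MR_add[OF MR(1) MRz(1)] MR(2) MRz(2) by simp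
    then show ?thesis by blast
  qed
  show ?thesis
  proof (intro exI[of _ \<delta>] conjI[OF \<delta>] allI impI)
    fix a b assume "0 \<le> a \<and> a \<le> b \<and> b \<le> T \<and> \<bar>t0 - a\<bar> \<le> \<delta> \<and> \<bar>t0 - b\<bar> \<le> \<delta>" "\<exists>u v g. NSol a f u v g"
    then show "\<exists>u v g. NSol b f u v g"
      by (elim conjE exE) (rule ext)
  qed
qed

text \<open>A homogeneous solution solves the equation frozen at \<open>t0\<close> with right-hand
  side \<open>v t + C t0 (g t)\<close>, and on [a, b] this is the freezing error itself. The
  contraction bounds it by a fraction of itself.\<close>

lemma NSol_unique_extend:
  assumes t0: "t0 \<in> {0..T}" and N: "NSol T (\<lambda>_. 0) u v g"
  shows "\<exists>\<delta>>0. \<forall>a b. 0 \<le> a \<and> a \<le> b \<and> b \<le> T \<and> \<bar>t0 - a\<bar> \<le> \<delta> \<and> \<bar>t0 - b\<bar> \<le> \<delta> \<longrightarrow>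
    (\<forall>t\<in>{0..a}. u t = 0) \<longrightarrow> (\<forall>t\<in>{0..b}. u t = 0)"
proof -
  obtain \<delta> where \<delta>: "\<delta> > 0" and near: "contractive_near t0 \<delta>"
    using perturbation_bound[OF t0] by blast
  note pert = contractive_nearD[OF near]
  have MR: "MR u v g" "u 0 = 0" and eq: "AE t in lebesgue_on {0..T}. v t + C t (g t) + E t (u t) = 0"
    using N by (auto simp: NSol_def)
  define h where "h t = v t + C t0 (g t)" for t
  have S: "Sol (C t0) h u v g"
    using MR by (simp add: Sol_def h_def)
  have h: "Lp T p h"
    unfolding h_def by (intro Lp_add Lp_blinfun Sol_smeas[OF S] p_nonneg)
  have ext: "\<forall>t\<in>{0..b}. u t = 0"
    if ab: "0 \<le> a" "a \<le> b" "b \<le> T" "\<bar>t0 - a\<bar> \<le> \<delta>" "\<bar>t0 - b\<bar> \<le> \<delta>" and u: "\<forall>t\<in>{0..a}. u t = 0" for a b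
  proof -
    have sub: "{0..a} \<subseteq> {0..T}" "{a..b} \<subseteq> {0..T}" using ab by auto
    have u0: "AE t in lebesgue_on {0..a}. u t = 0"
      using u by (intro AE_lebesgue_on_space) auto
    have "AE t in lebesgue_on {0..a}. u t = J (g t)"
      using MR(1) AE_lebesgue_on_mono[OF _ sub(1)] by (auto simp: MR_def)
    with u0 have g0: "AE t in lebesgue_on {0..a}. g t = 0"
    proof eventually_elim
      case (elim t)
      then have "J (g t) = J 0" by simp
      then show ?case using injD[OF J_inj] by blast
    qed
    have h0: "AE t in lebesgue_on {0..a}. h t = 0"
      using AE_lebesgue_on_mono[OF eq sub(1)] g0 u0 by eventually_elim (simp add: h_def)
    have "AE t in lebesgue_on {a..b}. norm (C t0 (g t) - C t (g t) - E t (u t)) = norm (h t)"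
      using AE_lebesgue_on_mono[OF eq sub(2)]
    proof eventually_elim
      case (elim t)
      have "C t0 (g t) - C t (g t) - E t (u t) = h t - (v t + C t (g t) + E t (u t))"
        by (simp add: h_def)
      then show ?case using elim by simp
    qed
    then have "pmass p a b h = pmass p a b (\<lambda>t. C t0 (g t) - C t (g t) - E t (u t))"
      by (rule pmass_cong_AE[symmetric])
    also have "\<dots> \<le> ennreal (1 / 4 powr p) * pmass p a b h"
      by (rule pert[OF ab h h0 S])
    finally have le: "pmass p a b h \<le> ennreal (1 / 4 powr p) * pmass p a b h" .
    have fin: "pmass p a b h < \<infinity>"
      using pmass_mono_interval[OF sub(2), of p h] h by (auto simp: Lp_iff)
    define m where "m = enn2real (pmass p a b h)"
    have m: "pmass p a b h = ennreal m" "m \<ge> 0"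
      using fin by (auto simp: m_def)
    have "m \<le> 1 / 4 powr p * m"
      using le m(2) unfolding m(1) by (simp add: ennreal_mult[symmetric] ennreal_le_iff)
    moreover have "1 / 4 powr p \<le> (1/4::real)"
      using powr_mono[of 1 p "4::real"] p_nonneg by (simp add: field_simps)
    then have "1 / 4 powr p * m \<le> 1/4 * m"
      using m(2) by (rule mult_right_mono)
    ultimately have "m = 0" using m(2) by linarith
    then have "pmass p a b h = 0" using m by simp
    then have "AE t in lebesgue_on {a..b}. h t = 0"
      using pmass_eq_0_iff[OF Lp_smeas[OF h] ab(1,3)] by simp
    from AE_lebesgue_on_combine[OF h0 this] have "AE t in lebesgue_on {0..b}. h t = 0" .
    then show ?thesis
      using causality(1)[OF C_MR[OF t0] S _ ab(3)] ab by auto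
  qed
  show ?thesis
  proof (intro exI[of _ \<delta>] conjI[OF \<delta>] allI impI)
    fix a b assume "0 \<le> a \<and> a \<le> b \<and> b \<le> T \<and> \<bar>t0 - a\<bar> \<le> \<delta> \<and> \<bar>t0 - b\<bar> \<le> \<delta>" "\<forall>t\<in>{0..a}. u t = 0"
    then show "\<forall>t\<in>{0..b}. u t = 0"
      by (elim conjE) (rule ext)
  qed
qed

text \<open>The passage from \<open>P a\<close> to \<open>P b\<close> composes over adjacent
  intervals and is available on short intervals around every point, so bisection yields it for
  [0, T].\<close>

lemma interval_propagation:
  assumes "P 0"
    and step: "\<And>t0. t0 \<in> {0..T} \<Longrightarrow> \<exists>\<delta>>0. \<forall>a b. 0 \<le> a \<and> a \<le> b \<and> b \<le> T \<and> \<bar>t0 - a\<bar> \<le> \<delta> \<and> \<bar>t0 - b\<bar> \<le> \<delta> \<longrightarrow> P a \<longrightarrow> P b"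
  shows "P T"
proof -
  have "0 \<le> (0::real) \<and> T \<le> T \<longrightarrow> P 0 \<longrightarrow> P T"
  proof (rule Bolzano[where P = "\<lambda>a b. 0 \<le> a \<and> b \<le> T \<longrightarrow> P a \<longrightarrow> P b"])
    show "0 \<le> T" using T_pos by simp
  next
    fix t0 assume "0 \<le> t0" "t0 \<le> T"
    then obtain \<delta> where \<delta>: "\<delta> > 0" "\<And>a b. 0 \<le> a \<Longrightarrow> a \<le> b \<Longrightarrow> b \<le> T \<Longrightarrow> \<bar>t0 - a\<bar> \<le> \<delta> \<Longrightarrow> \<bar>t0 - b\<bar> \<le> \<delta> \<Longrightarrow> P a \<Longrightarrow> P b"
      using step[of t0] by auto
    have "P b" if "a \<le> t0 \<and> t0 \<le> b \<and> b - a < \<delta>" "0 \<le> a \<and> b \<le> T" "P a" for a b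
      using that by (intro \<delta>(2)[of a b]) auto
    then show "\<exists>d>0. \<forall>a b. a \<le> t0 \<and> t0 \<le> b \<and> b - a < d \<longrightarrow> 0 \<le> a \<and> b \<le> T \<longrightarrow> P a \<longrightarrow> P b"
      using \<delta>(1) by blast
  qed auto
  with assms(1) show ?thesis by simp
qed

lemma NSol_exists:
  assumes f: "Lp T p f"
  shows "\<exists>u v g. NSol T f u v g"
proof (rule interval_propagation[where P = "\<lambda>b. \<exists>u v g. NSol b f u v g"])
  have "NSol 0 f (\<lambda>_. 0) (\<lambda>_. 0) (\<lambda>_. 0)"
    unfolding NSol_def by (intro conjI MR_zero AE_lebesgue_on_point) simp
  then show "\<exists>u v g. NSol 0 f u v g" by blast
qed (rule NSol_extend[OF _ f])

lemma NSol_unique: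
  assumes "NSol T f u v g" "NSol T f u' v' g'" "t \<in> {0..T}"
  shows "u t = u' t"
proof -
  have eq: "AE t in lebesgue_on {0..T}. v t + C t (g t) + E t (u t) = f t"
    "AE t in lebesgue_on {0..T}. v' t + C t (g' t) + E t (u' t) = f t"
    using assms(1,2) by (auto simp: NSol_def)
  then have "AE t in lebesgue_on {0..T}. (v t - v' t) + C t (g t - g' t) + E t (u t - u' t) = 0"
  proof eventually_elim
    case (elim t)
    have "(v t - v' t) + C t (g t - g' t) + E t (u t - u' t)
        = (v t + C t (g t) + E t (u t)) - (v' t + C t (g' t) + E t (u' t))"
      by (simp add: blinfun.diff_right)
    then show ?case using elim by simp
  qed
  then have N: "NSol T (\<lambda>_. 0) (\<lambda>t. u t - u' t) (\<lambda>t. v t - v' t) (\<lambda>t. g t - g' t)"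
    using assms MR_diff by (auto simp: NSol_def)
  have "\<forall>t\<in>{0..T}. u t - u' t = 0"
  proof (rule interval_propagation[where P = "\<lambda>b. \<forall>t\<in>{0..b}. u t - u' t = 0"])
    show "\<forall>t\<in>{0..0}. u t - u' t = 0" using N by (auto simp: NSol_def)
  qed (rule NSol_unique_extend[OF _ N])
  then show ?thesis using assms(3) by simp
qed

end

section \<open>Strongly differentiable operator families\<close>

text \<open>Take \<open>k\<close> of norm \<open>r\<close> at which \<open>L\<close> reaches half of
  its norm. As \<open>2 *\<^sub>R L k\<close> is the difference of the values at
  \<open>x + k\<close> and \<open>x - k\<close>, one of these values is at least as large as
  \<open>L k\<close>.\<close>

lemma blinfun_large_value_near:
  fixes L :: "'a::real_normed_vector \<Rightarrow>\<^sub>L 'b::real_normed_vector"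
  assumes "r > 0"
  shows "\<exists>y. norm (y - x) \<le> r \<and> r * norm L / 2 \<le> norm (L y)"
proof (cases "norm L = 0")
  case True
  then show ?thesis using assms by (intro exI[of _ x]) auto
next
  case False
  have "\<exists>z. norm L / 2 * norm z < norm (L z)"
  proof (rule ccontr)
    assume "\<not> ?thesis"
    then have "norm L \<le> norm L / 2"
      by (intro norm_blinfun_bound) (auto simp: not_less)
    with False show False by simp
  qed
  then obtain z where z: "norm L / 2 * norm z < norm (L z)" by blast
  then have "z \<noteq> 0" by auto
  define k where "k = (r / norm z) *\<^sub>R z"
  have k: "norm k = r" using \<open>z \<noteq> 0\<close> assms by (simp add: k_def)
  have "r / norm z * (norm L / 2 * norm z) \<le> r / norm z * norm (L z)"
    using z assms by (intro mult_left_mono) auto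
  then have Lk: "r * norm L / 2 \<le> norm (L k)"
    using assms \<open>z \<noteq> 0\<close> by (simp add: k_def blinfun.scaleR_right)
  have "2 *\<^sub>R L k = L (x + k) - L (x - k)"
    by (simp add: blinfun.add_right blinfun.diff_right scaleR_2)
  then have "2 * norm (L k) \<le> norm (L (x + k)) + norm (L (x - k))"
    by (metis norm_scaleR norm_triangle_ineq4 abs_numeral)
  then have "norm (L k) \<le> norm (L (x + k)) \<or> norm (L k) \<le> norm (L (x - k))"
    by linarith
  then show ?thesis
  proof
    assume "norm (L k) \<le> norm (L (x + k))"
    then show ?thesis using Lk k by (intro exI[of _ "x + k"]) auto
  next
    assume "norm (L k) \<le> norm (L (x - k))"
    then show ?thesis using Lk k by (intro exI[of _ "x - k"]) auto
  qed
qed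

text \<open>Sokal's gliding hump proof.\<close>

lemma uniform_boundedness:
  fixes L :: "'i \<Rightarrow> ('a::banach \<Rightarrow>\<^sub>L 'b::real_normed_vector)"
  assumes bdd: "\<And>x. \<exists>c. \<forall>i\<in>I. norm (L i x) \<le> c"
  shows "\<exists>c. \<forall>i\<in>I. norm (L i) \<le> c"
proof (rule ccontr)
  assume "\<not> ?thesis"
  \<comment> \<open>Steps of length \<open>1 / 8^n\<close> against norms above \<open>16^n\<close>
    leave a growth of order \<open>2^n\<close>.\<close>
  then have "\<forall>n::nat. \<exists>i\<in>I. 16^n < norm (L i)"
    by (meson not_le)
  then obtain i where i: "\<And>n. i n \<in> I" "\<And>n. 16^n < norm (L (i n))"
    by metis
  have "\<exists>x. \<forall>n. True \<and> (norm (x (Suc n) - x n) \<le> 1 / 8^n \<and> 1 / 8^n * norm (L (i n)) / 2 \<le> norm (L (i n) (x (Suc n))))"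
    by (rule dependent_nat_choice) (use blinfun_large_value_near[of "1 / 8^_"] in auto)
  then obtain x where x: "\<And>n. norm (x (Suc n) - x n) \<le> 1 / 8^n"
    "\<And>n. 1 / 8^n * norm (L (i n)) / 2 \<le> norm (L (i n) (x (Suc n)))"
    by blast
  have "norm (x (Suc n) - x n) \<le> 1 / 2^n" for n
    by (rule order.trans[OF x(1)]) (simp add: field_simps power_mono)
  then obtain l where l: "x \<longlonglongrightarrow> l"
    using geometric_Cauchy_limit[of x 1] by auto
  \<comment> \<open>All later steps together cost at most \<open>1 / 8^n / 4\<close> times the norm,
    half of the \<open>1 / 8^n / 2\<close> secured at step \<open>n\<close>.\<close>
  have tail: "norm (l - x (Suc n)) \<le> 1 / 8^n / 4" for n
  proof -
    have "norm (x (Suc k + Suc n) - x (k + Suc n)) \<le> 1 / 8^Suc n / 2^k" for k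
    proof -
      have "norm (x (Suc (k + Suc n)) - x (k + Suc n)) \<le> 1 / 8^(k + Suc n)"
        by (rule x(1))
      also have "\<dots> = 1 / 8^Suc n / 8^k"
        by (simp add: power_add)
      also have "\<dots> \<le> 1 / 8^Suc n / 2^k"
        by (intro divide_left_mono power_mono mult_pos_pos) auto
      finally show ?thesis by simp
    qed
    then obtain l' where l': "(\<lambda>k. x (k + Suc n)) \<longlonglongrightarrow> l'" "norm (l' - x (0 + Suc n)) \<le> 2 * (1 / 8^Suc n) / 2^0"
      using geometric_Cauchy_limit[of "\<lambda>k. x (k + Suc n)" "1 / 8^Suc n"] by blast
    have "l' = l"
      using LIMSEQ_unique[OF l'(1) LIMSEQ_ignore_initial_segment[OF l]] .
    then show ?thesis
      using l'(2) by simp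
  qed
  obtain c where c: "\<And>j. j \<in> I \<Longrightarrow> norm (L j l) \<le> c"
    using bdd[of l] by blast
  have "2^n / 4 \<le> c" for n :: nat
  proof -
    let ?N = "norm (L (i n))"
    have "norm (L (i n) (x (Suc n))) \<le> norm (L (i n) l) + norm (L (i n) (x (Suc n) - l))"
      by (metis blinfun.diff_right add.commute norm_triangle_sub)
    also have "norm (L (i n) (x (Suc n) - l)) \<le> ?N * (1 / 8^n / 4)"
      using tail[of n] by (intro order.trans[OF norm_blinfun] mult_left_mono) (auto simp: norm_minus_commute)
    finally have "1 / 8^n * ?N / 4 \<le> norm (L (i n) l)"
      using x(2)[of n] by (simp add: field_simps)
    moreover have "2^n / 4 \<le> 1 / 8^n * ?N / 4"
    proof -
      have "(2::real)^n * 8^n = 16^n" by (simp add: power_mult_distrib[symmetric])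
      then show ?thesis using i(2)[of n] by (simp add: field_simps)
    qed
    ultimately show ?thesis using c[OF i(1)[of n]] by linarith
  qed
  moreover obtain n :: nat where "4 * c < 2^n"
    using real_arch_pow[of 2 "4 * c"] by auto
  ultimately show False
    by (metis linorder_not_le mult.commute pos_divide_le_eq zero_less_numeral)
qed

section \<open>Families with a bounded strong derivative\<close>

lemma has_vector_derivative_iff_quotient:
  "(f has_vector_derivative D) (at t within S) \<longleftrightarrow> ((\<lambda>s. (f s - f t) /\<^sub>R (s - t)) \<longlongrightarrow> D) (at t within S)"
proof -
  have "norm (f s - f t - (s - t) *\<^sub>R D) / norm (s - t) = norm ((f s - f t) /\<^sub>R (s - t) - D)" if "s \<noteq> t" for s
  proof -
    have "f s - f t - (s - t) *\<^sub>R D = (s - t) *\<^sub>R ((f s - f t) /\<^sub>R (s - t) - D)"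
      using that by (simp add: scaleR_diff_right)
    then show ?thesis using that by simp
  qed
  then have "\<forall>\<^sub>F s in at t within S. norm (f s - f t - (s - t) *\<^sub>R D) / norm (s - t) = norm ((f s - f t) /\<^sub>R (s - t) - D)"
    unfolding eventually_at_filter by simp
  from tendsto_cong[OF this] show ?thesis
    unfolding has_vector_derivative_def has_derivative_iff_norm
    by (simp add: bounded_linear_scaleR_left LIM_zero_iff tendsto_norm_zero_iff)
qed

text \<open>\<open>strongly_C1\<close> provides a derivative for each vector separately. Here the
  derivatives are gathered into bounded operators with a common bound \<open>c\<close>, continuous
  in the strong sense only.\<close>

definition C1_family :: "real \<Rightarrow> (real \<Rightarrow> ('a::banach \<Rightarrow>\<^sub>L 'b::banach)) \<Rightarrow> (real \<Rightarrow> ('a \<Rightarrow>\<^sub>L 'b)) \<Rightarrow> real \<Rightarrow> bool" where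
  "C1_family T B B' c \<longleftrightarrow> (\<forall>t\<in>{0..T}. norm (B' t) \<le> c) \<and> (\<forall>x. continuous_on {0..T} (\<lambda>t. B' t x)) \<and>
    (\<forall>x. \<forall>t\<in>{0..T}. ((\<lambda>s. B s x) has_vector_derivative B' t x) (at t within {0..T}))"

lemma C1_family_integral:
  assumes "C1_family T B B' c" "0 \<le> s" "s \<le> t" "t \<le> T"
  shows "((\<lambda>r. B' r x) has_integral (B t x - B s x)) {s..t}"
proof (rule fundamental_theorem_of_calculus[OF assms(3)])
  fix r assume "r \<in> {s..t}"
  then have "((\<lambda>s. B s x) has_vector_derivative B' r x) (at r within {0..T})"
    using assms by (auto simp: C1_family_def)
  then show "((\<lambda>s. B s x) has_vector_derivative B' r x) (at r within {s..t})"
    by (rule has_vector_derivative_within_subset) (use assms in auto)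
qed

lemma C1_family_c: "C1_family T B B' c \<Longrightarrow> T \<ge> 0 \<Longrightarrow> c \<ge> 0"
  unfolding C1_family_def by (metis atLeastAtMost_iff norm_ge_zero order.refl order.trans)

text \<open>The integral formula holds vector by vector, but its bound \<open>c * norm x\<close> is
  uniform; strong differentiability thus gives Lipschitz continuity in operator norm.\<close>

lemma C1_family_Lipschitz:
  assumes F: "C1_family T B B' c" and st: "s \<in> {0..T}" "t \<in> {0..T}"
  shows "norm (B t - B s) \<le> c * \<bar>t - s\<bar>"
proof -
  have *: "norm (B t - B s) \<le> c * (t - s)" if "0 \<le> s" "s \<le> t" "t \<le> T" for s t
  proof (rule norm_blinfun_bound)
    show "0 \<le> c * (t - s)" using C1_family_c[OF F] that by auto
    fix x
    have I: "((\<lambda>r. B' r x) has_integral (B t x - B s x)) {s..t}"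
      by (rule C1_family_integral[OF F that])
    have bd: "norm (B' r x) \<le> c * norm x" if "r \<in> {s..t}" for r
      using F that \<open>0 \<le> s\<close> \<open>t \<le> T\<close> by (intro order.trans[OF norm_blinfun] mult_right_mono) (auto simp: C1_family_def)
    have "norm (B t x - B s x) \<le> (c * norm x) * (t - s)"
      using has_integral_bound_real[of "c * norm x" "{}" "\<lambda>r. B' r x" "B t x - B s x" s t]
        I bd C1_family_c[OF F] that by auto
    then show "norm ((B t - B s) x) \<le> c * (t - s) * norm x"
      by (simp add: blinfun.diff_left mult_ac)
  qed
  show ?thesis
  proof (cases "s \<le> t")
    case True
    then show ?thesis using *[of s t] st by auto
  next
    case False
    then show ?thesis using *[of t s] st by (auto simp: norm_minus_commute)
  qed
qed

lemma continuous_on_blinfun_family: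
  fixes L :: "real \<Rightarrow> ('a::real_normed_vector \<Rightarrow>\<^sub>L 'b::real_normed_vector)"
  assumes L: "\<And>x. continuous_on S (\<lambda>t. L t x)" and M: "\<And>t. t \<in> S \<Longrightarrow> norm (L t) \<le> M"
    and f: "continuous_on S f"
  shows "continuous_on S (\<lambda>t. L t (f t))"
  unfolding continuous_on_def
proof
  fix t assume t: "t \<in> S"
  show "((\<lambda>s. L s (f s)) \<longlongrightarrow> L t (f t)) (at t within S)"
  proof (rule LIM_zero_cancel, rule Lim_null_comparison)
    show "\<forall>\<^sub>F s in at t within S. norm (L s (f s) - L t (f t)) \<le> M * norm (f s - f t) + norm (L s (f t) - L t (f t))"
      unfolding eventually_at_filter
    proof (intro always_eventually allI impI)
      fix s assume s: "s \<in> S"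
      have "norm (L s (f s) - L t (f t)) \<le> norm (L s (f s - f t)) + norm (L s (f t) - L t (f t))"
        by (metis (no_types) blinfun.diff_right diff_add_cancel add_diff_eq norm_triangle_ineq)
      also have "norm (L s (f s - f t)) \<le> M * norm (f s - f t)"
        using M[OF s] by (intro order.trans[OF norm_blinfun] mult_right_mono) auto
      finally show "norm (L s (f s) - L t (f t)) \<le> M * norm (f s - f t) + norm (L s (f t) - L t (f t))"
        by simp
    qed
    have "((\<lambda>s. M * norm (f s - f t) + norm (L s (f t) - L t (f t))) \<longlongrightarrow>
        M * norm (f t - f t) + norm (L t (f t) - L t (f t))) (at t within S)"
      using f L[of "f t"] t
      by (intro tendsto_add tendsto_mult tendsto_norm tendsto_diff tendsto_const) (auto simp: continuous_on_def)
    then show "((\<lambda>s. M * norm (f s - f t) + norm (L s (f t) - L t (f t))) \<longlongrightarrow> 0) (at t within S)"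
      by simp
  qed
qed

lemma C1_family_bounded:
  assumes F: "C1_family T B B' c" and t: "t \<in> {0..T}"
  shows "norm (B t) \<le> norm (B 0) + c * T"
proof -
  have "norm (B t - B 0) \<le> c * \<bar>t - 0\<bar>"
    using t by (intro C1_family_Lipschitz[OF F]) auto
  also have "\<dots> \<le> c * T"
    using t C1_family_c[OF F] by (intro mult_left_mono) auto
  finally show ?thesis
    using norm_triangle_sub[of "B t" "B 0"] by linarith
qed

lemma C1_family_continuous:
  assumes F: "C1_family T B B' c" and u: "continuous_on {0..T} u"
  shows "continuous_on {0..T} (\<lambda>t. B' t (u t))" "continuous_on {0..T} (\<lambda>t. B t (u t))"
proof -
  show "continuous_on {0..T} (\<lambda>t. B' t (u t))"
    using F by (intro continuous_on_blinfun_family[OF _ _ u]) (auto simp: C1_family_def)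
  have B: "continuous_on {0..T} (\<lambda>t. B t x)" for x
    unfolding continuous_on_eq_continuous_within
  proof
    fix t assume "t \<in> {0..T}"
    then have "((\<lambda>t. B t x) has_vector_derivative B' t x) (at t within {0..T})"
      using F by (auto simp: C1_family_def)
    then show "continuous (at t within {0..T}) (\<lambda>t. B t x)"
      by (rule has_vector_derivative_continuous)
  qed
  show "continuous_on {0..T} (\<lambda>t. B t (u t))"
    by (rule continuous_on_blinfun_family[OF B C1_family_bounded[OF F] u])
qed

text \<open>For fixed \<open>x\<close> the difference quotients are bounded, as the continuous
  derivative is. Uniform boundedness makes the bound proportional to \<open>norm x\<close>, and it
  passes to the limit.\<close>

lemma strongly_C1_family:
  fixes B :: "real \<Rightarrow> ('x::banach \<Rightarrow>\<^sub>L 'x)"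
  assumes T: "T > 0" and B: "strongly_C1 T B"
  shows "\<exists>B' c. C1_family T B B' c"
proof -
  obtain b where b: "\<And>x. continuous_on {0..T} (b x)"
    "\<And>x t. t \<in> {0..T} \<Longrightarrow> ((\<lambda>s. B s x) has_vector_derivative b x t) (at t within {0..T})"
    using B unfolding strongly_C1_def by metis
  \<comment> \<open>Indexing by pairs of times yields one constant for all difference quotients,
    hence for the derivatives at all times.\<close>
  define Q where "Q = (\<lambda>(s, t). (1 / (t - s)) *\<^sub>R (B t - B s))"
  have "\<exists>c. \<forall>i\<in>{(s, t). s \<in> {0..T} \<and> t \<in> {0..T} \<and> s < t}. norm (Q i x) \<le> c" for x
  proof -
    have "compact (b x ` {0..T})"
      using b(1) by (intro compact_continuous_image) auto
    then obtain M where M: "\<And>t. t \<in> {0..T} \<Longrightarrow> norm (b x t) \<le> M"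
      using compact_imp_bounded by (fastforce simp: bounded_iff)
    have "norm (Q (s, t) x) \<le> M" if st: "s \<in> {0..T}" "t \<in> {0..T}" "s < t" for s t
    proof -
      have "(b x has_integral (B t x - B s x)) {s..t}"
      proof (rule fundamental_theorem_of_calculus)
        fix r assume "r \<in> {s..t}"
        then have "r \<in> {0..T}" "{s..t} \<subseteq> {0..T}" using st by auto
        then show "((\<lambda>s. B s x) has_vector_derivative b x r) (at r within {s..t})"
          using b(2) has_vector_derivative_within_subset by blast
      qed (use st in auto)
      moreover have "M \<ge> 0" using order.trans[OF norm_ge_zero M[OF st(1)]] .
      ultimately have "norm (B t x - B s x) \<le> M * (t - s)"
        using has_integral_bound_real[of M "{}" "b x" "B t x - B s x" s t] M st by auto
      moreover have "Q (s, t) x = (1 / (t - s)) *\<^sub>R (B t x - B s x)"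
        by (simp add: Q_def blinfun.scaleR_left blinfun.diff_left)
      ultimately show ?thesis
        using st by (simp only: norm_scaleR) (simp add: field_simps)
    qed
    then show ?thesis by (intro exI[of _ M]) auto
  qed
  from uniform_boundedness[OF this]
  obtain c where c: "\<And>s t. s \<in> {0..T} \<Longrightarrow> t \<in> {0..T} \<Longrightarrow> s < t \<Longrightarrow> norm (Q (s, t)) \<le> c"
    by blast
  have Lip: "norm (B t x - B s x) \<le> c * \<bar>t - s\<bar> * norm x" if "s \<in> {0..T}" "t \<in> {0..T}" "s \<noteq> t" for s t x
  proof -
    have *: "norm (B t x - B s x) \<le> c * (t - s) * norm x" if "s \<in> {0..T}" "t \<in> {0..T}" "s < t" for s t
    proof -
      have "B t x - B s x = (t - s) *\<^sub>R Q (s, t) x"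
        using that by (simp add: Q_def blinfun.scaleR_left blinfun.diff_left)
      then have "norm (B t x - B s x) = (t - s) * norm (Q (s, t) x)"
        using that by simp
      also have "\<dots> \<le> (t - s) * (c * norm x)"
        using that c[OF that] by (intro mult_left_mono order.trans[OF norm_blinfun] mult_right_mono) auto
      finally show ?thesis by (simp add: mult_ac)
    qed
    show ?thesis
      using *[of s t] *[of t s] that by (cases "s < t") (auto simp: norm_minus_commute)
  qed
  have nontriv: "at t within {0..T} \<noteq> bot" if "t \<in> {0..T}" for t
    using that T by (simp add: trivial_limit_within islimpt_Icc)
  have b_bd: "norm (b x t) \<le> norm x * c" if t: "t \<in> {0..T}" for x t
  proof (rule tendsto_upperbound[OF _ _ nontriv[OF t]])
    have "((\<lambda>s. (B s x - B t x) /\<^sub>R (s - t)) \<longlongrightarrow> b x t) (at t within {0..T})"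
      using b(2)[OF t, of x] unfolding has_vector_derivative_iff_quotient .
    then show "((\<lambda>s. norm ((B s x - B t x) /\<^sub>R (s - t))) \<longlongrightarrow> norm (b x t)) (at t within {0..T})"
      by (rule tendsto_norm)
    show "\<forall>\<^sub>F s in at t within {0..T}. norm ((B s x - B t x) /\<^sub>R (s - t)) \<le> norm x * c"
      unfolding eventually_at_filter
    proof (intro always_eventually allI impI)
      fix s assume s: "s \<noteq> t" "s \<in> {0..T}"
      show "norm ((B s x - B t x) /\<^sub>R (s - t)) \<le> norm x * c"
        using Lip[OF t s(2) s(1)[symmetric], of x] s(1)
        by (simp only: norm_scaleR) (simp add: abs_inverse inverse_eq_divide field_simps)
    qed
  qed
  have lin: "bounded_linear (\<lambda>x. b x t)" if t: "t \<in> {0..T}" for t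
  proof (rule bounded_linear_intro)
    fix x y
    have "((\<lambda>s. B s (x + y)) has_vector_derivative b x t + b y t) (at t within {0..T})"
      using has_vector_derivative_add[OF b(2)[OF t, of x] b(2)[OF t, of y]] by (simp add: blinfun.add_right)
    then show "b (x + y) t = b x t + b y t"
      using vector_derivative_unique_within[OF nontriv[OF t] b(2)[OF t, of "x + y"]] by blast
  next
    fix r x
    have "((\<lambda>s. B s (r *\<^sub>R x)) has_vector_derivative r *\<^sub>R b x t) (at t within {0..T})"
      using bounded_linear.has_vector_derivative[OF bounded_linear_scaleR_right b(2)[OF t, of x]] by (simp add: blinfun.scaleR_right)
    then show "b (r *\<^sub>R x) t = r *\<^sub>R b x t"
      using vector_derivative_unique_within[OF nontriv[OF t] b(2)[OF t, of "r *\<^sub>R x"]] by blast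
  qed (rule b_bd[OF t])
  define B' where "B' t = Blinfun (\<lambda>x. b x t)" for t
  have B': "B' t x = b x t" if "t \<in> {0..T}" for t x
    unfolding B'_def using bounded_linear_Blinfun_apply[OF lin[OF that]] by simp
  have "c \<ge> 0"
    using order.trans[OF norm_ge_zero c[of 0 T]] T by auto
  have "C1_family T B B' c"
    unfolding C1_family_def
  proof (intro conjI ballI allI)
    fix t assume t: "t \<in> {0..T}"
    show "norm (B' t) \<le> c"
      using b_bd[OF t] \<open>c \<ge> 0\<close> by (intro norm_blinfun_bound) (auto simp: B'[OF t] mult.commute)
    show "((\<lambda>s. B s x) has_vector_derivative B' t x) (at t within {0..T})" for x
      using b(2)[OF t] by (simp add: B'[OF t])
  next
    show "continuous_on {0..T} (\<lambda>t. B' t x)" for x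
      using b(1)[of x] by (rule continuous_on_eq) (simp add: B')
  qed
  then show ?thesis by blast
qed


text \<open>The identity \<open>Bi s - Bi t = - Bi s (B s - B t) Bi t\<close> first gives Lipschitz
  continuity in norm and then, divided by \<open>s - t\<close>, the derivative.\<close>

lemma C1_family_inverse:
  fixes B Bi :: "real \<Rightarrow> ('x::banach \<Rightarrow>\<^sub>L 'x)"
  assumes F: "C1_family T B B' c" and T: "T > 0"
    and inv: "\<And>t x. t \<in> {0..T} \<Longrightarrow> Bi t (B t x) = x" "\<And>t x. t \<in> {0..T} \<Longrightarrow> B t (Bi t x) = x"
    and M: "\<And>t. t \<in> {0..T} \<Longrightarrow> norm (Bi t) \<le> M"
  shows "C1_family T Bi (\<lambda>t. - (Bi t o\<^sub>L B' t o\<^sub>L Bi t)) (M * c * M)"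
proof -
  have c: "c \<ge> 0" using C1_family_c[OF F] T by simp
  have M0: "M \<ge> 0" using order.trans[OF norm_ge_zero M[of 0]] T by simp
  have B'_bd: "norm (B' t) \<le> c" if "t \<in> {0..T}" for t
    using F that by (simp add: C1_family_def)
  have diff: "Bi s x - Bi t x = - Bi s (B s (Bi t x) - B t (Bi t x))" if "s \<in> {0..T}" "t \<in> {0..T}" for s t x
    using that inv by (simp add: blinfun.diff_right)
  have Lip: "norm (Bi s - Bi t) \<le> (M * c * M) * \<bar>s - t\<bar>" if st: "s \<in> {0..T}" "t \<in> {0..T}" for s t
  proof (rule norm_blinfun_bound)
    fix x
    have "norm ((Bi s - Bi t) x) = norm (Bi s ((B s - B t) (Bi t x)))"
      using diff[OF st, of x] by (simp add: blinfun.diff_left)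
    also have "\<dots> \<le> norm (Bi s) * (norm (B s - B t) * (norm (Bi t) * norm x))"
      by (intro order.trans[OF norm_blinfun] mult_left_mono norm_blinfun norm_ge_zero)
    also have "\<dots> \<le> M * ((c * \<bar>s - t\<bar>) * (M * norm x))"
      using M[OF st(1)] M[OF st(2)] C1_family_Lipschitz[OF F st(2,1)] M0 c by (intro mult_mono) auto
    finally show "norm ((Bi s - Bi t) x) \<le> M * c * M * \<bar>s - t\<bar> * norm x"
      by (simp add: mult_ac)
  qed (use M0 c in auto)
  have lim: "(Bi \<longlongrightarrow> Bi t) (at t within {0..T})" if t: "t \<in> {0..T}" for t
  proof (rule LIM_zero_cancel, rule Lim_null_comparison)
    show "\<forall>\<^sub>F s in at t within {0..T}. norm (Bi s - Bi t) \<le> (M * c * M) * \<bar>s - t\<bar>"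
      unfolding eventually_at_filter using Lip t by simp
    have "((\<lambda>s. (M * c * M) * \<bar>s - t\<bar>) \<longlongrightarrow> (M * c * M) * \<bar>t - t\<bar>) (at t within {0..T})"
      by (intro tendsto_intros)
    then show "((\<lambda>s. (M * c * M) * \<bar>s - t\<bar>) \<longlongrightarrow> 0) (at t within {0..T})"
      by simp
  qed
  then have cont: "continuous_on {0..T} Bi"
    by (simp add: continuous_on_def)
  show ?thesis
    unfolding C1_family_def
  proof (intro conjI ballI allI)
    fix t assume t: "t \<in> {0..T}"
    have "norm (Bi t o\<^sub>L B' t o\<^sub>L Bi t) \<le> norm (Bi t) * norm (B' t) * norm (Bi t)"
      by (intro order.trans[OF norm_blinfun_compose] mult_right_mono norm_blinfun_compose norm_ge_zero)
    also have "\<dots> \<le> M * c * M"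
      using M[OF t] B'_bd[OF t] M0 c by (intro mult_mono) auto
    finally show "norm (- (Bi t o\<^sub>L B' t o\<^sub>L Bi t)) \<le> M * c * M" by simp
    fix x
    let ?y = "Bi t x"
    \<comment> \<open>The vector \<open>Bi t x\<close> stays fixed while \<open>s\<close> varies, so
      strong differentiability of \<open>B\<close> suffices.\<close>
    have q: "((\<lambda>s. (B s ?y - B t ?y) /\<^sub>R (s - t)) \<longlongrightarrow> B' t ?y) (at t within {0..T})"
      using F t unfolding C1_family_def has_vector_derivative_iff_quotient by blast
    have "((\<lambda>s. - Bi s ((B s ?y - B t ?y) /\<^sub>R (s - t))) \<longlongrightarrow> - Bi t (B' t ?y)) (at t within {0..T})"
      by (intro tendsto_intros lim[OF t] q)
    moreover have "\<forall>\<^sub>F s in at t within {0..T}. - Bi s ((B s ?y - B t ?y) /\<^sub>R (s - t)) = (Bi s x - Bi t x) /\<^sub>R (s - t)"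
      unfolding eventually_at_filter using diff t by (simp add: blinfun.scaleR_right)
    ultimately show "((\<lambda>s. Bi s x) has_vector_derivative (- (Bi t o\<^sub>L B' t o\<^sub>L Bi t)) x) (at t within {0..T})"
      unfolding has_vector_derivative_iff_quotient
      by (simp add: tendsto_cong blinfun.minus_left)
  next
    fix x
    have "continuous_on {0..T} (\<lambda>t. - Bi t (B' t (Bi t x)))"
      by (intro continuous_intros cont C1_family_continuous(1)[OF F])
    then show "continuous_on {0..T} (\<lambda>t. (- (Bi t o\<^sub>L B' t o\<^sub>L Bi t)) x)"
      by (simp add: blinfun.minus_left)
  qed
qed

text \<open>The difference \<open>R s t\<close> of the two sides is additive in the interval \<open>[s, t]\<close> and of higher
  order as its length tends to zero, so it vanishes.\<close>

lemma product_rule: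
  fixes B :: "real \<Rightarrow> ('a::banach \<Rightarrow>\<^sub>L 'b::banach)"
  assumes F: "C1_family T B B' c" and T: "T \<ge> 0" and p: "p \<ge> 1" and v: "Lp T p v"
    and u: "\<And>t. t \<in> {0..T} \<Longrightarrow> (v has_integral (u t - u 0)) {0..t}"
  shows "Lp T p (\<lambda>t. B' t (u t) + B t (v t))"
    and "t \<in> {0..T} \<Longrightarrow> ((\<lambda>t. B' t (u t) + B t (v t)) has_integral (B t (u t) - B 0 (u 0))) {0..t}"
proof -
  have c: "c \<ge> 0" by (rule C1_family_c[OF F T])
  have B'_bd: "norm (B' t) \<le> c" if "t \<in> {0..T}" for t
    using F that by (simp add: C1_family_def)
  have v_int: "v integrable_on {s..t}" "(\<lambda>r. norm (v r)) integrable_on {s..t}" if "0 \<le> s" "t \<le> T" for s t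
    using Lp_integrable(3,1)[OF v p that] .
  have u_int: "integral {s..t} v = u t - u s" if "0 \<le> s" "s \<le> t" "t \<le> T" for s t
  proof -
    have "integral {0..s} v + integral {s..t} v = integral {0..t} v"
      using that v_int by (intro Henstock_Kurzweil_Integration.integral_combine) auto
    moreover have "integral {0..s} v = u s - u 0" "integral {0..t} v = u t - u 0"
      using that u by (auto intro!: integral_unique)
    ultimately show ?thesis by (simp add: algebra_simps)
  qed
  have u_cont: "continuous_on {0..T} u"
  proof (rule continuous_on_eq)
    show "continuous_on {0..T} (\<lambda>t. u 0 + integral {0..t} v)"
      using v_int(1)[of 0 T] by (intro continuous_intros indefinite_integral_continuous_1) auto
    show "u 0 + integral {0..t} v = u t" if "t \<in> {0..T}" for t
      using u_int[of 0 t] that by simp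
  qed
  have B_meas: "smeas T (\<lambda>t. B t x)" for x
    by (rule smeas_continuous_on[OF C1_family_continuous(2)[OF F continuous_on_const]])
  have Bv: "Lp T p (\<lambda>t. B t (v t))"
    using C1_family_bounded[OF F] c T p by (intro Lp_blinfun_family(1)[OF B_meas v, of "norm (B 0) + c * T"]) auto
  have B'u: "Lp T p (\<lambda>t. B' t (u t))"
    using p by (intro Lp_continuous_on C1_family_continuous(1)[OF F u_cont]) auto
  define q where "q t = B' t (u t) + B t (v t)" for t
  have q: "Lp T p q"
    unfolding q_def using p by (intro Lp_add Bv B'u) auto
  then show "Lp T p (\<lambda>t. B' t (u t) + B t (v t))"
    unfolding q_def .
  have q_int: "q integrable_on {s..t}" if "0 \<le> s" "t \<le> T" for s t
    by (rule Lp_integrable(3)[OF q p that])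
  define R where "R s t = B t (u t) - B s (u s) - integral {s..t} q" for s t
  \<comment> \<open>With \<open>u\<close> frozen at the left end and \<open>B\<close> at the right
    end the integrals are explicit; each term of the remainder contains an increment of
    \<open>u\<close> or of \<open>B\<close> over the interval.\<close>
  have R_eq: "R s t = integral {s..t} (\<lambda>r. B' r (u s - u r) + (B t - B r) (v r))"
    and R_int: "(\<lambda>r. B' r (u s - u r) + (B t - B r) (v r)) integrable_on {s..t}"
    if st: "0 \<le> s" "s \<le> t" "t \<le> T" for s t
  proof -
    have "((\<lambda>r. B' r (u s)) has_integral (B t (u s) - B s (u s))) {s..t}"
      by (rule C1_family_integral[OF F st])
    moreover have "((\<lambda>r. B t (v r)) has_integral B t (u t - u s)) {s..t}"
      using has_integral_linear[OF integrable_integral[OF v_int(1)] blinfun.bounded_linear_right[of "B t"], of s t] st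
      by (simp add: o_def u_int)
    moreover have "(q has_integral integral {s..t} q) {s..t}"
      using q_int[of s t] st by auto
    ultimately have "((\<lambda>r. B' r (u s) + B t (v r) - q r) has_integral (B t (u s) - B s (u s) + B t (u t - u s) - integral {s..t} q)) {s..t}"
      by (intro has_integral_add has_integral_diff)
    moreover have "(\<lambda>r. B' r (u s) + B t (v r) - q r) = (\<lambda>r. B' r (u s - u r) + (B t - B r) (v r))"
      by (auto simp: q_def blinfun.diff_right blinfun.diff_left)
    moreover have "B t (u s) - B s (u s) + B t (u t - u s) - integral {s..t} q = R s t"
      by (simp add: R_def blinfun.diff_right)
    ultimately have "((\<lambda>r. B' r (u s - u r) + (B t - B r) (v r)) has_integral R s t) {s..t}"
      by simp
    then show "R s t = integral {s..t} (\<lambda>r. B' r (u s - u r) + (B t - B r) (v r))"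
      "(\<lambda>r. B' r (u s - u r) + (B t - B r) (v r)) integrable_on {s..t}"
      by (auto simp: integral_unique)
  qed
  have R_small: "norm (R s t) \<le> c * e * integral {s..t} (\<lambda>r. 1 + norm (v r))"
    if e: "e > 0" and st: "s \<in> {0..T}" "t \<in> {0..T}" "s \<le> t" for e s t
  proof -
    obtain d where d: "d > 0" "\<And>r r'. r \<in> {0..T} \<Longrightarrow> r' \<in> {0..T} \<Longrightarrow> dist r' r < d \<Longrightarrow> dist (u r') (u r) < e"
      using compact_uniformly_continuous[OF u_cont] e unfolding uniformly_continuous_on_def by (metis compact_Icc)
    \<comment> \<open>The bound is additive in the interval, just like \<open>R\<close>, so it
      passes to unions of adjacent intervals and bisection applies.\<close>
    define P where "P s t \<longleftrightarrow> (0 \<le> s \<and> t \<le> T \<longrightarrow> norm (R s t) \<le> c * e * integral {s..t} (\<lambda>r. 1 + norm (v r)))" for s t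
    have "P s t"
    proof (rule Bolzano[OF st(3), of P])
      fix a b r assume P: "P a b" "P b r" and ab: "a \<le> b" "b \<le> r"
      show "P a r"
        unfolding P_def
      proof
        assume ar: "0 \<le> a \<and> r \<le> T"
        have "integral {a..b} q + integral {b..r} q = integral {a..r} q"
          using ar ab by (intro Henstock_Kurzweil_Integration.integral_combine q_int) auto
        then have "R a r = R a b + R b r"
          by (simp add: R_def algebra_simps)
        moreover have "integral {a..b} (\<lambda>r. 1 + norm (v r)) + integral {b..r} (\<lambda>r. 1 + norm (v r)) = integral {a..r} (\<lambda>r. 1 + norm (v r))"
          using ar ab by (intro Henstock_Kurzweil_Integration.integral_combine integrable_add v_int) auto
        moreover have "norm (R a b) \<le> c * e * integral {a..b} (\<lambda>r. 1 + norm (v r))"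
          "norm (R b r) \<le> c * e * integral {b..r} (\<lambda>r. 1 + norm (v r))"
          using P ar ab by (auto simp: P_def)
        ultimately show "norm (R a r) \<le> c * e * integral {a..r} (\<lambda>r. 1 + norm (v r))"
          by (metis (no_types, lifting) add_mono distrib_left norm_triangle_le)
      qed
    next
      fix r
      \<comment> \<open>A length below \<open>d\<close> controls the increment of \<open>u\<close>;
        a length below \<open>e\<close> controls that of \<open>B\<close> through its Lipschitz
        bound.\<close>
      have "P a b" if ab: "a \<le> r \<and> r \<le> b \<and> b - a < min d e" for a b
        unfolding P_def
      proof
        assume ab': "0 \<le> a \<and> b \<le> T"
        have "norm (integral {a..b} (\<lambda>r. B' r (u a - u r) + (B b - B r) (v r)))
            \<le> integral {a..b} (\<lambda>r. (c * e) * (1 + norm (v r)))"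
        proof (rule integral_norm_bound_integral)
          show "(\<lambda>r. B' r (u a - u r) + (B b - B r) (v r)) integrable_on {a..b}"
            using ab ab' by (intro R_int) auto
          show "(\<lambda>r. (c * e) * (1 + norm (v r))) integrable_on {a..b}"
            using ab' by (intro integrable_on_mult_right integrable_add v_int) auto
          fix x assume x: "x \<in> {a..b}"
          have "norm (B' x (u a - u x)) \<le> c * e"
          proof -
            have "dist (u a) (u x) < e"
              using x ab ab' by (intro d(2)) (auto simp: dist_real_def)
            then show ?thesis
              using x ab' B'_bd[of x] c by (intro order.trans[OF norm_blinfun] mult_mono) (auto simp: dist_norm)
          qed
          moreover have "norm ((B b - B x) (v x)) \<le> c * e * norm (v x)"
          proof -
            have "norm (B b - B x) \<le> c * \<bar>b - x\<bar>"
              using x ab' by (intro C1_family_Lipschitz[OF F]) auto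
            also have "\<dots> \<le> c * e"
              using x ab c by (intro mult_left_mono) auto
            finally show ?thesis
              by (intro order.trans[OF norm_blinfun] mult_right_mono) auto
          qed
          ultimately show "norm (B' x (u a - u x) + (B b - B x) (v x)) \<le> (c * e) * (1 + norm (v x))"
            by (intro norm_triangle_le) (simp add: distrib_left)
        qed
        then show "norm (R a b) \<le> c * e * integral {a..b} (\<lambda>r. 1 + norm (v r))"
          using R_eq[of a b] ab ab' by simp
      qed
      then show "\<exists>d>0. \<forall>a b. a \<le> r \<and> r \<le> b \<and> b - a < d \<longrightarrow> P a b"
        using d(1) e by (intro exI[of _ "min d e"]) auto
    qed
    then show ?thesis
      using st by (auto simp: P_def)
  qed
  show "((\<lambda>t. B' t (u t) + B t (v t)) has_integral (B t (u t) - B 0 (u 0))) {0..t}" if t: "t \<in> {0..T}"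
  proof -
    define k where "k = c * integral {0..t} (\<lambda>r. 1 + norm (v r))"
    have le: "norm (R 0 t) \<le> k * e" if "e > 0" for e
      using R_small[OF that, of 0 t] t by (simp add: k_def mult_ac)
    have lim: "((\<lambda>e. k * e) \<longlongrightarrow> k * 0) (at_right 0)"
      by (intro tendsto_intros)
    have "norm (R 0 t) \<le> k * 0"
      by (rule tendsto_lowerbound[OF lim]) (auto simp: eventually_at_filter le)
    then have "integral {0..t} q = B t (u t) - B 0 (u 0)"
      by (simp add: R_def)
    then show ?thesis
      using integrable_integral[OF q_int[of 0 t]] t unfolding q_def[abs_def] by simp
  qed
qed

section \<open>Continuity in the trace space\<close>

lemma smeas_norm: "smeas T f \<Longrightarrow> smeas T (\<lambda>t. norm (f t))"
  by (rule smeas_compose) (auto intro!: continuous_intros)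

section \<open>Windows and cut-offs\<close>

text \<open>The left translate by \<open>t\<close>, kept on [0, l] only. Multiplied by
  \<open>1 - r / l\<close>, such a piece of a function in the maximal regularity space competes in
  the infimum of \<open>tr_norm\<close> with initial value \<open>f t\<close>.\<close>

definition window :: "real \<Rightarrow> real \<Rightarrow> (real \<Rightarrow> 'a::real_normed_vector) \<Rightarrow> real \<Rightarrow> 'a" where
  "window l t f r = (if r \<in> {0..l} then f (t + r) else 0)"

lemma norm_cutoff_le:
  assumes "l > 0"
  shows "norm ((1 - r / l) *\<^sub>R window l t f r) \<le> norm (window l t f r)"
proof (cases "r \<in> {0..l}")
  case True
  then have "\<bar>1 - r / l\<bar> \<le> 1"
    using assms by (auto simp: abs_le_iff field_simps)
  from mult_right_mono[OF this norm_ge_zero] show ?thesis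
    by simp
qed (auto simp: window_def)

lemma smeas_window:
  assumes "smeas T f" "0 \<le> t" "t + l \<le> T"
  shows "smeas S (window l t f)"
proof -
  have "smeas S (\<lambda>r. if r \<in> {0..l} then (if t + 1 * r \<in> {0..T} then f (t + 1 * r) else 0) else 0)"
    using assms(1) by (intro smeas_restrict smeas_affine) auto
  moreover have "(\<lambda>r. if r \<in> {0..l} then (if t + 1 * r \<in> {0..T} then f (t + 1 * r) else 0) else 0) = window l t f"
    using assms by (auto simp: window_def)
  ultimately show ?thesis by simp
qed

lemma pmass_window:
  assumes "smeas T f" "0 \<le> t" "t + l \<le> T" "l \<le> S"
  shows "pmass p 0 S (window l t f) = pmass p t (t + l) f"
proof -
  have "pmass p 0 S (window l t f) = pmass p 0 l (\<lambda>r. f (t + 1 * r))"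
    unfolding window_def using assms by (subst pmass_restrict) auto
  also have "\<dots> = pmass p t (t + l) f"
    by (rule pmass_affine[OF assms(1)]) (use assms in auto)
  finally show ?thesis .
qed

lemma Lp_window:
  assumes "Lp T p f" "0 \<le> t" "t + l \<le> T" "l \<le> S"
  shows "Lp S p (window l t f)"
proof -
  have "pmass p t (t + l) f \<le> pmass p 0 T f"
    using assms by (intro pmass_mono_interval) auto
  then show ?thesis
    using assms smeas_window[of T f t l S] pmass_window[of T f t l S p] by (auto simp: Lp_iff)
qed

lemma Lp_cutoff:
  assumes f: "Lp T p f" and t: "0 \<le> t" "t + l \<le> T" and l: "l \<le> S" "0 < l" and p: "p \<ge> 0"
  shows "Lp S p (\<lambda>r. (1 - r / l) *\<^sub>R window l t f r)"
proof (rule Lp_bound(1))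
  show w: "Lp S p (window l t f)" by (rule Lp_window[OF f t l(1)])
  have "smeas S (\<lambda>r. 1 - r / l)"
    by (intro smeas_continuous_on continuous_intros) (use l in auto)
  then show "smeas S (\<lambda>r. (1 - r / l) *\<^sub>R window l t f r)"
    by (rule smeas_scaleR[OF _ Lp_smeas[OF w]])
  show "AE r in lebesgue_on {0..S}. norm ((1 - r / l) *\<^sub>R window l t f r) \<le> 1 * norm (window l t f r)"
    using norm_cutoff_le[OF l(2)] by (intro AE_lebesgue_on_space) simp
qed (use p in auto)

lemma Lp_reverse:
  assumes "Lp T p f"
  shows "Lp T p (\<lambda>t. f (T - t))"
proof -
  note f = Lp_smeas[OF assms]
  have "smeas T (\<lambda>t. f (T - t))"
    using smeas_affine[OF f, of "-1" T T] by (rule smeas_cong_AE) (auto intro!: AE_lebesgue_on_space)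
  moreover have "pmass p 0 T (\<lambda>t. f (T - t)) = pmass p 0 T f"
    using pmass_reverse[OF f, of 0 T p T] by simp
  ultimately show ?thesis
    using assms by (simp add: Lp_iff)
qed

text \<open>Absolute continuity of the integral: a primitive of \<open>norm (f t) powr p\<close> is
  uniformly continuous on [0, T].\<close>

lemma pmass_window_small:
  fixes f :: "real \<Rightarrow> 'a::banach"
  assumes f: "Lp T p f" and p: "p \<ge> 1" and \<kappa>: "\<kappa> > 0"
  shows "\<exists>d>0. \<forall>a b. 0 \<le> a \<and> a \<le> b \<and> b \<le> T \<and> b - a < d \<longrightarrow> pmass p a b f \<le> ennreal \<kappa>"
proof -
  let ?n = "\<lambda>t. norm (f t) powr p"
  define G where "G t = integral {0..t} ?n" for t
  have int: "?n integrable_on {a..b}" if "0 \<le> a" "b \<le> T" for a b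
    using Lp_integrable(2)[OF f p that] .
  have "continuous_on {0..T} G"
    unfolding G_def by (rule indefinite_integral_continuous_1[OF int]) auto
  then have "uniformly_continuous_on {0..T} G"
    by (rule compact_uniformly_continuous) simp
  then obtain d where d: "d > 0" "\<And>x y. x \<in> {0..T} \<Longrightarrow> y \<in> {0..T} \<Longrightarrow> dist y x < d \<Longrightarrow> dist (G y) (G x) < \<kappa>"
    using \<kappa> unfolding uniformly_continuous_on_def by metis
  have "pmass p a b f \<le> ennreal \<kappa>" if ab: "0 \<le> a" "a \<le> b" "b \<le> T" "b - a < d" for a b
  proof -
    have "integral {0..a} ?n + integral {a..b} ?n = integral {0..b} ?n"
      using ab by (intro Henstock_Kurzweil_Integration.integral_combine int) auto
    then have "integral {a..b} ?n = G b - G a"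
      by (simp add: G_def)
    also have "\<dots> \<le> \<kappa>"
      using d(2)[of a b] ab by (auto simp: dist_real_def)
    finally show ?thesis
      using Lp_integrable(4)[OF f p ab(1,3)] by (simp add: ennreal_leI)
  qed
  with d(1) show ?thesis by blast
qed

lemma lpnorm_le:
  assumes "pmass p 0 T f \<le> ennreal (\<kappa> powr p)" "\<kappa> \<ge> 0" "p > 0"
  shows "lpnorm T p f \<le> \<kappa>"
proof -
  have "enn2real (pmass p 0 T f) \<le> \<kappa> powr p"
    using enn2real_mono[OF assms(1)] by simp
  then have "enn2real (pmass p 0 T f) powr (1 / p) \<le> (\<kappa> powr p) powr (1 / p)"
    using assms by (intro powr_mono2) auto
  then show ?thesis
    using assms by (simp add: lpnorm_eq powr_powr)
qed

context evolution
begin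

text \<open>The space \<open>MR\<close>, unlike the equation, is invariant under time reversal.
  Points near \<open>T\<close> can therefore be treated like points near 0.\<close>

lemma MR_reverse:
  assumes MR: "MR w v g"
  shows "MR (\<lambda>t. w (T - t)) (\<lambda>t. - v (T - t)) (\<lambda>t. g (T - t))"
  unfolding MR_def
proof (intro conjI ballI)
  have v: "Lp T p v" "Lp T p g" using MR by (auto simp: MR_def)
  show "Lp T p (\<lambda>t. g (T - t))"
    by (rule Lp_reverse[OF v(2)])
  from Lp_scale[OF Lp_reverse[OF v(1)] p_nonneg(1), of "-1"] show "Lp T p (\<lambda>t. - v (T - t))"
    by simp
  fix t assume t: "t \<in> {0..T}"
  have "v integrable_on {T - t..T}"
    using Lp_integrable(3)[OF v(1) p_nonneg(2), of "T - t" T] t by simp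
  then have "(v has_integral (w T - w (T - t))) {T - t..T}"
    using MR_integral[OF MR, of "T - t" T] t by (simp add: has_integral_iff)
  from has_integral_neg[OF has_integral_reverse[OF this, of T]]
  show "((\<lambda>t. - v (T - t)) has_integral w (T - t) - w (T - 0)) {0..t}"
    by simp
next
  have "AE t in lebesgue_on {0..T}. w t = J (g t)"
    using MR by (simp add: MR_def)
  from AE_lebesgue_real_affine[OF this[unfolded AE_lebesgue_on_iff], of "-1" T]
  have "AE t in lebesgue. T + - 1 * t \<in> {0..T} \<longrightarrow> w (T + - 1 * t) = J (g (T + - 1 * t))"
    by simp
  then show "AE t in lebesgue_on {0..T}. w (T - t) = J (g (T - t))"
    unfolding AE_lebesgue_on_iff by eventually_elim auto
qed

text \<open>A translate by \<open>t\<close> is known only up to time \<open>T - t\<close>, while the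
  trace space asks for functions on [0, T]; the linear factor brings it to zero at time
  \<open>l\<close>.\<close>

lemma MR_cutoff:
  assumes MR: "MR w v g" and l: "0 < l" and t: "0 \<le> t" "t + l \<le> T"
  shows "MR (\<lambda>r. (1 - r / l) *\<^sub>R window l t w r)
    (\<lambda>r. (-1 / l) *\<^sub>R window l t w r + (1 - r / l) *\<^sub>R window l t v r)
    (\<lambda>r. (1 - r / l) *\<^sub>R window l t g r)"
proof -
  have v: "Lp T p v" "Lp T p g" using MR by (auto simp: MR_def)
  have w: "Lp T p w"
    by (rule Lp_continuous_on[OF MR_continuous[OF MR] p_nonneg(1)])
  have lT: "l \<le> T" using t by simp
  let ?q = "\<lambda>r. (-1 / l) *\<^sub>R window l t w r + (1 - r / l) *\<^sub>R window l t v r"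
  \<comment> \<open>The scalar cut-off is read as an operator family so that
    \<open>product_rule\<close> supplies the derivative.\<close>
  let ?B = "\<lambda>r. (1 - r / l) *\<^sub>R (id_blinfun :: 'x \<Rightarrow>\<^sub>L 'x)" and ?B' = "\<lambda>r::real. (-1 / l) *\<^sub>R (id_blinfun :: 'x \<Rightarrow>\<^sub>L 'x)"
  have fam: "C1_family l ?B ?B' (1 / l)"
    unfolding C1_family_def
  proof (intro conjI ballI allI)
    show "norm (?B' r) \<le> 1 / l" for r
      using l norm_blinfun_id_le[where 'a = 'x] by (simp add: divide_right_mono)
    show "((\<lambda>s. ?B s x) has_vector_derivative ?B' r x) (at r within {0..l})" for r x
      using l by (auto simp: blinfun.scaleR_left blinfun.minus_left intro!: derivative_eq_intros)
  qed auto
  have q_int: "(?q has_integral ((1 - r / l) *\<^sub>R w (t + r) - w t)) {0..r}" if r: "r \<in> {0..l}" for r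
  proof -
    have "((\<lambda>s. ?B' s (window l t w s) + ?B s (window l t v s)) has_integral
        (?B r (window l t w r) - ?B 0 (window l t w 0))) {0..r}"
    proof (rule product_rule(2)[OF fam _ p_nonneg(2) _ _ r])
      show "Lp l p (window l t v)" by (rule Lp_window[OF v(1) t]) simp
      fix s assume s: "s \<in> {0..l}"
      have "v integrable_on {t..t + s}"
        using Lp_integrable(3)[OF v(1) p_nonneg(2), of t "t + s"] s t by simp
      then have "(v has_integral (w (t + s) - w t)) {t..t + s}"
        using MR_integral[OF MR, of t "t + s"] s t by (simp add: has_integral_iff)
      from has_integral_shift[OF this, of "-t"]
      have "((\<lambda>r. v (t + r)) has_integral (w (t + s) - w t)) {0..s}"
        by (simp add: add.commute)
      then show "(window l t v has_integral (window l t w s - window l t w 0)) {0..s}"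
        using s l by (subst has_integral_cong[where g = "\<lambda>r. v (t + r)"]) (auto simp: window_def)
    qed (use l in auto)
    then show ?thesis
      using r l by (simp add: blinfun.scaleR_left blinfun.minus_left window_def)
  qed
  show ?thesis
    unfolding MR_def
  proof (intro conjI ballI)
    show "Lp T p ?q"
      by (intro Lp_add Lp_scale Lp_window[OF w t lT] Lp_cutoff[OF v(1) t lT l] p_nonneg)
    show "Lp T p (\<lambda>r. (1 - r / l) *\<^sub>R window l t g r)"
      by (rule Lp_cutoff[OF v(2) t lT l p_nonneg(1)])
    fix r assume r: "r \<in> {0..T}"
    show "(?q has_integral (1 - r / l) *\<^sub>R window l t w r - (1 - 0 / l) *\<^sub>R window l t w 0) {0..r}"
    proof (cases "r \<le> l")
      case True
      then show ?thesis using q_int[of r] r l by (simp add: window_def)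
    next
      case False
      have "(?q has_integral 0) {l..r}"
      \<comment> \<open>At \<open>l\<close> itself the term with \<open>-1 / l\<close> need not
        vanish.\<close>
      proof (rule has_integral_spike_finite[where S = "{l}" and f = "\<lambda>_. 0"])
        show "?q s = 0" if "s \<in> {l..r} - {l}" for s
          using that by (auto simp: window_def)
      qed auto
      from has_integral_combine[OF _ _ q_int[of l] this] False l show ?thesis
        by (simp add: window_def)
    qed
  next
    have "AE s in lebesgue_on {0..T}. w s = J (g s)"
      using MR by (simp add: MR_def)
    from AE_lebesgue_real_affine[OF this[unfolded AE_lebesgue_on_iff], of 1 t]
    have "AE r in lebesgue. t + r \<in> {0..T} \<longrightarrow> w (t + r) = J (g (t + r))"
      by simp
    then show "AE r in lebesgue_on {0..T}. (1 - r / l) *\<^sub>R window l t w r = J ((1 - r / l) *\<^sub>R window l t g r)"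
      unfolding AE_lebesgue_on_iff
      by eventually_elim (use t in \<open>auto simp: window_def blinfun.scaleR_right\<close>)
  qed
qed

lemma tr_norm_le:
  assumes "MR z v g"
  shows "tr_norm T p J (z 0) \<le> lpnorm T p g + (lpnorm T p z + lpnorm T p v)"
proof -
  have "pmass p 0 T (\<lambda>t. Jinv J (z t)) = pmass p 0 T g"
    using MR_inMR(3)[OF assms] by (intro pmass_cong_AE) (auto elim!: eventually_mono)
  then have eq: "lpnorm T p (\<lambda>t. Jinv J (z t)) = lpnorm T p g"
    by (simp add: lpnorm_eq)
  have "tr_norm T p J (z 0) \<le> lpnorm T p (\<lambda>t. Jinv J (z t)) + (lpnorm T p z + lpnorm T p v)"
    unfolding tr_norm_def
  proof (rule cInf_lower)
    show "bdd_below {lpnorm T p (\<lambda>t. Jinv J (u t)) + (lpnorm T p u + lpnorm T p v) |u v.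
        inMR T p J u \<and> wderiv T p u v \<and> u 0 = z 0}"
      by (rule bdd_belowI[of _ 0]) (auto simp: lpnorm_def)
  qed (use MR_inMR(1,2)[OF assms] in blast)
  then show ?thesis by (simp add: eq)
qed

text \<open>The difference of two cut-off translates of equal length \<open>l\<close> has initial
  value \<open>w s - w t\<close>. A short \<open>l\<close> makes the parts from \<open>g\<close> and
  \<open>v\<close> small; afterwards uniform continuity of \<open>w\<close> handles the term with
  \<open>1 / l\<close>. The range up to \<open>3 * T / 4\<close> leaves room for windows of length
  \<open>T / 4\<close>.\<close>

lemma tr_norm_modulus:
  assumes MR: "MR w v g" and \<epsilon>: "\<epsilon> > 0"
  shows "\<exists>\<delta>>0. \<forall>s\<in>{0..3*T/4}. \<forall>t\<in>{0..3*T/4}. \<bar>s - t\<bar> < \<delta> \<longrightarrow> tr_norm T p J (w s - w t) < \<epsilon>"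
proof -
  have v: "Lp T p v" "Lp T p g" using MR by (auto simp: MR_def)
  define \<kappa> where "\<kappa> = (\<epsilon> / 4) powr p"
  have \<kappa>: "\<kappa> > 0" using \<epsilon> by (simp add: \<kappa>_def)
  \<comment> \<open>The estimate of the derivative loses \<open>2 powr p\<close> twice, that is
    \<open>4 powr p\<close>; the other 4 accounts for two windows and a budget of
    \<open>\<kappa> / 2\<close>.\<close>
  define \<kappa>1 where "\<kappa>1 = \<kappa> / (4 * 4 powr p)"
  have four: "4 powr p = 2 powr p * 2 powr p" using powr_mult[of 2 2 p] by simp
  have two: "2 powr p \<ge> 1" using p_nonneg by (simp add: ge_one_powr_ge_zero)
  have \<kappa>1: "\<kappa>1 > 0" "2 powr p * (2 powr p * (\<kappa>1 + \<kappa>1)) = \<kappa> / 2"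
    using \<kappa> by (auto simp: \<kappa>1_def four)
  have kk: "ennreal (2 powr p) * (ennreal \<kappa>1 + ennreal \<kappa>1) = ennreal (2 powr p * (\<kappa>1 + \<kappa>1))"
  proof -
    have "ennreal \<kappa>1 + ennreal \<kappa>1 = ennreal (\<kappa>1 + \<kappa>1)"
      using \<kappa>1(1) by (intro ennreal_plus[symmetric]) auto
    then show ?thesis
      using \<kappa>1(1) ennreal_mult[of "2 powr p" "\<kappa>1 + \<kappa>1"] by simp
  qed
  have \<kappa>1': "2 powr p * (\<kappa>1 + \<kappa>1) \<le> \<kappa>"
  proof -
    have "1 * (2 powr p * (\<kappa>1 + \<kappa>1)) \<le> 2 powr p * (2 powr p * (\<kappa>1 + \<kappa>1))"
      using two \<kappa>1(1) by (intro mult_right_mono) auto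
    then show ?thesis using \<kappa>1(2) \<kappa> by linarith
  qed
  obtain d1 where d1: "d1 > 0" "\<And>a b. 0 \<le> a \<Longrightarrow> a \<le> b \<Longrightarrow> b \<le> T \<Longrightarrow> b - a < d1 \<Longrightarrow> pmass p a b g \<le> ennreal \<kappa>1"
    using pmass_window_small[OF v(2) p_nonneg(2) \<kappa>1(1)] by blast
  obtain d2 where d2: "d2 > 0" "\<And>a b. 0 \<le> a \<Longrightarrow> a \<le> b \<Longrightarrow> b \<le> T \<Longrightarrow> b - a < d2 \<Longrightarrow> pmass p a b v \<le> ennreal \<kappa>1"
    using pmass_window_small[OF v(1) p_nonneg(2) \<kappa>1(1)] by blast
  define l where "l = min (min d1 d2) T / 4"
  have l: "l > 0" "l < d1" "l < d2" "l \<le> T / 4"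
    using d1(1) d2(1) T_pos by (auto simp: l_def)
  \<comment> \<open>The p-th power of the second factor times \<open>2 powr p * T\<close> is
    \<open>\<kappa> / 2\<close>. The minimum covers the estimates with and without division by
    \<open>l\<close>.\<close>
  define \<omega> where "\<omega> = min 1 l * (\<kappa> / (2 * 2 powr p * T)) powr (1 / p)"
  have \<omega>: "\<omega> > 0" using l \<kappa> T_pos by (simp add: \<omega>_def)
  have \<omega>_bd: "2 powr p * ((\<omega> / l) powr p * T) \<le> \<kappa> / 2" "\<omega> powr p * T \<le> \<kappa>"
  proof -
    let ?z = "(\<kappa> / (2 * 2 powr p * T)) powr (1 / p)"
    have z: "?z powr p = \<kappa> / (2 * 2 powr p * T)"
      using \<kappa> T_pos p_nonneg by (simp add: powr_powr)
    have "\<omega> \<le> l * ?z" "\<omega> \<le> 1 * ?z"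
      unfolding \<omega>_def by (intro mult_right_mono; simp)+
    then have "\<omega> / l \<le> ?z" "\<omega> \<le> ?z"
      using l by (auto simp: divide_le_eq mult.commute)
    then have "(\<omega> / l) powr p \<le> ?z powr p" "\<omega> powr p \<le> ?z powr p"
      using \<omega> l p_nonneg by (intro powr_mono2; simp)+
    then have A: "(\<omega> / l) powr p * T \<le> \<kappa> / (2 * 2 powr p)" "\<omega> powr p * T \<le> \<kappa> / (2 * 2 powr p)"
      unfolding z using T_pos by (auto simp: field_simps)
    then have "2 powr p * ((\<omega> / l) powr p * T) \<le> 2 powr p * (\<kappa> / (2 * 2 powr p))"
      by (intro mult_left_mono) auto
    then show "2 powr p * ((\<omega> / l) powr p * T) \<le> \<kappa> / 2" by simp
    have "\<kappa> / (2 * 2 powr p) \<le> \<kappa> / 1"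
      using two \<kappa> by (intro divide_left_mono) auto
    then show "\<omega> powr p * T \<le> \<kappa>" using A(2) by simp
  qed
  have "uniformly_continuous_on {0..T} w"
    by (rule compact_uniformly_continuous[OF MR_continuous[OF MR]]) simp
  then obtain \<delta> where \<delta>: "\<delta> > 0" "\<And>x y. x \<in> {0..T} \<Longrightarrow> y \<in> {0..T} \<Longrightarrow> dist y x < \<delta> \<Longrightarrow> dist (w y) (w x) < \<omega>"
    using \<omega> unfolding uniformly_continuous_on_def by metis
  have "tr_norm T p J (w s - w t) < \<epsilon>" if st: "s \<in> {0..3*T/4}" "t \<in> {0..3*T/4}" "\<bar>s - t\<bar> < \<delta>" for s t
  proof -
    have sl: "0 \<le> s" "s + l \<le> T" and tl: "0 \<le> t" "t + l \<le> T" and lT: "l \<le> T"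
      using st l T_pos by auto
    let ?z = "\<lambda>r. (1 - r / l) *\<^sub>R window l s w r - (1 - r / l) *\<^sub>R window l t w r"
    let ?v = "\<lambda>r. ((-1 / l) *\<^sub>R window l s w r + (1 - r / l) *\<^sub>R window l s v r)
      - ((-1 / l) *\<^sub>R window l t w r + (1 - r / l) *\<^sub>R window l t v r)"
    let ?g = "\<lambda>r. (1 - r / l) *\<^sub>R window l s g r - (1 - r / l) *\<^sub>R window l t g r"
    have MRz: "MR ?z ?v ?g"
      by (rule MR_diff[OF MR_cutoff[OF MR l(1) sl] MR_cutoff[OF MR l(1) tl]])
    have z0: "?z 0 = w s - w t"
      using l by (simp add: window_def)
    have w_diff: "norm (window l s w r - window l t w r) \<le> \<omega>" for r
    proof (cases "r \<in> {0..l}")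
      case True
      then have "dist (w (s + r)) (w (t + r)) < \<omega>"
        using st(3) sl tl by (intro \<delta>(2)) (auto simp: dist_real_def)
      then show ?thesis
        using True by (simp add: window_def dist_norm)
    qed (use \<omega> in \<open>auto simp: window_def\<close>)
    have "pmass p 0 T ?g \<le> ennreal (2 powr p) * (pmass p 0 T (window l s g) + pmass p 0 T (window l t g))"
    proof (rule pmass_bound_add[OF smeas_window[OF Lp_smeas[OF v(2)] sl] smeas_window[OF Lp_smeas[OF v(2)] tl]])
      show "AE r in lebesgue_on {0..T}. norm (?g r) \<le> norm (window l s g r) + norm (window l t g r)"
        by (rule AE_I2) (rule order.trans[OF norm_triangle_ineq4 add_mono[OF norm_cutoff_le[OF l(1)] norm_cutoff_le[OF l(1)]]])
    qed (use p_nonneg in auto)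
    also have "\<dots> \<le> ennreal (2 powr p) * (ennreal \<kappa>1 + ennreal \<kappa>1)"
      unfolding pmass_window[OF Lp_smeas[OF v(2)] sl lT] pmass_window[OF Lp_smeas[OF v(2)] tl lT]
      using sl tl l by (intro mult_left_mono add_mono d1(2)) auto
    also have "\<dots> = ennreal (2 powr p * (\<kappa>1 + \<kappa>1))"
      by (rule kk)
    also have "\<dots> \<le> ennreal \<kappa>"
      by (rule ennreal_leI[OF \<kappa>1'])
    finally have g_small: "lpnorm T p ?g \<le> \<epsilon> / 4"
      unfolding \<kappa>_def by (rule lpnorm_le) (use \<epsilon> p_nonneg in auto)
    have "pmass p 0 T ?z \<le> pmass p 0 T (\<lambda>_. \<omega>)"
    proof (rule pmass_mono[OF AE_lebesgue_on_space p_nonneg(1)])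
      fix r
      have "?z r = (1 - r / l) *\<^sub>R window l 0 (\<lambda>x. w (s + x) - w (t + x)) r"
        by (auto simp: window_def scaleR_diff_right)
      then have "norm (?z r) = norm ((1 - r / l) *\<^sub>R window l 0 (\<lambda>x. w (s + x) - w (t + x)) r)"
        by (simp only:)
      also have "\<dots> \<le> norm (window l 0 (\<lambda>x. w (s + x) - w (t + x)) r)"
        by (rule norm_cutoff_le[OF l(1)])
      also have "\<dots> = norm (window l s w r - window l t w r)"
        by (auto simp: window_def)
      finally show "norm (?z r) \<le> norm \<omega>"
        using w_diff[of r] by simp
    qed
    also have "\<dots> = ennreal (\<omega> powr p * T)"
      using pmass_const[of 0 T p \<omega>] T_pos \<omega> by simp
    also have "\<dots> \<le> ennreal \<kappa>"
      by (rule ennreal_leI[OF \<omega>_bd(2)])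
    finally have z_small: "lpnorm T p ?z \<le> \<epsilon> / 4"
      unfolding \<kappa>_def by (rule lpnorm_le) (use \<epsilon> p_nonneg in auto)
    \<comment> \<open>The two derivative windows form one scalar function, since
      \<open>pmass_bound_add\<close> takes two summands and the second is needed for
      \<open>\<omega> / l\<close>.\<close>
    let ?a = "\<lambda>r. norm (window l s v r) + norm (window l t v r)"
    have sm_v: "smeas T (window l s v)" "smeas T (window l t v)"
      by (rule smeas_window[OF Lp_smeas[OF v(1)] sl], rule smeas_window[OF Lp_smeas[OF v(1)] tl])
    have "pmass p 0 T ?a \<le> ennreal (2 powr p) * (pmass p 0 T (window l s v) + pmass p 0 T (window l t v))"
      by (rule pmass_bound_add[OF sm_v]) (use p_nonneg in auto)
    also have "\<dots> \<le> ennreal (2 powr p) * (ennreal \<kappa>1 + ennreal \<kappa>1)"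
      unfolding pmass_window[OF Lp_smeas[OF v(1)] sl lT] pmass_window[OF Lp_smeas[OF v(1)] tl lT]
      using sl tl l by (intro mult_left_mono add_mono d2(2)) auto
    also have "\<dots> = ennreal (2 powr p * (\<kappa>1 + \<kappa>1))"
      by (rule kk)
    finally have a_small: "pmass p 0 T ?a \<le> ennreal (2 powr p * (\<kappa>1 + \<kappa>1))" .
    have "pmass p 0 T ?v \<le> ennreal (2 powr p) * (pmass p 0 T ?a + pmass p 0 T (\<lambda>_. \<omega> / l))"
    proof (rule pmass_bound_add[OF smeas_add[OF smeas_norm[OF sm_v(1)] smeas_norm[OF sm_v(2)]] smeas_const])
      show "AE r in lebesgue_on {0..T}. norm (?v r) \<le> norm (?a r) + norm (\<omega> / l)"
      proof (rule AE_I2)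
        fix r
        have "?v r = ((1 - r / l) *\<^sub>R window l s v r - (1 - r / l) *\<^sub>R window l t v r)
            - (1 / l) *\<^sub>R (window l s w r - window l t w r)"
          by (simp add: algebra_simps)
        also have "norm \<dots> \<le> (norm ((1 - r / l) *\<^sub>R window l s v r) + norm ((1 - r / l) *\<^sub>R window l t v r))
            + norm ((1 / l) *\<^sub>R (window l s w r - window l t w r))"
          by (intro order.trans[OF norm_triangle_ineq4] add_mono norm_triangle_ineq4 order_refl)
        also have "\<dots> \<le> (norm (window l s v r) + norm (window l t v r)) + \<omega> / l"
        proof (intro add_mono norm_cutoff_le[OF l(1)])
          show "norm ((1 / l) *\<^sub>R (window l s w r - window l t w r)) \<le> \<omega> / l"
            using w_diff[of r] l(1) unfolding norm_scaleR by (simp add: divide_right_mono)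
        qed
        finally show "norm (?v r) \<le> norm (?a r) + norm (\<omega> / l)"
          using \<omega> l by simp
      qed
    qed (use p_nonneg in auto)
    also have "\<dots> \<le> ennreal (2 powr p) * (ennreal (2 powr p * (\<kappa>1 + \<kappa>1)) + ennreal ((\<omega> / l) powr p * T))"
      using a_small pmass_const[of 0 T p "\<omega> / l"] T_pos \<omega> l by (intro mult_left_mono add_mono) auto
    also have "\<dots> = ennreal (2 powr p * (2 powr p * (\<kappa>1 + \<kappa>1)) + 2 powr p * ((\<omega> / l) powr p * T))"
    proof -
      have "ennreal (2 powr p * (\<kappa>1 + \<kappa>1)) + ennreal ((\<omega> / l) powr p * T)
          = ennreal (2 powr p * (\<kappa>1 + \<kappa>1) + (\<omega> / l) powr p * T)"
        using \<kappa>1(1) T_pos by (intro ennreal_plus[symmetric]) auto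
      then show ?thesis
        using \<kappa>1(1) T_pos by (simp only: ennreal_mult[symmetric] distrib_left[symmetric]) (subst ennreal_mult[symmetric], auto)
    qed
    also have "\<dots> \<le> ennreal \<kappa>"
      using \<kappa>1(2) \<omega>_bd(1) by (intro ennreal_leI) linarith
    finally have v_small: "lpnorm T p ?v \<le> \<epsilon> / 4"
      unfolding \<kappa>_def by (rule lpnorm_le) (use \<epsilon> p_nonneg in auto)
    have "tr_norm T p J (w s - w t) \<le> lpnorm T p ?g + (lpnorm T p ?z + lpnorm T p ?v)"
      using tr_norm_le[OF MRz] unfolding z0 .
    then show ?thesis
      using g_small z_small v_small \<epsilon> by linarith
  qed
  with \<delta>(1) show ?thesis by blast
qed

lemma MR_trace:
  assumes MR: "MR w v g" and t: "t \<in> {0..3*T/4}"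
  shows "w t \<in> trace_space T p J"
proof -
  have "0 < T / 4" "0 \<le> t" "t + T / 4 \<le> T"
    using t T_pos by auto
  from MR_inMR(1)[OF MR_cutoff[OF MR this]]
  have "(1 - 0 / (T / 4)) *\<^sub>R window (T / 4) t w 0 \<in> trace_space T p J"
    unfolding trace_space_def
    by (intro CollectI exI[of _ "\<lambda>r. (1 - r / (T / 4)) *\<^sub>R window (T / 4) t w r"] conjI refl)
  then show ?thesis
    using T_pos by (simp add: window_def)
qed

text \<open>If \<open>t \<le> T / 2\<close>, then \<open>t\<close> and all \<open>s\<close> within
  \<open>T / 4\<close> of it lie in \<open>{0..3*T/4}\<close>; otherwise their reflections
  do.\<close>

lemma MR_cont_Tr:
  assumes MR: "MR w v g"
  shows "cont_Tr T p J w"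
  unfolding cont_Tr_def
proof (intro conjI ballI allI impI)
  note rev = MR_reverse[OF MR]
  fix t assume t: "t \<in> {0..T}"
  show "w t \<in> trace_space T p J"
  proof (cases "t \<le> T / 2")
    case True
    then show ?thesis using MR_trace[OF MR, of t] t T_pos by auto
  next
    case False
    then show ?thesis using MR_trace[OF rev, of "T - t"] t T_pos by auto
  qed
  fix \<epsilon> :: real assume \<epsilon>: "\<epsilon> > 0"
  obtain \<delta>1 where \<delta>1: "\<delta>1 > 0" "\<And>s t. s \<in> {0..3*T/4} \<Longrightarrow> t \<in> {0..3*T/4} \<Longrightarrow> \<bar>s - t\<bar> < \<delta>1 \<Longrightarrow> tr_norm T p J (w s - w t) < \<epsilon>"
    using tr_norm_modulus[OF MR \<epsilon>] by blast
  obtain \<delta>2 where \<delta>2: "\<delta>2 > 0" "\<And>s t. s \<in> {0..3*T/4} \<Longrightarrow> t \<in> {0..3*T/4} \<Longrightarrow> \<bar>s - t\<bar> < \<delta>2 \<Longrightarrow> tr_norm T p J (w (T - s) - w (T - t)) < \<epsilon>"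
    using tr_norm_modulus[OF rev \<epsilon>] by blast
  show "\<exists>\<delta>>0. \<forall>s\<in>{0..T}. \<bar>s - t\<bar> < \<delta> \<longrightarrow> tr_norm T p J (w s - w t) < \<epsilon>"
  proof (intro exI[of _ "min (min \<delta>1 \<delta>2) (T / 4)"] conjI ballI impI)
    show "0 < min (min \<delta>1 \<delta>2) (T / 4)" using \<delta>1(1) \<delta>2(1) T_pos by simp
    fix s assume s: "s \<in> {0..T}" "\<bar>s - t\<bar> < min (min \<delta>1 \<delta>2) (T / 4)"
    then have "\<bar>s - t\<bar> < \<delta>1 \<and> \<bar>s - t\<bar> < \<delta>2 \<and> \<bar>s - t\<bar> < T / 4"
      by simp
    then have near: "s - t < T / 4" "t - s < T / 4" "\<bar>s - t\<bar> < \<delta>1" "\<bar>s - t\<bar> < \<delta>2"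
      by linarith+
    show "tr_norm T p J (w s - w t) < \<epsilon>"
    proof (cases "t \<le> T / 2")
      case True
      then have "s \<in> {0..3*T/4}" "t \<in> {0..3*T/4}"
        using near s(1) t by (auto simp: field_simps)
      then show ?thesis using near(3) by (rule \<delta>1(2))
    next
      case False
      then have "T - s \<in> {0..3*T/4}" "T - t \<in> {0..3*T/4}"
        using near s(1) t by (auto simp: field_simps)
      from \<delta>2(2)[OF this] near(4) show ?thesis by (simp add: abs_minus_commute)
    qed
  qed
qed

end

section \<open>Variable domains\<close>

text \<open>The difference splits into \<open>B t (A t - A s)\<close> and
  \<open>(B t - B s) A s\<close>. The latter is small in operator norm, because \<open>B\<close> is
  Lipschitz and \<open>A\<close> is bounded.\<close>

lemma rel_cont_compose:
  assumes F: "C1_family T B B' c" and T: "T \<ge> 0" and A: "rel_cont T J A"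
  shows "rel_cont T J (\<lambda>t. B t o\<^sub>L A t)"
  unfolding rel_cont_def
proof (intro ballI allI impI)
  fix t \<epsilon> assume t: "t \<in> {0..T}" and \<epsilon>: "(0::real) < \<epsilon>"
  define b where "b = norm (B 0) + c * T + 1"
  have c: "c \<ge> 0" by (rule C1_family_c[OF F T])
  have b: "b > 0" "\<And>s. s \<in> {0..T} \<Longrightarrow> norm (B s) \<le> b"
  proof -
    show "b > 0" unfolding b_def using c T by (smt (verit) mult_nonneg_nonneg norm_ge_zero)
    show "norm (B s) \<le> b" if "s \<in> {0..T}" for s
      using C1_family_bounded[OF F that] by (simp add: b_def)
  qed
  obtain a where a: "a \<ge> 0" "\<And>s. s \<in> {0..T} \<Longrightarrow> norm (A s) \<le> a"
    using rel_cont_bounded[OF A] by blast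
  have "\<epsilon> / (2 * b) > 0" using \<epsilon> b by simp
  then obtain \<delta> \<eta> where d: "\<delta> > 0" "\<eta> \<ge> 0"
    "\<And>s x. s \<in> {0..T} \<Longrightarrow> \<bar>t - s\<bar> \<le> \<delta> \<Longrightarrow> norm (A t x - A s x) \<le> \<epsilon> / (2 * b) * norm x + \<eta> * norm (J x)"
    using A t unfolding rel_cont_def by metis
  \<comment> \<open>The second bound makes \<open>c * a * \<bar>t - s\<bar>\<close> at most
    \<open>\<epsilon> / 2\<close>; adding 1 keeps the denominator positive.\<close>
  define \<delta>' where "\<delta>' = min \<delta> (\<epsilon> / (2 * (c * a + 1)))"
  have ca: "c * a + 1 > 0" using c a by (simp add: add_nonneg_pos)
  have main: "norm ((B t o\<^sub>L A t) x - (B s o\<^sub>L A s) x) \<le> \<epsilon> * norm x + (b * \<eta>) * norm (J x)"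
    if s: "s \<in> {0..T}" "\<bar>t - s\<bar> \<le> \<delta>'" for s x
  proof -
    have "(B t o\<^sub>L A t) x - (B s o\<^sub>L A s) x = B t (A t x - A s x) + (B t - B s) (A s x)"
      by (simp add: blinfun.diff_right blinfun.diff_left)
    then have "norm ((B t o\<^sub>L A t) x - (B s o\<^sub>L A s) x) \<le> norm (B t (A t x - A s x)) + norm ((B t - B s) (A s x))"
      by (metis norm_triangle_ineq)
    also have "norm (B t (A t x - A s x)) \<le> b * (\<epsilon> / (2 * b) * norm x + \<eta> * norm (J x))"
      using b(1) b(2)[OF t] d(3)[OF s(1)] s(2) by (intro order.trans[OF norm_blinfun] mult_mono) (auto simp: \<delta>'_def)
    also have "\<dots> = \<epsilon> / 2 * norm x + (b * \<eta>) * norm (J x)"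
      using b(1) by (simp add: distrib_left)
    also have "norm ((B t - B s) (A s x)) \<le> \<epsilon> / 2 * norm x"
    proof -
      have "norm ((B t - B s) (A s x)) \<le> norm (B t - B s) * (norm (A s) * norm x)"
        by (intro order.trans[OF norm_blinfun] mult_left_mono norm_blinfun norm_ge_zero)
      also have "\<dots> \<le> (c * \<bar>t - s\<bar>) * (a * norm x)"
        using C1_family_Lipschitz[OF F s(1) t] a(2)[OF s(1)] a(1) c by (intro mult_mono) auto
      also have "\<dots> = (c * a) * \<bar>t - s\<bar> * norm x"
        by simp
      also have "\<dots> \<le> (c * a + 1) * (\<epsilon> / (2 * (c * a + 1))) * norm x"
        using s(2) c a(1) by (intro mult_right_mono mult_mono) (auto simp: \<delta>'_def)
      also have "\<dots> = \<epsilon> / 2 * norm x"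
        using ca by (simp add: field_simps)
      finally show ?thesis .
    qed
    finally show ?thesis by (simp add: algebra_simps)
  qed
  show "\<exists>\<delta>>0. \<exists>\<eta>\<ge>0. \<forall>s\<in>{0..T}. \<bar>t - s\<bar> \<le> \<delta> \<longrightarrow>
      (\<forall>x. norm ((B t o\<^sub>L A t) x - (B s o\<^sub>L A s) x) \<le> \<epsilon> * norm x + \<eta> * norm (J x))"
  proof (rule exI[of _ \<delta>'], intro conjI)
    show "\<delta>' > 0" using d(1) \<epsilon> ca by (simp add: \<delta>'_def)
    show "\<exists>\<eta>\<ge>0. \<forall>s\<in>{0..T}. \<bar>t - s\<bar> \<le> \<delta>' \<longrightarrow>
      (\<forall>x. norm ((B t o\<^sub>L A t) x - (B s o\<^sub>L A s) x) \<le> \<epsilon> * norm x + \<eta> * norm (J x))"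
      using main b(1) d(2) by (intro exI[of _ "b * \<eta>"]) auto
  qed
qed

lemma Lp_norm: "Lp T p f \<Longrightarrow> Lp T p (\<lambda>t. norm (f t))"
  by (simp add: Lp_iff smeas_norm pmass_def)

theorem theorem2p5:
  fixes J :: "'d::banach \<Rightarrow>\<^sub>L 'x::banach"
    and A :: "real \<Rightarrow> ('d \<Rightarrow>\<^sub>L 'x)"
    and B :: "real \<Rightarrow> ('x \<Rightarrow>\<^sub>L 'x)"
    and T p :: real
  assumes T_pos: "T > 0" and p_gt1: "p > 1"
    and J_inj: "inj (blinfun_apply J)"
    and J_dense: "closure (range (blinfun_apply J)) = UNIV"
    and X_RNP: "RNP TYPE('x)"
    and A_meas: "\<forall>x. smeas T (\<lambda>t. A t x)"
    and A_relcont: "rel_cont T J A"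
    and B_C1: "strongly_C1 T B"
    and B_inv: "\<exists>M. \<forall>t\<in>{0..T}. \<exists>Bi :: 'x \<Rightarrow>\<^sub>L 'x.
                  Bi o\<^sub>L B t = id_blinfun \<and> B t o\<^sub>L Bi = id_blinfun \<and> norm Bi \<le> M"
    and BA_MR: "\<forall>t\<in>{0..T}. maxreg T p J (B t o\<^sub>L A t)"
  shows "fam_maxreg T p J A B \<and>
    (\<forall>f x0. Lp T p f \<and> x0 \<in> trace_space T p J \<longrightarrow>
      (let sol = (\<lambda>u. inMRB T p J A B u \<and> B 0 (u 0) = x0 \<and>
                 (\<exists>v. wderiv T p u v \<and>
                   (AE t in lebesgue. t \<in> {0..T} \<longrightarrow> v t + A t (Jinv J (B t (u t))) = f t)))
       in (\<exists>u. sol u \<and> cont_Tr T p J (\<lambda>t. B t (u t))) \<and>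
          (\<forall>u1 u2. sol u1 \<and> sol u2 \<longrightarrow> (\<forall>t\<in>{0..T}. u1 t = u2 t))))"
proof -
  interpret evolution T p J
    by unfold_locales (fact T_pos p_gt1 J_inj)+
  have T0: "0 \<in> {0..T}" "T \<ge> 0" using T_pos by auto
  obtain B' c where F: "C1_family T B B' c"
    using strongly_C1_family[OF T_pos B_C1] by blast
  obtain M where "\<forall>t\<in>{0..T}. \<exists>Bi :: 'x \<Rightarrow>\<^sub>L 'x. Bi o\<^sub>L B t = id_blinfun \<and> B t o\<^sub>L Bi = id_blinfun \<and> norm Bi \<le> M"
    using B_inv by blast
  then obtain Bi :: "real \<Rightarrow> ('x \<Rightarrow>\<^sub>L 'x)" where Bi: "\<And>t. t \<in> {0..T} \<Longrightarrow> Bi t o\<^sub>L B t = id_blinfun"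
    "\<And>t. t \<in> {0..T} \<Longrightarrow> B t o\<^sub>L Bi t = id_blinfun" and M: "\<And>t. t \<in> {0..T} \<Longrightarrow> norm (Bi t) \<le> M"
    by metis
  have inv: "Bi t (B t x) = x" "B t (Bi t x) = x" if "t \<in> {0..T}" for t x
    using Bi[OF that] by (metis blinfun_apply_blinfun_compose id_blinfun.rep_eq id_apply)+
  have M0: "M \<ge> 0" using order.trans[OF norm_ge_zero M[OF T0(1)]] .
  have c0: "c \<ge> 0" by (rule C1_family_c[OF F T0(2)])
  define Bi' where "Bi' t = - (Bi t o\<^sub>L B' t o\<^sub>L Bi t)" for t
  have Fi: "C1_family T Bi Bi' (M * c * M)"
    unfolding Bi'_def by (rule C1_family_inverse[OF F T_pos inv M])
  have B_meas: "smeas T (\<lambda>t. B t x)" for x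
    by (rule smeas_continuous_on[OF C1_family_continuous(2)[OF F continuous_on_const]])
  define b where "b = norm (B 0) + c * T"
  have b: "b \<ge> 0" "\<And>t. t \<in> {0..T} \<Longrightarrow> norm (B t) \<le> b"
    using C1_family_bounded[OF F] c0 T0(2) by (auto simp: b_def)
  define C where "C t = B t o\<^sub>L A t" for t
  define E where "E t = - (B' t o\<^sub>L Bi t)" for t
  interpret nonautonomous T p J C E "c * M"
  proof unfold_locales
    show "smeas T (\<lambda>t. C t x)" for x
      unfolding C_def using smeas_blinfun_family[OF B_meas, of "\<lambda>t. A t x"] A_meas by simp
    show "rel_cont T J C"
      unfolding C_def by (rule rel_cont_compose[OF F T0(2) A_relcont])
    show "maxreg T p J (C t)" if "t \<in> {0..T}" for t
      using BA_MR that by (simp add: C_def)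
    have "continuous_on {0..T} (\<lambda>t. - B' t (Bi t x))" for x
      by (intro continuous_intros C1_family_continuous(1)[OF F] C1_family_continuous(2)[OF Fi])
    then show "smeas T (\<lambda>t. E t x)" for x
      unfolding E_def by (intro smeas_continuous_on) (simp add: blinfun.minus_left)
    show "norm (E t) \<le> c * M" if t: "t \<in> {0..T}" for t
    proof -
      have "norm (B' t) \<le> c" using F t by (simp add: C1_family_def)
      then show ?thesis
        unfolding E_def using M[OF t] c0
        by (simp add: order.trans[OF norm_blinfun_compose] mult_mono)
    qed
  qed
  obtain a where a: "a \<ge> 0" "\<And>t. t \<in> {0..T} \<Longrightarrow> norm (A t) \<le> a"
    using rel_cont_bounded[OF A_relcont] by blast
  obtain k where k: "k \<ge> 0" "\<And>t x. t \<in> {0..T} \<Longrightarrow> norm x \<le> k * (norm (C t x) + norm (J x))"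
    using uniform_graph_bound[OF C_rel C_MR] by blast
  have LpB: "Lp T p (\<lambda>t. B t (f t))" if "Lp T p f" for f
    by (rule Lp_blinfun_family(1)[OF B_meas that p_nonneg(1) b])

  \<comment> \<open>The passage to \<open>B u\<close>, for uniqueness, where nothing but
    \<open>inMRB\<close> is known about the solution.\<close>
  have to_MR: "MR (\<lambda>t. B t (u t)) (\<lambda>t. B' t (u t) + B t (v t)) (\<lambda>t. Jinv J (B t (u t)))"
    and to_eq: "AE t in lebesgue_on {0..T}. (B' t (u t) + B t (v t)) + C t (Jinv J (B t (u t))) + E t (B t (u t)) = B t (f t)"
    if u: "inMRB T p J A B u" and v: "wderiv T p u v"
      and eq: "AE t in lebesgue. t \<in> {0..T} \<longrightarrow> v t + A t (Jinv J (B t (u t))) = f t" for u v f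
  proof -
    let ?w = "\<lambda>t. B t (u t)" and ?g = "\<lambda>t. Jinv J (B t (u t))"
    have vLp: "Lp T p v" and v_int: "\<And>t. t \<in> {0..T} \<Longrightarrow> (v has_integral (u t - u 0)) {0..t}"
      using v by (auto simp: wderiv_def)
    note prod = product_rule[OF F T0(2) p_nonneg(2) vLp v_int]
    have uLp: "Lp T p u" and Ag: "Lp T p (\<lambda>t. A t (?g t))"
      using u by (auto simp: inMRB_def W1p_def)
    have wLp: "Lp T p ?w" by (rule LpB[OF uLp])
    have "AE t in lebesgue. t \<in> {0..T} \<longrightarrow> ?w t \<in> range (blinfun_apply J)"
      using u by (simp add: inMRB_def)
    then have Jg: "AE t in lebesgue_on {0..T}. ?w t = J (?g t)"
      unfolding AE_lebesgue_on_iff by eventually_elim (simp add: Jinv_def f_inv_into_f)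
    have g_meas: "smeas T ?g"
      by (rule smeas_domain[OF C_MR[OF T0(1)] J_dense smeas_cong_AE[OF Lp_smeas[OF wLp] Jg]])
    \<comment> \<open>The uniform graph bound dominates \<open>?g\<close> by
      \<open>C t (?g t)\<close> and \<open>?w\<close>, and \<open>C\<close> differs from
      \<open>A\<close> only by the bounded factor \<open>B\<close>.\<close>
    have "Lp T p ?g"
    proof (rule Lp_bound(1)[OF g_meas])
      show "Lp T p (\<lambda>t. b *\<^sub>R norm (A t (?g t)) + norm (?w t))"
        by (intro Lp_add Lp_scale Lp_norm Ag wLp p_nonneg)
      have "AE t in lebesgue_on {0..T}. t \<in> {0..T}"
        by (rule AE_lebesgue_on_space)
      then show "AE t in lebesgue_on {0..T}. norm (?g t) \<le> k * norm (b *\<^sub>R norm (A t (?g t)) + norm (?w t))"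
        using Jg
      proof eventually_elim
        case (elim t)
        have "norm (?g t) \<le> k * (norm (C t (?g t)) + norm (J (?g t)))"
          by (rule k(2)[OF elim(1)])
        also have "\<dots> \<le> k * (b * norm (A t (?g t)) + norm (?w t))"
          using k(1) b(2)[OF elim(1)] elim(2)
          by (intro mult_left_mono add_mono) (auto simp: C_def intro!: order.trans[OF norm_blinfun] mult_right_mono)
        finally show ?case using b(1) by simp
      qed
    qed (use p_nonneg k in auto)
    then show "MR ?w (\<lambda>t. B' t (u t) + B t (v t)) ?g"
      unfolding MR_def using prod Jg by blast
    have "AE t in lebesgue_on {0..T}. t \<in> {0..T}"
      by (rule AE_lebesgue_on_space)
    then show "AE t in lebesgue_on {0..T}. (B' t (u t) + B t (v t)) + C t (?g t) + E t (?w t) = B t (f t)"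
      using eq[folded AE_lebesgue_on_iff]
    proof eventually_elim
      case (elim t)
      show ?case
        unfolding elim(2)[symmetric] using inv[OF elim(1)]
        by (simp add: C_def E_def blinfun.add_right blinfun.minus_left)
    qed
  qed

  \<comment> \<open>The way back, for existence; the product rule is now applied to the inverse
    family and its derivative \<open>Bi'\<close>.\<close>
  have from_MR: "inMRB T p J A B (\<lambda>t. Bi t (w t))" "wderiv T p (\<lambda>t. Bi t (w t)) (\<lambda>t. Bi' t (w t) + Bi t (v t))"
    "AE t in lebesgue. t \<in> {0..T} \<longrightarrow> (Bi' t (w t) + Bi t (v t)) + A t (Jinv J (B t (Bi t (w t)))) = f t"
    if MR: "MR w v g" and eq: "AE t in lebesgue_on {0..T}. v t + C t (g t) + E t (w t) = B t (f t)" for w v g f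
  proof -
    have vLp: "Lp T p v" "Lp T p g" and v_int: "\<And>t. t \<in> {0..T} \<Longrightarrow> (v has_integral (w t - w 0)) {0..t}"
      using MR by (auto simp: MR_def)
    note prod = product_rule[OF Fi T0(2) p_nonneg(2) vLp(1) v_int]
    show wd: "wderiv T p (\<lambda>t. Bi t (w t)) (\<lambda>t. Bi' t (w t) + Bi t (v t))"
      unfolding wderiv_def using prod by blast
    have space: "AE t in lebesgue_on {0..T}. t \<in> {0..T}"
      by (rule AE_lebesgue_on_space)
    have g_eq: "AE t in lebesgue_on {0..T}. g t = Jinv J (B t (Bi t (w t)))"
      using space MR_inMR(3)[OF MR]
    proof eventually_elim
      case (elim t)
      then show ?case using inv(2)[OF elim(1)] by simp
    qed
    have Ag: "Lp T p (\<lambda>t. A t (g t))"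
      using A_meas by (intro Lp_blinfun_family(1)[OF _ vLp(2) p_nonneg(1) a]) auto
    show "inMRB T p J A B (\<lambda>t. Bi t (w t))"
      unfolding inMRB_def W1p_def
    proof (intro conjI)
      show "Lp T p (\<lambda>t. Bi t (w t))"
        by (rule Lp_continuous_on[OF C1_family_continuous(2)[OF Fi MR_continuous[OF MR]] p_nonneg(1)])
      show "\<exists>v. wderiv T p (\<lambda>t. Bi t (w t)) v" using wd by blast
      have "AE t in lebesgue_on {0..T}. w t = J (g t)"
        using MR by (simp add: MR_def)
      with space have "AE t in lebesgue_on {0..T}. B t (Bi t (w t)) \<in> range (blinfun_apply J)"
        by eventually_elim (simp add: inv)
      then show "AE t in lebesgue. t \<in> {0..T} \<longrightarrow> B t (Bi t (w t)) \<in> range (blinfun_apply J)"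
        unfolding AE_lebesgue_on_iff .
      show "Lp T p (\<lambda>t. A t (Jinv J (B t (Bi t (w t)))))"
        by (rule Lp_cong_AE[OF Ag]) (use g_eq in \<open>eventually_elim, simp\<close>)
    qed
    have "AE t in lebesgue_on {0..T}. (Bi' t (w t) + Bi t (v t)) + A t (Jinv J (B t (Bi t (w t)))) = f t"
      using space g_eq eq
    proof eventually_elim
      case (elim t)
      have "v t = B t (f t) - B t (A t (g t)) + B' t (Bi t (w t))"
        using elim(3) by (simp add: C_def E_def blinfun.minus_left algebra_simps)
      then have "Bi t (v t) = f t - A t (g t) + Bi t (B' t (Bi t (w t)))"
        using inv(1)[OF elim(1)] by (simp add: blinfun.add_right blinfun.diff_right)
      then show ?case
        unfolding elim(2)[symmetric] by (simp add: Bi'_def blinfun.minus_left)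
    qed
    then show "AE t in lebesgue. t \<in> {0..T} \<longrightarrow> (Bi' t (w t) + Bi t (v t)) + A t (Jinv J (B t (Bi t (w t)))) = f t"
      unfolding AE_lebesgue_on_iff .
  qed

  \<comment> \<open>With \<open>x0 = 0\<close> this also covers the zero initial value of
    \<open>fam_maxreg\<close>, by injectivity of \<open>B 0\<close>.\<close>
  define sol where "sol f x0 u \<longleftrightarrow> inMRB T p J A B u \<and> B 0 (u 0) = x0 \<and>
      (\<exists>v. wderiv T p u v \<and> (AE t in lebesgue. t \<in> {0..T} \<longrightarrow> v t + A t (Jinv J (B t (u t))) = f t))" for f x0 u
  have exist: "\<exists>u. sol f x0 u \<and> cont_Tr T p J (\<lambda>t. B t (u t))" if f: "Lp T p f" and x0: "x0 \<in> trace_space T p J" for f x0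
  proof -
    \<comment> \<open>An element of the trace space is the initial value of some \<open>W\<close> in
      the maximal regularity space; subtracting \<open>W\<close> leaves data in L^p and a zero
      initial value.\<close>
    obtain W where W: "inMR T p J W" "W 0 = x0"
      using x0 unfolding trace_space_def by blast
    then obtain V where "wderiv T p W V"
      by (auto simp: inMR_def W1p_def)
    then have MRW: "MR W V (\<lambda>t. Jinv J (W t))" (is "MR W V ?G")
      by (rule inMR_MR[OF W(1)])
    then have "Lp T p V" "Lp T p ?G" "Lp T p W"
      using MR_Lp[OF MRW] by (auto simp: MR_def)
    then have "Lp T p (\<lambda>t. B t (f t) - (V t + C t (?G t) + E t (W t)))"
      by (intro Lp_diff Lp_add Lp_C Lp_E LpB f p_nonneg)
    then obtain z v g where N: "NSol T (\<lambda>t. B t (f t) - (V t + C t (?G t) + E t (W t))) z v g"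
      using NSol_exists by blast
    let ?w = "\<lambda>t. W t + z t"
    have MRw: "MR ?w (\<lambda>t. V t + v t) (\<lambda>t. ?G t + g t)" and z0: "z 0 = 0"
      using MR_add[OF MRW] N by (auto simp: NSol_def)
    have "AE t in lebesgue_on {0..T}. v t + C t (g t) + E t (z t) = B t (f t) - (V t + C t (?G t) + E t (W t))"
      using N by (simp add: NSol_def)
    then have "AE t in lebesgue_on {0..T}. (V t + v t) + C t (?G t + g t) + E t (?w t) = B t (f t)"
    proof eventually_elim
      case (elim t)
      have "(V t + v t) + C t (?G t + g t) + E t (?w t)
          = (V t + C t (?G t) + E t (W t)) + (v t + C t (g t) + E t (z t))"
        by (simp add: blinfun.add_right)
      then show ?case using elim by simp
    qed
    note S = from_MR[OF MRw this]
    have "B 0 (Bi 0 (?w 0)) = x0"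
      using inv(2)[OF T0(1)] W(2) z0 by simp
    then have "sol f x0 (\<lambda>t. Bi t (?w t))"
      unfolding sol_def using S by blast
    \<comment> \<open>On [0, T], the only times at which \<open>cont_Tr\<close> looks,
      \<open>B t (Bi t (?w t))\<close> is \<open>?w t\<close>.\<close>
    moreover have "cont_Tr T p J (\<lambda>t. B t (Bi t (?w t)))"
      using MR_cont_Tr[OF MRw] inv(2) by (simp add: cont_Tr_def)
    ultimately show ?thesis by blast
  qed
  have unique: "u1 t = u2 t" if u1: "sol f x0 u1" and u2: "sol f x0 u2" and t: "t \<in> {0..T}" for f x0 u1 u2 t
  proof -
    obtain v1 v2 where v: "inMRB T p J A B u1" "wderiv T p u1 v1"
      "AE t in lebesgue. t \<in> {0..T} \<longrightarrow> v1 t + A t (Jinv J (B t (u1 t))) = f t"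
      "inMRB T p J A B u2" "wderiv T p u2 v2"
      "AE t in lebesgue. t \<in> {0..T} \<longrightarrow> v2 t + A t (Jinv J (B t (u2 t))) = f t"
      and B0: "B 0 (u1 0) = x0" "B 0 (u2 0) = x0"
      using u1 u2 unfolding sol_def by blast
    \<comment> \<open>Both transformed solutions have the data \<open>B t (f t)\<close>, so their
      difference solves the homogeneous equation and is compared with zero.\<close>
    let ?w = "\<lambda>t. B t (u1 t) - B t (u2 t)"
      and ?v = "\<lambda>t. (B' t (u1 t) + B t (v1 t)) - (B' t (u2 t) + B t (v2 t))"
      and ?g = "\<lambda>t. Jinv J (B t (u1 t)) - Jinv J (B t (u2 t))"
    have "MR ?w ?v ?g"
      by (rule MR_diff[OF to_MR[OF v(1-3)] to_MR[OF v(4-6)]])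
    moreover have "AE t in lebesgue_on {0..T}. ?v t + C t (?g t) + E t (?w t) = 0"
      using to_eq[OF v(1-3)] to_eq[OF v(4-6)]
    proof eventually_elim
      case (elim t)
      have "?v t + C t (?g t) + E t (?w t) =
          ((B' t (u1 t) + B t (v1 t)) + C t (Jinv J (B t (u1 t))) + E t (B t (u1 t)))
          - ((B' t (u2 t) + B t (v2 t)) + C t (Jinv J (B t (u2 t))) + E t (B t (u2 t)))"
        by (simp add: blinfun.diff_right)
      then show ?case using elim by simp
    qed
    ultimately have "NSol T (\<lambda>_. 0) ?w ?v ?g"
      using B0 by (simp add: NSol_def)
    moreover have "NSol T (\<lambda>_. 0) (\<lambda>_. 0) (\<lambda>_. 0) (\<lambda>_. 0)"
      by (simp add: NSol_def MR_zero)
    ultimately have "?w t = 0"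
      using t by (rule NSol_unique)
    then show ?thesis
      using inv(1)[OF t] by (metis eq_iff_diff_eq_0)
  qed
  have B0: "B 0 x = 0 \<longleftrightarrow> x = 0" for x
    using inv(1)[OF T0(1), of x] by auto
  have "0 \<in> trace_space T p J"
    unfolding trace_space_def using MR_inMR(1)[OF MR_zero] by force
  then have zero_sol: "\<exists>u. sol f 0 u" if "Lp T p f" for f
    using exist[OF that] by blast
  have "fam_maxreg T p J A B"
    unfolding fam_maxreg_def Let_def
  proof (intro allI impI)
    fix f :: "real \<Rightarrow> 'x" assume f: "Lp T p f"
    have sol0: "sol f 0 = (\<lambda>u. inMRB T p J A B u \<and> u 0 = 0 \<and>
        (\<exists>v. wderiv T p u v \<and> (AE t in lebesgue. t \<in> {0..T} \<longrightarrow> v t + A t (Jinv J (B t (u t))) = f t)))"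
      by (auto simp: sol_def B0 fun_eq_iff)
    show "(\<exists>u. inMRB T p J A B u \<and> u 0 = 0 \<and>
          (\<exists>v. wderiv T p u v \<and> (AE t in lebesgue. t \<in> {0..T} \<longrightarrow> v t + A t (Jinv J (B t (u t))) = f t))) \<and>
        (\<forall>u1 u2. (inMRB T p J A B u1 \<and> u1 0 = 0 \<and>
          (\<exists>v. wderiv T p u1 v \<and> (AE t in lebesgue. t \<in> {0..T} \<longrightarrow> v t + A t (Jinv J (B t (u1 t))) = f t))) \<and>
          (inMRB T p J A B u2 \<and> u2 0 = 0 \<and>
          (\<exists>v. wderiv T p u2 v \<and> (AE t in lebesgue. t \<in> {0..T} \<longrightarrow> v t + A t (Jinv J (B t (u2 t))) = f t))) \<longrightarrow>
          (\<forall>t\<in>{0..T}. u1 t = u2 t))"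
      using zero_sol[OF f] unique[of f 0] unfolding sol0 by blast
  qed
  moreover have "\<forall>f x0. Lp T p f \<and> x0 \<in> trace_space T p J \<longrightarrow>
      (\<exists>u. sol f x0 u \<and> cont_Tr T p J (\<lambda>t. B t (u t))) \<and>
      (\<forall>u1 u2. sol f x0 u1 \<and> sol f x0 u2 \<longrightarrow> (\<forall>t\<in>{0..T}. u1 t = u2 t))"
    using exist unique by blast
  ultimately show ?thesis
    unfolding sol_def Let_def by (rule conjI)
qed

end
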